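(* Let $D\ge 1$ and let $(G,\mu)$ be a $D$-dimensional Vicsek graph. For $p\in(1,\infty)$ put $$\gamma^*(p):=\frac{1}{D+1}+\frac1p\Big(1-\frac{2}{D+1}\Big).$$ Then: (1) for every $p\in(1,\infty)$ and every $\gamma$ with $0<\gamma<\gamma^*(p)$, the inequality $(\mathrm R_{p,\gamma})$ holds and the inequality $(\mathrm{RR}_{p,\gamma})$ fails; (2) for every $p\in(1,\infty)$ and every $\gamma$ with $\gamma^*(p)<\gamma<1$, the inequality $(\mathrm R_{p,\gamma})$ fails and the inequality $(\mathrm{RR}_{p,\gamma})$ holds. Here $(\mathrm R_{p,\gamma})$ is the statement: there is $C>0$ such that $\|\nabla f\|_{L^p(G)}\le C\|\Delta^\gamma f\|_{L^p(G)}$ for all finitely supported functions $f$ on $G$; and $(\mathrm{RR}_{p,\gamma})$ is the statement: there is $C>0$ such that $\|\Delta^\gamma f\|_{L^p(G)}\le C\|\nabla f\|_{L^p(G)}$ for all finitely supported functions $f$ on $G$.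
   Context: Graphs. $G$ is an infinite set with a symmetric weight $\mu_{xy}=\mu_{yx}\ge0$ on $G\times G$; $E_G=\{(x,y):\mu_{xy}>0\}$; $x\sim y$ means $(x,y)\in E_G$ ($x\sim x$ is allowed). $\delta(x,y)$ is the length of a shortest path from $x$ to $y$, and $G$ is assumed connected ($\delta<\infty$). $m(x):=\sum_{y\sim x}\mu_{xy}$ (finite), $m(E)=\sum_{x\in E}m(x)$, $B(x,r)=\{y:\delta(x,y)<r\}$, $V(x,r)=m(B(x,r))$, and $\|f\|_{L^p(G)}=(\sum_x|f(x)|^pm(x))^{1/p}$. Operators. $\nabla f(x,y)=f(x)-f(y)$ for $(x,y)\in E_G$; $|\nabla f|(x)=\big(\frac1{2m(x)}\sum_{y\sim x}\mu_{xy}|f(x)-f(y)|^2\big)^{1/2}$, and $\|\nabla f\|_{L^p(G)}$ means $\|\,|\nabla f|\,\|_{L^p(G)}$. $Pf(x)=\frac1{m(x)}\sum_{y\sim x}\mu_{xy}f(y)$ and $\Delta=I-P$, a bounded nonnegative self-adjoint operator on $L^2(G)$; $\Delta^\gamma$ is defined by functional calculus. The kernels $p_k$ are defined by $P^kf(x)=\sum_y p_k(x,y)f(y)m(y)$ for $k\ge 0$ (so $p_0(x,y)=\mathbf 1_{x=y}/m(y)$, $p_1(x,y)=\mu_{xy}/(m(x)m(y))$). Vicsek graphs. For $D\ge1$, $(G,\mu)$ is a $D$-dimensional Vicsek graph if all of the following hold. - Tree: for any $N\ge3$ and any $(x_0,\dots,x_N)\in G^{N+1}$ with $x_0=x_N$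 and $(x_{i-1},x_i)\in E_G$ for $1\le i\le N$, there are $1\le i<j\le N$ with $x_i=x_j$. - (AR)$_D$: there is $C>0$ with $C^{-1}(1+r)^D\le V(x,r)\le C(1+r)^D$ for all $x\in G$, $r>0$. - (LB): $(x,x)\in E_G$ for all $x\in G$ and there is $\epsilon>0$ with $\mu_{xy}\ge\epsilon m(x)$ for all $(x,y)\in E_G$. - (UE)$_\beta$ with $\beta=D+1$: there are $C,c>0$ with $p_{k-1}(x,y)\le \frac{C}{V(x,k^{1/\beta})}\exp\big(-c[\delta(x,y)^\beta/k]^{1/(\beta-1)}\big)$ for all $x,y\in G$ and integers $k\ge1$. *)

theory Defs
  imports "HOL-Analysis.Analysis" "HOL-Computational_Algebra.Polynomial"
begin

section \<open>Weighted graphs\<close>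

text \<open>The vertex set is the whole type \<open>'a\<close>; the graph is given by its weight \<open>\<mu>\<close>.\<close>

definition adj :: "('a \<Rightarrow> 'a \<Rightarrow> real) \<Rightarrow> 'a \<Rightarrow> 'a \<Rightarrow> bool" where
  "adj \<mu> x y \<longleftrightarrow> \<mu> x y > 0"

definition vmeas :: "('a \<Rightarrow> 'a \<Rightarrow> real) \<Rightarrow> 'a \<Rightarrow> real" where
  "vmeas \<mu> x = (\<Sum>\<^sub>\<infinity>y\<in>{y. adj \<mu> x y}. \<mu> x y)"

definition weighted_graph :: "('a \<Rightarrow> 'a \<Rightarrow> real) \<Rightarrow> bool" where
  "weighted_graph \<mu> \<longleftrightarrow>
     infinite (UNIV :: 'a set) \<and>
     (\<forall>x y. \<mu> x y = \<mu> y x) \<and>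
     (\<forall>x y. \<mu> x y \<ge> 0) \<and>
     (\<forall>x. (\<lambda>y. \<mu> x y) summable_on {y. adj \<mu> x y}) \<and>
     (\<forall>x y. (adj \<mu>)\<^sup>*\<^sup>* x y)"

text \<open>The graph distance; the minimum is over a nonempty set when the graph is connected.\<close>

definition gdist :: "('a \<Rightarrow> 'a \<Rightarrow> real) \<Rightarrow> 'a \<Rightarrow> 'a \<Rightarrow> nat" where
  "gdist \<mu> x y = (LEAST n. (adj \<mu> ^^ n) x y)"

definition gball :: "('a \<Rightarrow> 'a \<Rightarrow> real) \<Rightarrow> 'a \<Rightarrow> real \<Rightarrow> 'a set" where
  "gball \<mu> x r = {y. real (gdist \<mu> x y) < r}"

definition vol :: "('a \<Rightarrow> 'a \<Rightarrow> real) \<Rightarrow> 'a \<Rightarrow> real \<Rightarrow> real" where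
  "vol \<mu> x r = (\<Sum>\<^sub>\<infinity>y\<in>gball \<mu> x r. vmeas \<mu> y)"

definition Lp_norm :: "('a \<Rightarrow> 'a \<Rightarrow> real) \<Rightarrow> real \<Rightarrow> ('a \<Rightarrow> real) \<Rightarrow> ennreal" where
  "Lp_norm \<mu> p f =
     (if (\<lambda>x. \<bar>f x\<bar> powr p * vmeas \<mu> x) summable_on UNIV
      then ennreal ((\<Sum>\<^sub>\<infinity>x. \<bar>f x\<bar> powr p * vmeas \<mu> x) powr (1 / p))
      else \<infinity>)"

definition L2 :: "('a \<Rightarrow> 'a \<Rightarrow> real) \<Rightarrow> ('a \<Rightarrow> real) set" where
  "L2 \<mu> = {u. Lp_norm \<mu> 2 u < \<infinity>}"


section \<open>Gradient, Markov operator, Laplacian\<close>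

definition grad_length :: "('a \<Rightarrow> 'a \<Rightarrow> real) \<Rightarrow> ('a \<Rightarrow> real) \<Rightarrow> 'a \<Rightarrow> real" where
  "grad_length \<mu> f x =
     sqrt (1 / (2 * vmeas \<mu> x) * (\<Sum>\<^sub>\<infinity>y\<in>{y. adj \<mu> x y}. \<mu> x y * \<bar>f x - f y\<bar>\<^sup>2))"

definition markov :: "('a \<Rightarrow> 'a \<Rightarrow> real) \<Rightarrow> ('a \<Rightarrow> real) \<Rightarrow> 'a \<Rightarrow> real" where
  "markov \<mu> f x = 1 / vmeas \<mu> x * (\<Sum>\<^sub>\<infinity>y\<in>{y. adj \<mu> x y}. \<mu> x y * f y)"

definition laplacian :: "('a \<Rightarrow> 'a \<Rightarrow> real) \<Rightarrow> ('a \<Rightarrow> real) \<Rightarrow> 'a \<Rightarrow> real" where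
  "laplacian \<mu> f x = f x - markov \<mu> f x"

text \<open>
  The kernel of \<open>P\<^sup>k\<close> with respect to the vertex measure. The defining identity
  \<open>P\<^sup>k f(x) = (\<Sum>y. p\<^sub>k(x,y) f(y) m(y))\<close>, applied to the indicator function of \<open>{y}\<close>,
  determines \<open>p\<^sub>k(x,y)\<close> and gives the formula below.
\<close>

definition heat_kernel :: "('a \<Rightarrow> 'a \<Rightarrow> real) \<Rightarrow> nat \<Rightarrow> 'a \<Rightarrow> 'a \<Rightarrow> real" where
  "heat_kernel \<mu> k x y = (markov \<mu> ^^ k) (indicator {y}) x / vmeas \<mu> y"


section \<open>Functional calculus on \<open>L\<^sup>2\<close>\<close>

text \<open>
  The spectrum of a bounded operator on the Hilbert space \<open>L\<^sup>2\<close>. By the open mapping theorem a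
  bijective bounded operator has a bounded inverse, so bijectivity is all that has to be required.
  The operators considered are self-adjoint, so only real spectral values occur.
\<close>

definition L2_spectrum ::
  "('a \<Rightarrow> 'a \<Rightarrow> real) \<Rightarrow> (('a \<Rightarrow> real) \<Rightarrow> ('a \<Rightarrow> real)) \<Rightarrow> real set" where
  "L2_spectrum \<mu> T = {s. \<not> bij_betw (\<lambda>u x. s * u x - T u x) (L2 \<mu>) (L2 \<mu>)}"

definition poly_operator ::
  "real poly \<Rightarrow> (('a \<Rightarrow> real) \<Rightarrow> ('a \<Rightarrow> real)) \<Rightarrow> ('a \<Rightarrow> real) \<Rightarrow> 'a \<Rightarrow> real" where
  "poly_operator q T u x = (\<Sum>i\<le>degree q. coeff q i * (T ^^ i) u x)"

text \<open>
  The continuous functional calculus of a bounded self-adjoint operator \<open>T\<close>: the map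
  \<open>q \<mapsto> q(T)\<close> on polynomials is isometric for the supremum norm on the spectrum of \<open>T\<close>, and
  \<open>\<phi>(T)\<close> is its extension by continuity to continuous \<open>\<phi>\<close>. Thus \<open>\<phi>(T) u\<close> is the \<open>L\<^sup>2\<close>-limit of
  \<open>q\<^sub>n(T) u\<close> for every sequence of polynomials \<open>q\<^sub>n\<close> converging to \<open>\<phi>\<close> uniformly on the spectrum.
  Since the vertex measure is positive at every vertex, \<open>L\<^sup>2\<close>-limits are unique as functions.
\<close>

definition functional_calculus ::
  "('a \<Rightarrow> 'a \<Rightarrow> real) \<Rightarrow> (real \<Rightarrow> real) \<Rightarrow> (('a \<Rightarrow> real) \<Rightarrow> ('a \<Rightarrow> real))
     \<Rightarrow> ('a \<Rightarrow> real) \<Rightarrow> ('a \<Rightarrow> real)" where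
  "functional_calculus \<mu> \<phi> T u =
     (THE g. g \<in> L2 \<mu> \<and>
        (\<forall>q :: nat \<Rightarrow> real poly.
           uniform_limit (L2_spectrum \<mu> T) (\<lambda>n. poly (q n)) \<phi> sequentially \<longrightarrow>
           (\<lambda>n. Lp_norm \<mu> 2 (\<lambda>x. poly_operator (q n) T u x - g x)) \<longlonglongrightarrow> 0))"

definition laplacian_power ::
  "('a \<Rightarrow> 'a \<Rightarrow> real) \<Rightarrow> real \<Rightarrow> ('a \<Rightarrow> real) \<Rightarrow> ('a \<Rightarrow> real)" where
  "laplacian_power \<mu> \<gamma> f = functional_calculus \<mu> (\<lambda>t. t powr \<gamma>) (laplacian \<mu>) f"


section \<open>Vicsek graphs\<close>

definition tree_condition :: "('a \<Rightarrow> 'a \<Rightarrow> real) \<Rightarrow> bool" where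
  "tree_condition \<mu> \<longleftrightarrow>
     (\<forall>N\<ge>3. \<forall>x :: nat \<Rightarrow> 'a.
        x 0 = x N \<and> (\<forall>i\<in>{1..N}. adj \<mu> (x (i - 1)) (x i)) \<longrightarrow>
        (\<exists>i j. 1 \<le> i \<and> i < j \<and> j \<le> N \<and> x i = x j))"

definition ahlfors_regular :: "real \<Rightarrow> ('a \<Rightarrow> 'a \<Rightarrow> real) \<Rightarrow> bool" where
  "ahlfors_regular D \<mu> \<longleftrightarrow>
     (\<exists>C>0. \<forall>x. \<forall>r>0. inverse C * (1 + r) powr D \<le> vol \<mu> x r \<and> vol \<mu> x r \<le> C * (1 + r) powr D)"

definition LB_condition :: "('a \<Rightarrow> 'a \<Rightarrow> real) \<Rightarrow> bool" where
  "LB_condition \<mu> \<longleftrightarrow>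
     (\<forall>x. adj \<mu> x x) \<and> (\<exists>\<epsilon>>0. \<forall>x y. adj \<mu> x y \<longrightarrow> \<mu> x y \<ge> \<epsilon> * vmeas \<mu> x)"

definition UE_condition :: "real \<Rightarrow> ('a \<Rightarrow> 'a \<Rightarrow> real) \<Rightarrow> bool" where
  "UE_condition \<beta> \<mu> \<longleftrightarrow>
     (\<exists>C>0. \<exists>c>0. \<forall>x y. \<forall>k\<ge>1.
        heat_kernel \<mu> (k - 1) x y \<le>
          C / vol \<mu> x (real k powr (1 / \<beta>)) *
          exp (- c * (real (gdist \<mu> x y) powr \<beta> / real k) powr (1 / (\<beta> - 1))))"

definition vicsek_graph :: "real \<Rightarrow> ('a \<Rightarrow> 'a \<Rightarrow> real) \<Rightarrow> bool" where
  "vicsek_graph D \<mu> \<longleftrightarrow>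
     weighted_graph \<mu> \<and> tree_condition \<mu> \<and> ahlfors_regular D \<mu> \<and>
     LB_condition \<mu> \<and> UE_condition (D + 1) \<mu>"


section \<open>The inequalities\<close>

definition R_ineq :: "('a \<Rightarrow> 'a \<Rightarrow> real) \<Rightarrow> real \<Rightarrow> real \<Rightarrow> bool" where
  "R_ineq \<mu> p \<gamma> \<longleftrightarrow>
     (\<exists>C>0. \<forall>f. finite {x. f x \<noteq> 0} \<longrightarrow>
        Lp_norm \<mu> p (grad_length \<mu> f) \<le> ennreal C * Lp_norm \<mu> p (laplacian_power \<mu> \<gamma> f))"

definition RR_ineq :: "('a \<Rightarrow> 'a \<Rightarrow> real) \<Rightarrow> real \<Rightarrow> real \<Rightarrow> bool" where
  "RR_ineq \<mu> p \<gamma> \<longleftrightarrow>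
     (\<exists>C>0. \<forall>f. finite {x. f x \<noteq> 0} \<longrightarrow>
        Lp_norm \<mu> p (laplacian_power \<mu> \<gamma> f) \<le> ennreal C * Lp_norm \<mu> p (grad_length \<mu> f))"

definition gamma_star :: "real \<Rightarrow> real \<Rightarrow> real" where
  "gamma_star D p = 1 / (D + 1) + 1 / p * (1 - 2 / (D + 1))"

end

theory Submission
  imports Defs "HOL-Computational_Algebra.Fundamental_Theorem_Algebra"
begin

text \<open>
  Write \<open>\<beta> = D + 1\<close>. For \<open>0 < \<gamma> < 1\<close> the power series of \<open>(1 - t) powr \<gamma>\<close> gives
  \<open>\<Delta>\<^sup>\<gamma> = \<Sum> a\<^sub>k P\<^sup>k\<close> with absolutely summable \<open>a\<^sub>k\<close>, and conversely
  \<open>\<nabla>f = \<Sum> c\<^sub>k \<nabla>P\<^sup>k \<Delta>\<^sup>\<gamma> f\<close> with \<open>c\<^sub>k \<le> (k + 1) powr (\<gamma> - 1)\<close>, and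
  \<open>\<Delta>\<^sup>\<gamma> f = \<Sum> c'\<^sub>k P\<^sup>k \<Delta> f\<close> with \<open>c'\<^sub>k \<le> (k + 1) powr (-\<gamma>)\<close>. Both positive results follow by
  summing norm bounds for \<open>\<nabla>P\<^sup>k\<close> and for its adjoint.

  Spectral theory on \<open>L\<^sup>2\<close> and the heat kernel bound control the time derivative
  \<open>p\<^sub>k - p\<^sub>k\<^sub>+\<^sub>1\<close>. In a tree an edge separates the graph, so the difference of \<open>p\<^sub>k(\<cdot>, w)\<close> across an
  edge is the sum of the time derivative over the far side of the edge. Summing over \<open>w\<close> gives the
  bound \<open>k powr (-1 / \<beta> + \<epsilon>)\<close> for \<open>\<nabla>P\<^sup>k\<close> on \<open>L\<^sup>\<infinity>\<close>. Summing over edges counts the time derivative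
  at \<open>z\<close> once for every edge between \<open>z\<close> and \<open>w\<close>, which gives the bound
  \<open>k powr (1 / \<beta> - 1 + \<epsilon>)\<close> on \<open>L\<^sup>1\<close>. The Schur test interpolates to \<open>k powr (-\<gamma>\<^sup>* + \<epsilon>)\<close> on \<open>L\<^sup>p\<close>.

  If one of the inequalities held on the wrong side of \<open>\<gamma>\<^sup>*\<close>, then combined with a positive result it
  would bound \<open>\<Delta>\<^sup>\<gamma> f\<close> by \<open>\<Delta>\<^sup>\<gamma>\<^sup>' f\<close> for some \<open>\<gamma> < \<gamma>'\<close>, which heat kernels at large times refute.
\<close>

section \<open>Polynomials of a bounded symmetric operator\<close>

text \<open>The definition of \<open>laplacian_power\<close> tests every polynomial sequence that
  converges on the spectrum, so it determines a function only once the norm of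
  \<open>q(\<Delta>)\<close> is bounded by the supremum of \<open>|q|\<close> on the spectrum. That
  bound is proved for real symmetric operators from the factorisation of real polynomials, with no
  spectral measure. The loops confine the spectrum to \<open>[0, 2 - 2 eps]\<close>; near 2 the
  function \<open>t * |1 - t|^k\<close> does not decay, so the decay \<open>1 / k\<close> of
  \<open>\<Delta> P^k\<close>, on which every kernel estimate rests, depends on this gap.

  The losses \<open>\<epsilon>\<close> in the exponents have one origin: the sub-Gaussian tail is
  not integrated but cut at radius \<open>k powr (1 / \<beta> + \<epsilon>)\<close>, beyond which it
  is smaller than any power. They do no harm because the theorem leaves out the critical exponent.

  The two positive results are dual: \<open>gamma_star D p\<close> and its value at the conjugate
  exponent of \<open>p\<close> add up to 1, so the same kernel, once as it stands and once
  transposed, serves both.\<close>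

definition poly_op :: "real poly \<Rightarrow> ('h \<Rightarrow> 'h) \<Rightarrow> 'h::real_vector \<Rightarrow> 'h" where
  "poly_op q T u = (\<Sum>i\<le>degree q. coeff q i *\<^sub>R (T ^^ i) u)"

lemma poly_op_altdef:
  assumes "degree q \<le> n"
  shows "poly_op q T u = (\<Sum>i\<le>n. coeff q i *\<^sub>R (T ^^ i) u)"
  unfolding poly_op_def
  by (rule sum.mono_neutral_left) (use assms in \<open>auto simp: coeff_eq_0\<close>)

lemma poly_op_0 [simp]: "poly_op 0 T u = 0"
  by (simp add: poly_op_def)

lemma poly_op_pCons [simp]:
  assumes "linear T"
  shows "poly_op (pCons a q) T u = a *\<^sub>R u + T (poly_op q T u)"
proof -
  have "poly_op (pCons a q) T u = (\<Sum>i\<le>Suc (degree q). coeff (pCons a q) i *\<^sub>R (T ^^ i) u)"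
    by (rule poly_op_altdef) (simp add: degree_pCons_le)
  also have "\<dots> = a *\<^sub>R u + T (poly_op q T u)"
    by (simp add: sum.atMost_Suc_shift poly_op_def linear_sum[OF assms] linear_scale[OF assms]
        del: sum.atMost_Suc)
  finally show ?thesis .
qed

lemma poly_op_add: "poly_op (p + q) T u = poly_op p T u + poly_op q T u"
proof -
  define n where "n = max (degree p) (degree q)"
  have "degree (p + q) \<le> n" "degree p \<le> n" "degree q \<le> n"
    by (auto simp: n_def degree_add_le_max)
  then show ?thesis
    by (simp add: poly_op_altdef[where n = n] scaleR_left_distrib sum.distrib)
qed

lemma poly_op_smult: "poly_op (smult a p) T u = a *\<^sub>R poly_op p T u"
  by (subst poly_op_altdef[where n = "degree p"]) (simp_all add: degree_smult_le scaleR_sum_right poly_op_def)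

lemma poly_op_diff: "poly_op (p - q) T u = poly_op p T u - poly_op q T u"
  using poly_op_add[of "p - q" q T u] by simp

lemma poly_op_mult:
  assumes "linear T"
  shows "poly_op (p * q) T u = poly_op p T (poly_op q T u)"
  by (induction p) (simp_all add: assms poly_op_add poly_op_smult)

lemma bounded_linear_poly_op:
  assumes "bounded_linear T"
  shows "bounded_linear (poly_op q T)"
proof (induction q)
  case 0
  then show ?case by (simp add: poly_op_def[abs_def])
next
  case (pCons a q)
  have "poly_op (pCons a q) T = (\<lambda>u. a *\<^sub>R u + T (poly_op q T u))"
    using assms by (auto simp: bounded_linear.linear)
  then show ?case
    using pCons.IH
    by (auto intro!: bounded_linear_add bounded_linear_compose[OF assms] bounded_linear_scaleR_right)
qed

lemma poly_op_symmetric: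
  assumes "\<And>u v. T u \<bullet> v = u \<bullet> T (v :: 'h :: real_inner)"
  shows "poly_op q T u \<bullet> v = u \<bullet> poly_op q T v"
proof -
  have "(T ^^ i) u \<bullet> v = u \<bullet> (T ^^ i) v" for i
    by (induction i arbitrary: u v) (simp_all add: assms funpow_swap1)
  then show ?thesis
    by (simp add: poly_op_def inner_sum_left inner_sum_right)
qed

section \<open>Invertibility of coercive operators and of symmetric surjective ones\<close>

lemma coercive_imp_bij:
  fixes A :: "'h::{real_inner,banach} \<Rightarrow> 'h"
  assumes A: "bounded_linear A" and c: "c > 0" "\<And>u. c * (u \<bullet> u) \<le> A u \<bullet> u"
  shows "bij A"
proof (rule bijI)
  interpret A: bounded_linear A by fact
  show "inj A"
  proof (rule injI)
    fix u v assume "A u = A v"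
    then have "A (u - v) = 0" by (simp add: A.diff)
    then have "c * ((u - v) \<bullet> (u - v)) \<le> 0" using c(2)[of "u - v"] by simp
    then have "(u - v) \<bullet> (u - v) \<le> 0" using c(1) by (simp add: mult_le_0_iff)
    then have "(norm (u - v))\<^sup>2 \<le> 0" by (simp only: power2_norm_eq_inner)
    then show "u = v" by simp
  qed
  obtain K where K: "K > 0" "\<And>u. norm (A u) \<le> norm u * K"
    using A.pos_bounded by blast
  define M where "M = max K c"
  have M: "M > 0" "c \<le> M" "\<And>u. norm (A u) \<le> M * norm u"
    using K c(1) by (auto simp: M_def)
      (metis K(2) max.cobounded1 mult.commute mult_left_mono norm_ge_zero order_trans)
  \<comment> \<open>Lax-Milgram by iteration: this \<open>\<tau>\<close> minimises
    \<open>1 - 2 * \<tau> * c + (\<tau> * M)^2\<close>, the bound for the squared contraction factor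
    of \<open>x - \<tau> (A x - w)\<close>, and the minimum is \<open>1 - (c / M)^2\<close>.\<close>
  define \<tau> where "\<tau> = c / M\<^sup>2"
  define k where "k = sqrt (1 - (c / M)\<^sup>2)"
  have cM: "0 < c / M" "c / M \<le> 1" using M c by auto
  then have "0 < (c/M)\<^sup>2" "(c / M)\<^sup>2 \<le> 1"
    by (auto simp: power_le_one)
  then have k: "0 \<le> k" "k < 1" "k\<^sup>2 = 1 - (c / M)\<^sup>2"
    by (auto simp: k_def intro!: real_sqrt_lt_1_iff[THEN iffD2] )
  have contr: "norm (d - \<tau> *\<^sub>R A d) \<le> k * norm d" for d
  proof (rule power2_le_imp_le)
    have "(norm (d - \<tau> *\<^sub>R A d))\<^sup>2 = (norm d)\<^sup>2 - 2 * \<tau> * (A d \<bullet> d) + \<tau>\<^sup>2 * (norm (A d))\<^sup>2"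
      unfolding power2_norm_eq_inner
      by (simp add: inner_diff_left inner_diff_right inner_commute power2_eq_square algebra_simps)
    also have "\<dots> \<le> (norm d)\<^sup>2 - 2 * \<tau> * (c * (norm d)\<^sup>2) + \<tau>\<^sup>2 * (M * norm d)\<^sup>2"
    proof -
      have "2 * \<tau> * (c * (norm d)\<^sup>2) \<le> 2 * \<tau> * (A d \<bullet> d)"
        using c M by (intro mult_left_mono) (auto simp: \<tau>_def power2_norm_eq_inner)
      moreover have "\<tau>\<^sup>2 * (norm (A d))\<^sup>2 \<le> \<tau>\<^sup>2 * (M * norm d)\<^sup>2"
        by (intro mult_left_mono power_mono M(3)) auto
      ultimately show ?thesis by linarith
    qed
    also have "\<dots> = (k * norm d)\<^sup>2"
      using M(1) by (simp add: power_mult_distrib k(3)) (simp add: \<tau>_def field_simps power2_eq_square)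
    finally show "(norm (d - \<tau> *\<^sub>R A d))\<^sup>2 \<le> (k * norm d)\<^sup>2" .
  qed (use k in auto)
  show "surj A"
  proof (rule surjI)
    fix w
    have "\<exists>!x. x - \<tau> *\<^sub>R (A x - w) = x"
    proof (rule banach_fix_type[OF k(1,2)], intro allI)
      fix x y
      have "dist (x - \<tau> *\<^sub>R (A x - w)) (y - \<tau> *\<^sub>R (A y - w)) = norm ((x - y) - \<tau> *\<^sub>R A (x - y))"
        by (simp add: dist_norm A.diff algebra_simps)
      then show "dist (x - \<tau> *\<^sub>R (A x - w)) (y - \<tau> *\<^sub>R (A y - w)) \<le> k * dist x y"
        using contr by (simp add: dist_norm)
    qed
    then have "\<exists>x. A x = w" using c M by (auto simp: \<tau>_def)
    then show "A (SOME x. A x = w) = w" by (rule someI_ex)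
  qed
qed

text \<open>A gliding hump replaces the uniform boundedness principle.\<close>

lemma gliding_hump:
  fixes w :: "nat \<Rightarrow> 'h::{real_inner,banach}"
  assumes w: "\<And>n. norm (w n) = 1"
  obtains z where "\<And>n. (1/3)^n / 2 \<le> \<bar>z \<bullet> w n\<bar>"
proof -
  \<comment> \<open>The sign makes step \<open>n\<close> push the product with \<open>w n\<close>
    away from 0, so it reaches size \<open>(1/3)^n\<close> whatever the earlier steps did; all later
    steps together move it by at most half of that.\<close>
  define zz where "zz = rec_nat (w 0) (\<lambda>n z. z + ((if z \<bullet> w (Suc n) \<ge> 0 then 1 else -1) * (1/3)^Suc n) *\<^sub>R w (Suc n))"
  have zz0: "zz 0 = w 0" and zzS: "zz (Suc n) = zz n + ((if zz n \<bullet> w (Suc n) \<ge> 0 then 1 else -1) * (1/3)^Suc n) *\<^sub>R w (Suc n)" for n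
    by (simp_all add: zz_def)
  have ww: "w n \<bullet> w n = 1" for n using w[of n] by (simp add: dot_square_norm)
  have big: "\<bar>zz n \<bullet> w n\<bar> \<ge> (1/3)^n" for n
  proof (cases n)
    case 0 then show ?thesis by (simp add: zz0 ww)
  next
    case (Suc k)
    have "zz n \<bullet> w n = zz k \<bullet> w n + (if zz k \<bullet> w n \<ge> 0 then 1 else -1) * (1/3)^n"
      by (simp add: Suc zzS inner_add_left ww)
    moreover have "(0::real) < (1/3)^n" by simp
    ultimately show ?thesis
      by (auto split: if_splits simp: abs_if)
  qed
  define d where "d n = zz (Suc n) - zz n" for n
  have nd: "norm (d n) = (1/3)^Suc n" for n
    by (simp add: d_def zzS w abs_mult)
  have geo: "(\<lambda>n. (1/3)^Suc n) sums (1/2 :: real)"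
    using sums_mult[OF geometric_sums[of "1/3::real"], of "1/3"] by simp
  have sd: "summable (\<lambda>n. norm (d n))"
    using geo by (simp add: nd sums_iff)
  define z where "z = w 0 + suminf d"
  have zzsum: "zz n = w 0 + (\<Sum>k<n. d k)" for n
    by (induction n) (simp_all add: zz0 d_def)
  have tail: "norm (z - zz n) \<le> (1/3)^n / 2" for n
  proof -
    have s: "summable (\<lambda>k. norm (d (k + n)))"
      using sd by (subst summable_iff_shift[of "\<lambda>k. norm (d k)"])
    have "z - zz n = (\<Sum>k. d (k + n))"
      using suminf_minus_initial_segment[OF summable_norm_cancel[OF sd], of n]
      by (simp add: z_def zzsum)
    also have "norm \<dots> \<le> (\<Sum>k. norm (d (k + n)))"
      by (rule summable_norm[OF s])
    also have "\<dots> = (\<Sum>k. (1/3)^n * (1/3)^Suc k)"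
      by (simp add: nd power_add mult.commute)
    also have "\<dots> = (1/3)^n / 2"
      using sums_unique[OF sums_mult[OF geo, of "(1/3)^n"]] by simp
    finally show ?thesis .
  qed
  have "(1/3)^n / 2 \<le> \<bar>z \<bullet> w n\<bar>" for n
  proof -
    have "\<bar>(z - zz n) \<bullet> w n\<bar> \<le> norm (z - zz n) * norm (w n)"
      by (rule Cauchy_Schwarz_ineq2)
    then have "\<bar>z \<bullet> w n - zz n \<bullet> w n\<bar> \<le> (1/3)^n / 2"
      using tail[of n] w[of n] by (simp add: inner_diff_left)
    with big[of n] show ?thesis by linarith
  qed
  then show ?thesis by (rule that)
qed

text \<open>Otherwise there are unit vectors \<open>w n\<close> with
  \<open>norm (A (w n)) \<le> (1/4)^n\<close>. The vector \<open>z\<close> of the gliding hump is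
  some \<open>A y\<close>, and by symmetry its product with \<open>w n\<close> is at most
  \<open>norm y * (1/4)^n\<close>, eventually below \<open>(1/3)^n / 2\<close>.\<close>

lemma symmetric_surj_bounded_below:
  fixes A :: "'h::{real_inner,banach} \<Rightarrow> 'h"
  assumes A: "linear A" and sym: "\<And>u v. A u \<bullet> v = u \<bullet> A v" and surj: "surj A"
  obtains c where "c > 0" "\<And>u. c * norm u \<le> norm (A u)"
proof -
  have "\<exists>c>0. \<forall>u. c * norm u \<le> norm (A u)"
  proof (rule ccontr)
    assume "\<not> ?thesis"
    then have "\<exists>u. norm (A u) < (1/4)^n * norm u" for n :: nat
      by (auto simp: not_le dest: spec[of _ "(1/4)^n"])
    then obtain u where u: "\<And>n :: nat. norm (A (u n)) < (1/4)^n * norm (u n)" by metis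
    define w where "w n = (1 / norm (u n)) *\<^sub>R u n" for n
    have pos: "norm (u n) > 0" for n
      using u[of n] linear_0[OF A] by (cases "u n = 0") auto
    have w1: "norm (w n) = 1" for n using pos[of n] by (simp add: w_def)
    have Aw: "norm (A (w n)) \<le> (1/4)^n" for n
      using u[of n] pos[of n] by (simp add: w_def linear_scale[OF A] field_simps)
    obtain z where z: "\<And>n. (1/3)^n / 2 \<le> \<bar>z \<bullet> w n\<bar>"
      using gliding_hump[of w] w1 by blast
    obtain y where y: "z = A y" using surj by auto
    have le: "(1/3)^n / 2 \<le> norm y * (1/4)^n" for n
    proof -
      have "(1/3)^n / 2 \<le> \<bar>y \<bullet> A (w n)\<bar>" using z[of n] by (simp add: y sym)
      also have "\<dots> \<le> norm y * norm (A (w n))" by (rule Cauchy_Schwarz_ineq2)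
      also have "\<dots> \<le> norm y * (1/4)^n" by (intro mult_left_mono Aw) auto
      finally show ?thesis .
    qed
    have "(4/3)^n \<le> 2 * norm y" for n :: nat
      using le[of n] by (simp add: power_divide field_simps)
    moreover obtain n where "2 * norm y < (4/3)^n"
      using real_arch_pow[of "4/3"] by auto
    ultimately show False by (meson not_less)
  qed
  then show ?thesis using that by blast
qed

section \<open>Spectral mapping for polynomials and the norm bound on the spectrum\<close>

definition spec_real :: "('h::real_vector \<Rightarrow> 'h) \<Rightarrow> real set" where
  "spec_real T = {s. \<not> bij (\<lambda>u. s *\<^sub>R u - T u)}"

text \<open>Induction on the degree, splitting off a real factor that belongs to a complex root of
  \<open>Q\<close>. A real root lies outside the spectrum, so its linear factor is bijective by
  definition; a non-real root \<open>a + i b\<close> yields \<open>(T - a)^2 + b^2\<close>, which is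
  coercive.\<close>

lemma bij_poly_op:
  fixes T :: "'h::{real_inner,banach} \<Rightarrow> 'h"
  assumes T: "bounded_linear T" and sym: "\<And>u v. T u \<bullet> v = u \<bullet> T v"
    and "Q \<noteq> 0" "\<And>s. s \<in> spec_real T \<Longrightarrow> poly Q s \<noteq> 0"
  shows "bij (poly_op Q T)"
  using assms(3,4)
proof (induction "degree Q" arbitrary: Q rule: less_induct)
  case less
  have lin: "linear T" using T by (rule bounded_linear.linear)
  show ?case
  proof (cases "degree Q = 0")
    case True
    then obtain a where a: "Q = [:a:]" "a \<noteq> 0" using less.prems(1) by (auto elim: degree_eq_zeroE)
    have "poly_op Q T = (\<lambda>u. a *\<^sub>R u)" using lin by (auto simp: a linear_0)
    moreover have "bij (\<lambda>u::'h. a *\<^sub>R u)"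
      by (rule o_bij[where g = "\<lambda>u. (1/a) *\<^sub>R u"]) (use a in \<open>auto simp: fun_eq_iff\<close>)
    ultimately show ?thesis by simp
  next
    case False
    have step: "bij (poly_op Q T)" if R: "Q = R * Q'" "degree R > 0" "bij (poly_op R T)" for R Q'
    proof -
      have nz: "R \<noteq> 0" "Q' \<noteq> 0" using R less.prems by auto
      have "degree Q' < degree Q" using R nz by (simp add: degree_mult_eq)
      moreover have "poly Q' s \<noteq> 0" if "s \<in> spec_real T" for s
        using less.prems(2)[OF that] by (simp add: R)
      ultimately have "bij (poly_op Q' T)" using less.hyps nz by blast
      moreover have "poly_op Q T = poly_op R T \<circ> poly_op Q' T"
        by (auto simp: R poly_op_mult[OF lin])
      ultimately show ?thesis using R(3) by (simp add: bij_comp)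
    qed
    \<comment> \<open>Evaluation of a real polynomial at a complex number is an instance of
      \<open>poly_op\<close>, for multiplication by \<open>z\<close> on the real vector space of
      complex numbers, so sum and product rules carry over.\<close>
    let ?E = "\<lambda>p z. poly_op p (\<lambda>u::complex. z * u) 1"
    have linz: "linear (\<lambda>u::complex. z * u)" for z
      by (simp add: bounded_linear.linear bounded_linear_mult_right)
    have E: "?E p z = poly (map_poly of_real p) z" for p z
    proof -
      have "((\<lambda>u. z * u) ^^ i) 1 = z ^ i" for i by (induction i) auto
      then show ?thesis
        by (simp add: poly_op_def poly_altdef coeff_map_poly scaleR_conv_of_real degree_map_poly)
    qed
    have "\<not> constant (poly (map_poly of_real Q :: complex poly))"
      using False by (simp add: constant_degree degree_map_poly)
    then obtain z where "poly (map_poly of_real Q) z = (0::complex)"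
      using fundamental_theorem_of_algebra by blast
    then have Ez: "?E Q z = 0" by (simp add: E)
    show ?thesis
    proof (cases "Im z = 0")
      case True
      have "of_real (poly Q (Re z)) = ?E Q (of_real (Re z))"
      proof -
        have "(((\<lambda>u. of_real (Re z) * u)) ^^ i) 1 = (of_real (Re z ^ i) :: complex)" for i
          by (induction i) auto
        then show ?thesis
          by (simp add: poly_op_def poly_altdef scaleR_conv_of_real)
      qed
      also have "of_real (Re z) = z" using True by (simp add: complex_eq_iff)
      finally have root: "poly Q (Re z) = 0" using Ez by (simp del: of_real_eq_iff add: of_real_eq_0_iff)
      then have "Re z \<notin> spec_real T" using less.prems(2) by blast
      then have b: "bij (\<lambda>u. Re z *\<^sub>R u - T u)" by (simp add: spec_real_def)
      have "poly_op [:- Re z, 1:] T = uminus \<circ> (\<lambda>u. Re z *\<^sub>R u - T u)"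
        using lin by (auto simp: linear_0 fun_eq_iff)
      then have "bij (poly_op [:- Re z, 1:] T)"
        using bij_comp[OF b bij_uminus] by simp
      moreover from root obtain Q' where "Q = [:- Re z, 1:] * Q'"
        by (auto simp: poly_eq_0_iff_dvd)
      ultimately show ?thesis using step[of "[:- Re z, 1:]" Q'] by auto
    next
      case im: False
      define a b where "a = Re z" and "b = Im z"
      define R :: "real poly" where "R = [:a\<^sup>2 + b\<^sup>2, -2 * a, 1:]"
      have degR: "degree R = 2" by (simp add: R_def)
      have ER: "poly_op R (\<lambda>u::complex. z * u) v = 0" for v
      proof -
        have "z * (z * v) = of_real (2 * a) * (z * v) - of_real (a\<^sup>2 + b\<^sup>2) * v"
        proof -
          have "z * z = of_real (2 * a) * z - of_real (a\<^sup>2 + b\<^sup>2)"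
            by (simp add: complex_eq_iff a_def b_def power2_eq_square)
          then show ?thesis by (metis (no_types, lifting) left_diff_distrib mult.assoc)
        qed
        then show ?thesis
          using linz[of z] unfolding R_def
          by (simp add: scaleR_conv_of_real algebra_simps)
      qed
      have "Q = R * (Q div R) + Q mod R" by simp
      then have "?E Q z = ?E (R * (Q div R)) z + ?E (Q mod R) z" by (metis poly_op_add)
      then have r0: "?E (Q mod R) z = 0" using Ez by (simp add: poly_op_mult[OF linz] ER)
      have "degree (Q mod R) < 2"
        using degree_mod_less'[of R Q] degR by (cases "Q mod R = 0") (auto simp: R_def)
      then obtain c d where cd: "Q mod R = [:c, d:]"
        by (metis One_nat_def Suc_1 degree_eq_zeroE degree_pCons_eq_if less_2_cases pCons_cases old.nat.inject zero_neq_one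
            pCons_0_0)
      \<comment> \<open>The remainder modulo the minimal polynomial \<open>R\<close> of
        \<open>z\<close> is linear with real coefficients; vanishing at a non-real point, it is
        0.\<close>
      have "of_real c + of_real d * z = 0"
        using r0 linz[of z] by (simp add: cd scaleR_conv_of_real mult.commute)
      then have "d = 0 \<and> c = 0" using im by (auto simp: complex_eq_iff)
      then have QR: "Q = R * (Q div R)" using cd \<open>Q = R * (Q div R) + Q mod R\<close> by simp
      have "bij (poly_op R T)"
      proof (rule coercive_imp_bij[OF bounded_linear_poly_op[OF T]])
        show "b\<^sup>2 > 0" using im by (simp add: b_def)
        fix u
        have "poly_op R T u \<bullet> u = (norm (T u - a *\<^sub>R u))\<^sup>2 + b\<^sup>2 * (u \<bullet> u)"
        proof -
          have "T (T u) \<bullet> u = T u \<bullet> T u" by (rule sym)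
          then show ?thesis
            using lin unfolding power2_norm_eq_inner by (simp add: R_def linear_0 linear_diff linear_scale inner_diff_left
                inner_diff_right inner_add_left inner_add_right inner_commute power2_eq_square algebra_simps)
        qed
        then show "b\<^sup>2 * (u \<bullet> u) \<le> poly_op R T u \<bullet> u" by simp
      qed
      then show ?thesis using step QR degR by (metis zero_less_numeral)
    qed
  qed
qed

text \<open>The norm \<open>\<lambda>\<close> of a symmetric operator \<open>S\<close> makes \<open>\<lambda>\<^sup>2 - S\<^sup>2\<close> not bounded below.\<close>

lemma norm_poly_op_le_aux:
  fixes T :: "'h::{real_inner,banach} \<Rightarrow> 'h"
  assumes T: "bounded_linear T" and sym: "\<And>u v. T u \<bullet> v = u \<bullet> T v"
    and M: "\<And>s. s \<in> spec_real T \<Longrightarrow> \<bar>poly q s\<bar> \<le> M" "M \<ge> 0" "degree q > 0"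
  shows "norm (poly_op q T u) \<le> M * norm u"
proof -
  define S where "S = poly_op q T"
  have lin: "linear T" using T by (rule bounded_linear.linear)
  have S: "bounded_linear S" unfolding S_def by (rule bounded_linear_poly_op[OF T])
  have symS: "S u \<bullet> v = u \<bullet> S v" for u v unfolding S_def by (rule poly_op_symmetric[OF sym])
  define l where "l = onorm S"
  have Sl: "norm (S u) \<le> l * norm u" for u unfolding l_def by (rule onorm[OF S])
  have "l \<le> M"
  proof (rule ccontr)
    assume "\<not> l \<le> M"
    then have l: "l > M" "l > 0" using M(2) by auto
    define Q where "Q = [:l\<^sup>2:] - q * q"
    have "degree (q * q) > 0" using M(3) by (metis degree_0 degree_mult_eq add_gr_0 less_numeral_extra(3))
    then have Q0: "Q \<noteq> 0" unfolding Q_def by (metis degree_pCons_0 eq_iff_diff_eq_0 less_numeral_extra(3))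
    have "bij (poly_op Q T)"
    proof (rule bij_poly_op[OF T sym Q0])
      fix s assume "s \<in> spec_real T"
      then have "\<bar>poly q s\<bar> < \<bar>l\<bar>" using M(1)[of s] l by simp
      then have "(poly q s)\<^sup>2 < l\<^sup>2" using power_strict_mono[of "\<bar>poly q s\<bar>" l 2] l by simp
      then show "poly Q s \<noteq> 0" by (simp add: Q_def power2_eq_square)
    qed
    then obtain c where c: "c > 0" "\<And>u. c * norm u \<le> norm (poly_op Q T u)"
      using symmetric_surj_bounded_below[of "poly_op Q T"] poly_op_symmetric[OF sym]
        bounded_linear_poly_op[OF T] by (metis bij_is_surj bounded_linear.linear)
    have Qu: "poly_op Q T u = l\<^sup>2 *\<^sub>R u - S (S u)" for u
      using lin by (simp add: Q_def poly_op_diff poly_op_mult S_def linear_0)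
    \<comment> \<open>Expanding the square of \<open>norm (l\<^sup>2 *\<^sub>R u - S (S u))\<close>
      and using \<open>norm (S (S u)) \<le> l * norm (S u)\<close> turns the lower bound
      \<open>c\<close> into a bound for \<open>S\<close> strictly below its norm
      \<open>l\<close>.\<close>
    have SS: "(norm (S u))\<^sup>2 \<le> (l\<^sup>2 - c\<^sup>2 / (2 * l\<^sup>2)) * (norm u)\<^sup>2" for u
    proof -
      have "(c * norm u)\<^sup>2 \<le> (norm (poly_op Q T u))\<^sup>2" using c by (intro power_mono) auto
      also have "\<dots> = l^4 * (norm u)\<^sup>2 - 2 * l\<^sup>2 * (norm (S u))\<^sup>2 + (norm (S (S u)))\<^sup>2"
      proof -
        have "S (S u) \<bullet> u = S u \<bullet> S u" by (rule symS)
        then show ?thesis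
          unfolding Qu power2_norm_eq_inner
          by (simp add: inner_simps inner_commute power2_eq_square power4_eq_xxxx algebra_simps)
      qed
      also have "(norm (S (S u)))\<^sup>2 \<le> (l * norm (S u))\<^sup>2" by (intro power_mono Sl) auto
      finally have "c\<^sup>2 * (norm u)\<^sup>2 \<le> l^4 * (norm u)\<^sup>2 - l\<^sup>2 * (norm (S u))\<^sup>2 * 2 + l\<^sup>2 * (norm (S u))\<^sup>2"
        by (simp add: power_mult_distrib algebra_simps)
      moreover have "l\<^sup>2 * ((l\<^sup>2 - c\<^sup>2 / l\<^sup>2) * (norm u)\<^sup>2) = l^4 * (norm u)\<^sup>2 - c\<^sup>2 * (norm u)\<^sup>2"
        using l by (simp add: field_simps power2_eq_square power4_eq_xxxx)
      ultimately have "l\<^sup>2 * (norm (S u))\<^sup>2 \<le> l\<^sup>2 * ((l\<^sup>2 - c\<^sup>2 / l\<^sup>2) * (norm u)\<^sup>2)"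
        by linarith
      then have "(norm (S u))\<^sup>2 \<le> (l\<^sup>2 - c\<^sup>2 / l\<^sup>2) * (norm u)\<^sup>2" using l by simp
      also have "\<dots> \<le> (l\<^sup>2 - c\<^sup>2 / (2 * l\<^sup>2)) * (norm u)\<^sup>2"
        using l by (intro mult_right_mono) (auto simp: field_simps)
      finally show ?thesis .
    qed
    define e where "e = l\<^sup>2 - c\<^sup>2 / (2 * l\<^sup>2)"
    have Se: "norm (S u) \<le> sqrt (max 0 e) * norm u" for u
    proof (rule power2_le_imp_le)
      have "(norm (S u))\<^sup>2 \<le> e * (norm u)\<^sup>2" using SS by (simp add: e_def)
      also have "\<dots> \<le> max 0 e * (norm u)\<^sup>2" by (intro mult_right_mono) auto
      finally show "(norm (S u))\<^sup>2 \<le> (sqrt (max 0 e) * norm u)\<^sup>2" by (simp add: power_mult_distrib)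
    qed auto
    have "l \<le> sqrt (max 0 e)" unfolding l_def by (rule onorm_bound[OF _ Se]) simp
    moreover have "sqrt (max 0 e) < l"
    proof (rule real_sqrt_less_mono[THEN less_le_trans])
      show "max 0 e < l\<^sup>2" using l c by (auto simp: e_def)
    qed (use l in auto)
    ultimately show False by simp
  qed
  then show ?thesis using Sl[of u] M(2) unfolding S_def
    by (meson mult_right_mono norm_ge_zero order_trans)
qed

text \<open>For constant polynomials the hypothesis says nothing unless the spectrum is nonempty. If
  it were empty, the bound for the polynomial \<open>t\<close> would give \<open>T = 0\<close>,
  whose spectrum contains 0.\<close>

lemma norm_poly_op_le:
  fixes T :: "'h::{real_inner,banach} \<Rightarrow> 'h"
  assumes T: "bounded_linear T" and sym: "\<And>u v. T u \<bullet> v = u \<bullet> T v"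
    and M: "\<And>s. s \<in> spec_real T \<Longrightarrow> \<bar>poly q s\<bar> \<le> M" "M \<ge> 0"
  shows "norm (poly_op q T u) \<le> M * norm u"
proof (cases "degree q = 0 \<and> u \<noteq> 0")
  case False
  then show ?thesis
    using norm_poly_op_le_aux[OF T sym M] linear_0[OF bounded_linear.linear[OF bounded_linear_poly_op[OF T]]]
    by (cases "u = 0") auto
next
  case True
  have lin: "linear T" using T by (rule bounded_linear.linear)
  obtain a where a: "q = [:a:]" using True by (auto elim: degree_eq_zeroE)
  have "spec_real T \<noteq> {}"
  proof
    assume "spec_real T = {}"
    then have "norm (poly_op [:0, 1:] T v) \<le> 0 * norm v" for v
      by (intro norm_poly_op_le_aux[OF T sym]) auto
    then have "T v = 0" for v using lin by (simp add: linear_0)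
    then have "0 \<in> spec_real T"
      using True by (auto simp: spec_real_def bij_def inj_def)
    then show False using \<open>spec_real T = {}\<close> by simp
  qed
  then have "\<bar>a\<bar> \<le> M" using M(1) by (auto simp: a)
  then show ?thesis using lin by (simp add: a linear_0 mult_right_mono)
qed

section \<open>Binomial coefficients of negative order\<close>

text \<open>\<open>neg_binom s k\<close> is the coefficient of \<open>t\<^sup>k\<close> in \<open>(1 - t) powr (-s)\<close>.\<close>

definition neg_binom :: "real \<Rightarrow> nat \<Rightarrow> real" where
  "neg_binom s k = pochhammer s k / fact k"

lemma neg_binom_0 [simp]: "neg_binom s 0 = 1"
  by (simp add: neg_binom_def)

lemma neg_binom_Suc: "neg_binom s (Suc k) = neg_binom s k * (s + real k) / (real k + 1)"
  by (simp add: neg_binom_def pochhammer_Suc field_simps)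

lemma neg_binom_gbinomial: "neg_binom s k = (-1)^k * (-s gchoose k)"
  by (simp add: neg_binom_def gbinomial_pochhammer)

lemma neg_binom_convolution: "(\<Sum>i\<le>n. neg_binom s i * neg_binom t (n - i)) = neg_binom (s + t) n"
proof -
  have "(\<Sum>i\<le>n. neg_binom s i * neg_binom t (n - i)) = (-1)^n * (\<Sum>i=0..n. (-s gchoose i) * (-t gchoose (n - i)))"
    unfolding sum_distrib_left atLeast0AtMost
  proof (rule sum.cong)
    fix i assume "i \<in> {..n}"
    then have "(-1::real)^n = (-1)^i * (-1)^(n - i)" by (simp flip: power_add)
    then show "neg_binom s i * neg_binom t (n - i) = (-1)^n * ((-s gchoose i) * (-t gchoose (n - i)))"
      by (simp add: neg_binom_gbinomial)
  qed simp
  also have "\<dots> = neg_binom (s + t) n"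
    by (simp add: gbinomial_Vandermonde neg_binom_gbinomial add.commute)
  finally show ?thesis .
qed

lemma neg_binom_zero: "neg_binom 0 n = (if n = 0 then 1 else 0)"
  by (simp add: neg_binom_def pochhammer_0_left)

text \<open>Partial summation multiplies the generating function by
  \<open>(1 - t) powr (-1)\<close>, whose coefficients are all 1.\<close>

lemma sum_neg_binom: "(\<Sum>i\<le>n. neg_binom s i) = neg_binom (s + 1) n"
  using neg_binom_convolution[of s 1 n] by (simp add: neg_binom_def[of 1] pochhammer_fact[symmetric])

lemma neg_binom_pos: "0 < s \<Longrightarrow> 0 < neg_binom s k"
  by (simp add: neg_binom_def pochhammer_pos)

text \<open>Induction through quotients of consecutive terms: with \<open>x = k + 1\<close> the
  quotient \<open>1 - (1 - s) / x\<close> is at most \<open>(1 + 1 / x) powr (s - 1)\<close>, by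
  \<open>ln (1 + u) \<le> u\<close> and \<open>1 + v \<le> exp v\<close>.\<close>

lemma neg_binom_le:
  assumes "0 < s" "s < 1"
  shows "neg_binom s k \<le> (real k + 1) powr (s - 1)"
proof (induction k)
  case 0
  then show ?case by simp
next
  case (Suc k)
  define x where "x = real k + 1"
  have x: "x > 0" by (simp add: x_def)
  have "(s + real k) / (real k + 1) \<le> ((real k + 2) / (real k + 1)) powr (s - 1)"
  proof -
    have "1 - (1 - s) * (1 / x) \<le> (1 + 1 / x) powr (s - 1)"
    proof -
      have "ln (1 + 1/x) \<le> 1/x" using x by (intro ln_add_one_self_le_self) simp
      then have "(1 - s) * ln (1 + 1/x) \<le> (1 - s) * (1/x)" using assms by (intro mult_left_mono) auto
      then have "1 - (1 - s) * (1/x) \<le> 1 + (s - 1) * ln (1 + 1/x)" by (simp add: algebra_simps)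
      also have "\<dots> \<le> exp ((s - 1) * ln (1 + 1/x))" by (rule exp_ge_add_one_self)
      also have "\<dots> = (1 + 1 / x) powr (s - 1)"
      proof -
        have "1 + 1 / x > 0" using x by (simp add: add_pos_pos)
        then show ?thesis by (simp add: powr_def)
      qed
      finally show ?thesis .
    qed
    moreover have "(s + real k) / (real k + 1) = 1 - (1 - s) * (1 / x)" "(real k + 2) / (real k + 1) = 1 + 1 / x"
      by (auto simp: x_def field_simps)
    ultimately show ?thesis by simp
  qed
  then have "neg_binom s (Suc k) \<le> (real k + 1) powr (s - 1) * ((real k + 2) / (real k + 1)) powr (s - 1)"
    unfolding neg_binom_Suc times_divide_eq_right[symmetric]
    using Suc assms by (intro mult_mono) auto
  also have "\<dots> = (real (Suc k) + 1) powr (s - 1)"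
    by (subst powr_mult[symmetric]) (auto simp: add.commute)
  finally show ?case .
qed

lemma neg_binom_neg:
  assumes "0 < s" "s < 1"
  shows "neg_binom (- s) (Suc k) < 0"
proof (induction k)
  case (Suc k)
  then show ?case unfolding neg_binom_Suc[of _ "Suc k"]
    using assms by (intro divide_neg_pos mult_neg_pos) auto
qed (use assms in \<open>simp add: neg_binom_Suc\<close>)

lemma neg_binom_tendsto_0:
  assumes "0 < s" "s < 1"
  shows "neg_binom s \<longlonglongrightarrow> 0"
proof (rule tendsto_sandwich[of "\<lambda>_. 0" _ _ "\<lambda>k. (real k + 1) powr (s - 1)"])
  show "(\<lambda>k. (real k + 1) powr (s - 1)) \<longlonglongrightarrow> 0"
  proof (rule tendsto_neg_powr)
    show "filterlim (\<lambda>k. real k + 1) at_top sequentially"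
      using filterlim_compose[OF filterlim_real_sequentially filterlim_Suc] by (simp add: add.commute)
  qed (use assms in auto)
qed (use assms in \<open>auto intro!: always_eventually simp: neg_binom_le less_imp_le[OF neg_binom_pos]\<close>)

text \<open>Only the coefficient of index 0 is positive, and it is 1. The absolute values therefore
  add up to 2 minus a partial sum, and that partial sum is a positive coefficient of order
  \<open>1 - s\<close>.\<close>

lemma neg_binom_abs_summable:
  assumes "0 < s" "s < 1"
  shows "summable (\<lambda>k. \<bar>neg_binom (- s) k\<bar>)"
proof (rule bounded_imp_summable)
  fix n
  have "(\<Sum>k\<le>n. \<bar>neg_binom (- s) k\<bar>) = 2 - (\<Sum>k\<le>n. neg_binom (- s) k)"
  proof (induction n)
    case (Suc n)
    then show ?case using neg_binom_neg[OF assms, of n] by simp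
  qed simp
  then show "(\<Sum>k\<le>n. \<bar>neg_binom (- s) k\<bar>) \<le> 2"
    using neg_binom_pos[of "1 - s" n] assms by (simp add: sum_neg_binom)
qed simp

lemma neg_binom_sums_0:
  assumes "0 < s" "s < 1"
  shows "neg_binom (- s) sums 0"
  unfolding sums_def_le sum_neg_binom using neg_binom_tendsto_0[of "1 - s"] assms by simp

lemma neg_binom_sums_powr:
  assumes s: "0 < s" "s < 1" and t: "0 \<le> t" "t < 2"
  shows "(\<lambda>k. neg_binom (- s) k * (1 - t)^k) sums (t powr s)"
\<comment> \<open>At \<open>t = 0\<close> the binomial series is at the edge of its disc of
  convergence; there the coefficients themselves have to be summed.\<close>
proof (cases "t = 0")
  case True
  then show ?thesis using neg_binom_sums_0[OF s] by simp
next
  case False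
  then have "(\<lambda>n. (s gchoose n) * (t - 1)^n) sums (1 + (t - 1)) powr s"
    using t by (intro gen_binomial_real) auto
  moreover have "(s gchoose n) * (t - 1)^n = neg_binom (- s) n * (1 - t)^n" for n
  proof -
    have "(t - 1)^n = (-1)^n * (1 - t)^n" by (simp flip: power_mult_distrib)
    then show ?thesis by (simp add: neg_binom_gbinomial)
  qed
  ultimately show ?thesis by simp
qed

lemma neg_binom_uniform_limit:
  assumes s: "0 < s" "s < 1" and \<delta>: "\<delta> > 0"
  shows "uniform_limit {0..2 - \<delta>} (\<lambda>n t. \<Sum>k<n. neg_binom (- s) k * (1 - t)^k) (\<lambda>t. t powr s) sequentially"
proof -
  have "uniform_limit {0..2 - \<delta>} (\<lambda>n t. \<Sum>k<n. neg_binom (- s) k * (1 - t)^k)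
      (\<lambda>t. \<Sum>k. neg_binom (- s) k * (1 - t)^k) sequentially"
  proof (rule Weierstrass_m_test[OF _ neg_binom_abs_summable[OF s]])
    fix n t assume "t \<in> {0..2 - \<delta>}"
    then have "\<bar>1 - t\<bar> ^ n \<le> 1" using \<delta> by (intro power_le_one) auto
    then show "norm (neg_binom (- s) n * (1 - t) ^ n) \<le> \<bar>neg_binom (- s) n\<bar>"
      by (simp add: abs_mult power_abs mult_left_le)
  qed
  moreover have "(\<Sum>k. neg_binom (- s) k * (1 - t)^k) = t powr s" if "t \<in> {0..2 - \<delta>}" for t
    by (rule sums_unique[symmetric, OF neg_binom_sums_powr[OF s]]) (use that \<delta> in auto)
  ultimately show ?thesis
    using uniform_limit_cong'[of "{0..2 - \<delta>}"
      "\<lambda>n t. \<Sum>k<n. neg_binom (- s) k * (1 - t)^k" "\<lambda>n t. \<Sum>k<n. neg_binom (- s) k * (1 - t)^k"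
      "\<lambda>t. \<Sum>k. neg_binom (- s) k * (1 - t)^k" "\<lambda>t. t powr s" sequentially] by simp
qed

lemma neg_binom_summable_mult:
  assumes "0 < s" "s < 1" and f: "\<And>k. \<bar>f k\<bar> \<le> B"
  shows "summable (\<lambda>k. neg_binom (- s) k * f k)"
proof (rule summable_comparison_test'[where N = 0])
  show "summable (\<lambda>k. \<bar>neg_binom (- s) k\<bar> * B)"
    using neg_binom_abs_summable[OF assms(1,2)] by (rule summable_mult2)
  show "norm (neg_binom (- s) n * f n) \<le> \<bar>neg_binom (- s) n\<bar> * B" for n
    using f by (simp add: abs_mult mult_left_mono)
qed

text \<open>The partial sums of \<open>(1 - t) powr (-s)\<close> times \<open>(1 - t) powr s\<close> have the form
  \<open>1 + (\<Sum>j\<ge>N. d\<^sub>j t\<^sup>j)\<close> with \<open>d\<^sub>j \<le> 0\<close>, and the \<open>d\<^sub>j\<close> with \<open>j \<ge> N\<close> add up to \<open>-1\<close>.\<close>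

lemma neg_binom_inversion:
  assumes s: "0 < s" "s < 1" and f: "\<And>k. \<bar>f k\<bar> \<le> B0" and B: "\<And>j. j \<ge> N \<Longrightarrow> \<bar>f j\<bar> \<le> B" and N: "N > 0"
  shows "\<bar>(\<Sum>k<N. neg_binom s k * (\<Sum>i. neg_binom (- s) i * f (k + i))) - f 0\<bar> \<le> B"
proof -
  \<comment> \<open>\<open>d j\<close> is the coefficient of \<open>t^j\<close> in the product of
    the first \<open>N\<close> terms of the series of order \<open>s\<close> with the full series of
    order \<open>- s\<close>.\<close>
  define d where "d j = (\<Sum>k<N. neg_binom s k * (if k \<le> j then neg_binom (- s) (j - k) else 0))" for j
  have sum1: "(\<lambda>j. d j * g j) sums (\<Sum>k<N. neg_binom s k * (\<Sum>i. neg_binom (- s) i * g (k + i)))"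
    if g: "\<And>k. \<bar>g k\<bar> \<le> B'" for g B'
  proof -
    have "(\<lambda>j. (if k \<le> j then neg_binom (- s) (j - k) else 0) * g j) sums (\<Sum>i. neg_binom (- s) i * g (k + i))" for k
    proof -
      have "(\<lambda>i. neg_binom (- s) i * g (k + i)) sums (\<Sum>i. neg_binom (- s) i * g (k + i))"
        by (rule summable_sums[OF neg_binom_summable_mult[OF s, where f = "\<lambda>i. g (k + i)" and B = B', OF g]])
      then have "(\<lambda>i. (if k \<le> i + k then neg_binom (- s) (i + k - k) else 0) * g (i + k)) sums
          (\<Sum>i. neg_binom (- s) i * g (k + i))"
        by (simp add: add.commute[of k])
      then show ?thesis
        by (rule sums_zero_iff_shift[THEN iffD1, rotated]) simp
    qed
    then have "(\<lambda>j. \<Sum>k<N. neg_binom s k * ((if k \<le> j then neg_binom (- s) (j - k) else 0) * g j)) sums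
        (\<Sum>k<N. neg_binom s k * (\<Sum>i. neg_binom (- s) i * g (k + i)))"
      by (intro sums_sum sums_mult)
    then show ?thesis unfolding d_def sum_distrib_right mult.assoc .
  qed
  have d0: "d 0 = 1"
  proof -
    have "d 0 = (\<Sum>k<N. if k = 0 then 1 else 0)"
      unfolding d_def by (rule sum.cong) auto
    then show ?thesis using N by simp
  qed
  have dsmall: "d j = 0" if "0 < j" "j < N" for j
  proof -
    have "d j = (\<Sum>k\<le>j. neg_binom s k * neg_binom (- s) (j - k))"
      unfolding d_def by (rule sum.mono_neutral_cong_right) (use that in auto)
    then show ?thesis using that by (simp add: neg_binom_convolution neg_binom_zero)
  qed
  have dneg: "d j \<le> 0" if "j \<ge> N" for j
    unfolding d_def
  proof (rule sum_nonpos)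
    fix k assume "k \<in> {..<N}"
    then have "0 < j - k" using that by auto
    then obtain l where "j - k = Suc l" by (auto simp: gr0_conv_Suc)
    then show "neg_binom s k * (if k \<le> j then neg_binom (- s) (j - k) else 0) \<le> 0"
      using neg_binom_neg[OF s, of l] neg_binom_pos[OF s(1), of k] by (simp add: mult_nonneg_nonpos)
  qed
  \<comment> \<open>Testing with the constant sequence 1: the coefficients of order
    \<open>- s\<close> add up to 0, so the nonpositive \<open>d j\<close> with
    \<open>j \<ge> N\<close> compensate \<open>d 0 = 1\<close> exactly. Their total mass 1 is why
    the error is at most \<open>B\<close>.\<close>
  have "d sums 0"
  proof -
    have "(\<lambda>j. d j * 1) sums (\<Sum>k<N. neg_binom s k * (\<Sum>i. neg_binom (- s) i * 1))"
      by (rule sum1[of "\<lambda>_. 1" 1]) simp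
    also have "(\<Sum>i. neg_binom (- s) i * 1) = 0"
      using sums_unique[OF neg_binom_sums_0[OF s], symmetric] by simp
    finally show ?thesis by simp
  qed
  then have "(\<lambda>j. d j - (if j = 0 then 1 else 0)) sums (0 - 1)"
    by (intro sums_diff sums_single)
  then have "(\<lambda>j. - (d j - (if j = 0 then 1 else 0)) * B) sums (- (0 - 1) * B)"
    by (intro sums_mult2 sums_minus)
  then have e: "(\<lambda>j. - (d j - (if j = 0 then 1 else 0)) * B) sums B" by simp
  define T where "T = (\<Sum>k<N. neg_binom s k * (\<Sum>i. neg_binom (- s) i * f (k + i)))"
  have T: "(\<lambda>j. d j * f j - (if j = 0 then f 0 else 0)) sums (T - f 0)"
    unfolding T_def by (intro sums_diff sum1[of f B0, OF f] sums_single)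
  have le: "\<bar>d j * f j - (if j = 0 then f 0 else 0)\<bar> \<le> - (d j - (if j = 0 then 1 else 0)) * B" for j
  proof -
    consider "j = 0" | "0 < j" "j < N" | "j \<ge> N" by linarith
    then show ?thesis
    proof cases
      case 3
      then have "\<bar>d j * f j\<bar> \<le> - d j * B"
        using dneg[of j] B[of j] by (simp add: abs_mult mult_left_mono_neg)
      then show ?thesis using 3 N by auto
    qed (auto simp: d0 dsmall)
  qed
  have "T - f 0 \<le> B" by (rule sums_le[OF _ T e]) (rule abs_le_D1[OF le])
  moreover have "- (T - f 0) \<le> B" by (rule sums_le[OF _ sums_minus[OF T] e]) (rule abs_le_D2[OF le])
  ultimately show ?thesis unfolding T_def by linarith
qed

text \<open>Abel summation, since the coefficients of order \<open>1 - s\<close> are the partial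
  sums of those of order \<open>- s\<close>; the boundary term vanishes because the former tend to
  0. With \<open>f k\<close> the values of \<open>P^k f\<close> at a vertex, this rewrites
  \<open>\<Delta>^s f\<close> as a series in \<open>P^k \<Delta> f\<close>.\<close>

lemma neg_binom_telescope:
  assumes s: "0 < s" "s < 1" and f: "\<And>k. \<bar>f k\<bar> \<le> B"
  shows "(\<lambda>k. neg_binom (1 - s) k * (f k - f (Suc k))) sums (\<Sum>k. neg_binom (- s) k * f k)"
proof -
  have eq: "(\<Sum>k\<le>n. neg_binom (1 - s) k * (f k - f (Suc k)))
      = (\<Sum>k\<le>n. neg_binom (- s) k * f k) - neg_binom (1 - s) n * f (Suc n)" for n
  proof (induction n)
    case (Suc n)
    have c: "neg_binom (- s) (Suc n) = neg_binom (1 - s) (Suc n) - neg_binom (1 - s) n"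
      using sum_neg_binom[of "- s" "Suc n"] sum_neg_binom[of "- s" n] by simp
    show ?case unfolding sum.atMost_Suc Suc c by (simp add: algebra_simps)
  qed (simp add: algebra_simps)
  have "(\<lambda>n. neg_binom (1 - s) n * f (Suc n)) \<longlonglongrightarrow> 0"
  proof (rule tendsto_0_le[where K = B])
    show "neg_binom (1 - s) \<longlonglongrightarrow> 0" using s by (intro neg_binom_tendsto_0) auto
    show "\<forall>\<^sub>F n in sequentially. norm (neg_binom (1 - s) n * f (Suc n)) \<le> norm (neg_binom (1 - s) n) * B"
      using f by (auto simp: abs_mult intro!: always_eventually mult_left_mono)
  qed
  moreover have "(\<lambda>n. \<Sum>k\<le>n. neg_binom (- s) k * f k) \<longlonglongrightarrow> (\<Sum>k. neg_binom (- s) k * f k)"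
    using summable_sums[OF neg_binom_summable_mult[OF s f]] unfolding sums_def_le .
  ultimately show ?thesis
    unfolding sums_def_le eq
    using tendsto_diff[of "\<lambda>n. \<Sum>k\<le>n. neg_binom (- s) k * f k" "\<Sum>k. neg_binom (- s) k * f k" sequentially
      "\<lambda>n. neg_binom (1 - s) n * f (Suc n)" 0] by simp
qed

section \<open>Weighted \<open>L\<^sup>p\<close> bounds and the Schur test\<close>

text \<open>Jensen's inequality for the power \<open>p\<close> with weights \<open>a\<close>. Terms
  with \<open>a i = 0\<close> or \<open>t i = 0\<close> are dropped first, so that a convex
  combination of positive numbers remains.\<close>

lemma sum_powr_le:
  fixes a t :: "'i \<Rightarrow> real"
  assumes "finite S" and a: "\<And>i. i \<in> S \<Longrightarrow> a i \<ge> 0" and t: "\<And>i. i \<in> S \<Longrightarrow> t i \<ge> 0" and p: "p \<ge> 1"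
  shows "(\<Sum>i\<in>S. a i * t i) powr p \<le> (\<Sum>i\<in>S. a i) powr (p - 1) * (\<Sum>i\<in>S. a i * t i powr p)"
proof -
  define S' where "S' = {i \<in> S. t i > 0 \<and> a i > 0}"
  have S': "finite S'" "S' \<subseteq> S" using assms(1) by (auto simp: S'_def)
  have nn: "0 \<le> (\<Sum>i\<in>S. a i * t i powr p)" using a by (intro sum_nonneg) auto
  have eq: "(\<Sum>i\<in>S. a i * t i) = (\<Sum>i\<in>S'. a i * t i)"
  proof (rule sum.mono_neutral_right)
    show "\<forall>i\<in>S - S'. a i * t i = 0"
      using a t by (force simp: S'_def less_le)
  qed (use assms S' in auto)
  show ?thesis
  proof (cases "S' = {}")
    case True
    then show ?thesis using nn by (simp add: eq)
  next
    case False
    define A where "A = (\<Sum>i\<in>S'. a i)"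
    have A: "A > 0" unfolding A_def by (rule sum_pos) (use False S' in \<open>auto simp: S'_def\<close>)
    have "(\<Sum>i\<in>S'. (a i / A) *\<^sub>R t i) powr p \<le> (\<Sum>i\<in>S'. (a i / A) * t i powr p)"
    proof (rule convex_on_sum[OF S'(1) False powr_convex[OF p]])
      show "(\<Sum>i\<in>S'. a i / A) = 1" using A by (simp add: A_def flip: sum_divide_distrib)
    qed (use A in \<open>auto simp: S'_def\<close>)
    then have "((\<Sum>i\<in>S'. a i * t i) / A) powr p \<le> (\<Sum>i\<in>S'. a i * t i powr p) / A"
      by (simp add: sum_divide_distrib)
    moreover have "0 \<le> (\<Sum>i\<in>S'. a i * t i)" by (intro sum_nonneg) (auto simp: S'_def)
    ultimately have "(\<Sum>i\<in>S'. a i * t i) powr p \<le> A powr (p - 1) * (\<Sum>i\<in>S'. a i * t i powr p)"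
      using A by (simp add: powr_divide powr_diff field_simps)
    also have "\<dots> \<le> (\<Sum>i\<in>S. a i) powr (p - 1) * (\<Sum>i\<in>S. a i * t i powr p)"
    proof (intro mult_mono powr_mono2)
      show "A \<le> (\<Sum>i\<in>S. a i)" unfolding A_def by (rule sum_mono2) (use assms S' in auto)
      show "(\<Sum>i\<in>S'. a i * t i powr p) \<le> (\<Sum>i\<in>S. a i * t i powr p)"
        by (rule sum_mono2) (use assms S' in auto)
    qed (use A p in \<open>auto intro!: sum_nonneg simp: S'_def\<close>)
    finally show ?thesis by (simp add: eq)
  qed
qed

text \<open>Bounding the finite partial sums asks for no summability and survives pointwise limits;
  \<open>Lp_norm_le_iff\<close> translates to the extended norm.\<close>

definition Lp_le :: "('a \<Rightarrow> real) \<Rightarrow> real \<Rightarrow> ('a \<Rightarrow> real) \<Rightarrow> real \<Rightarrow> bool" where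
  "Lp_le m p f B \<longleftrightarrow> (\<forall>F. finite F \<longrightarrow> (\<Sum>x\<in>F. \<bar>f x\<bar> powr p * m x) \<le> B powr p)"

lemma Lp_norm_le_iff:
  assumes m: "\<And>x. vmeas \<mu> x > 0" and p: "p > 0" and B: "B \<ge> 0"
  shows "Lp_norm \<mu> p f \<le> ennreal B \<longleftrightarrow> Lp_le (vmeas \<mu>) p f B"
proof
  let ?g = "\<lambda>x. \<bar>f x\<bar> powr p * vmeas \<mu> x"
  have nn: "?g x \<ge> 0" for x using m[of x] by simp
  {
    assume *: "Lp_norm \<mu> p f \<le> ennreal B"
    then have s: "?g summable_on UNIV" by (auto simp: Lp_norm_def top_unique split: if_splits)
    then have "(\<Sum>\<^sub>\<infinity>x. ?g x) powr (1 / p) \<le> B" using * B by (simp add: Lp_norm_def)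
    then have "((\<Sum>\<^sub>\<infinity>x. ?g x) powr (1 / p)) powr p \<le> B powr p" using p by (intro powr_mono2) auto
    then have le: "(\<Sum>\<^sub>\<infinity>x. ?g x) \<le> B powr p" using p infsum_nonneg[of UNIV ?g] nn by (simp add: powr_powr)
    show "Lp_le (vmeas \<mu>) p f B"
      unfolding Lp_le_def
      using finite_sum_le_infsum[OF s _ subset_UNIV] nn le by (meson order_trans)
  next
    assume *: "Lp_le (vmeas \<mu>) p f B"
    have s: "?g summable_on UNIV"
      by (rule nonneg_bdd_above_summable_on)
         (use nn * in \<open>auto simp: Lp_le_def intro!: bdd_aboveI[where M = "B powr p"]\<close>)
    have "(\<Sum>\<^sub>\<infinity>x. ?g x) \<le> B powr p"
      by (rule infsum_le_finite_sums[OF s]) (use * in \<open>auto simp: Lp_le_def\<close>)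
    then have "(\<Sum>\<^sub>\<infinity>x. ?g x) powr (1 / p) \<le> (B powr p) powr (1 / p)"
      using p nn by (intro powr_mono2 infsum_nonneg) auto
    then show "Lp_norm \<mu> p f \<le> ennreal B"
      using s p B by (auto simp: Lp_norm_def powr_powr intro!: ennreal_leI)
  }
qed

locale Lp_weight =
  fixes m :: "'a \<Rightarrow> real" and p :: real
  assumes m_pos: "\<And>x. m x > 0" and p_ge_1: "p \<ge> 1"
begin

abbreviation "lp_le \<equiv> Lp_le m p"

lemma lp_le_mono:
  assumes "lp_le g B" "\<And>x. \<bar>f x\<bar> \<le> \<bar>g x\<bar>" "B \<le> B'" "B \<ge> 0"
  shows "lp_le f B'"
  unfolding Lp_le_def
proof (intro allI impI)
  fix F :: "'a set" assume "finite F"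
  have "(\<Sum>x\<in>F. \<bar>f x\<bar> powr p * m x) \<le> (\<Sum>x\<in>F. \<bar>g x\<bar> powr p * m x)"
    using assms(2) p_ge_1 m_pos by (intro sum_mono mult_right_mono powr_mono2) (auto intro: less_imp_le)
  also have "\<dots> \<le> B powr p" using assms(1) \<open>finite F\<close> by (simp add: Lp_le_def)
  also have "\<dots> \<le> B' powr p" using assms(3,4) p_ge_1 by (intro powr_mono2) auto
  finally show "(\<Sum>x\<in>F. \<bar>f x\<bar> powr p * m x) \<le> B' powr p" .
qed

lemma lp_le_limit:
  assumes "\<And>n. lp_le (f n) B" "\<And>x. (\<lambda>n. f n x) \<longlonglongrightarrow> g x"
  shows "lp_le g B"
  unfolding Lp_le_def
proof (intro allI impI)
  fix F :: "'a set" assume "finite F"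
  have "(\<lambda>n. \<Sum>x\<in>F. \<bar>f n x\<bar> powr p * m x) \<longlonglongrightarrow> (\<Sum>x\<in>F. \<bar>g x\<bar> powr p * m x)"
    using p_ge_1 by (intro tendsto_sum tendsto_mult tendsto_const tendsto_powr2 tendsto_rabs assms(2)) auto
  then show "(\<Sum>x\<in>F. \<bar>g x\<bar> powr p * m x) \<le> B powr p"
    by (rule LIMSEQ_le_const2) (use assms(1) \<open>finite F\<close> in \<open>auto simp: Lp_le_def\<close>)
qed

text \<open>Minkowski's inequality from convexity with weights \<open>b k / bb\<close>: each summand
  is measured on the scale of its own bound, which is why the \<open>b k\<close> must be
  positive.\<close>

lemma lp_le_sum:
  assumes I: "finite I" and h: "\<And>k. k \<in> I \<Longrightarrow> lp_le (h k) (b k)" and b: "\<And>k. k \<in> I \<Longrightarrow> b k > 0"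
  shows "lp_le (\<lambda>x. \<Sum>k\<in>I. h k x) (\<Sum>k\<in>I. b k)"
proof (cases "I = {}")
  case True
  then show ?thesis using p_ge_1 by (simp add: Lp_le_def)
next
  case False
  define bb where "bb = (\<Sum>k\<in>I. b k)"
  have bb: "bb > 0" unfolding bb_def using I False b by (rule sum_pos)
  show ?thesis
    unfolding Lp_le_def bb_def[symmetric]
  proof (intro allI impI)
    fix F :: "'a set" assume F: "finite F"
    have pt: "\<bar>\<Sum>k\<in>I. h k x\<bar> powr p \<le> bb powr (p - 1) * (\<Sum>k\<in>I. b k powr (1 - p) * \<bar>h k x\<bar> powr p)" for x
    proof -
      have "\<bar>\<Sum>k\<in>I. h k x\<bar> \<le> (\<Sum>k\<in>I. b k * (\<bar>h k x\<bar> / b k))"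
        using sum_abs[of "\<lambda>k. h k x" I] b by (simp add: order_less_imp_not_eq2 cong: sum.cong)
      then have "\<bar>\<Sum>k\<in>I. h k x\<bar> powr p \<le> (\<Sum>k\<in>I. b k * (\<bar>h k x\<bar> / b k)) powr p"
        using p_ge_1 by (intro powr_mono2) auto
      also have "\<dots> \<le> bb powr (p - 1) * (\<Sum>k\<in>I. b k * (\<bar>h k x\<bar> / b k) powr p)"
        unfolding bb_def
        by (rule sum_powr_le) (use I b p_ge_1 in \<open>auto intro: less_imp_le intro!: divide_nonneg_nonneg\<close>)
      also have "(\<Sum>k\<in>I. b k * (\<bar>h k x\<bar> / b k) powr p) = (\<Sum>k\<in>I. b k powr (1 - p) * \<bar>h k x\<bar> powr p)"
      proof (rule sum.cong)
        fix k assume "k \<in> I"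
        then show "b k * (\<bar>h k x\<bar> / b k) powr p = b k powr (1 - p) * \<bar>h k x\<bar> powr p"
          using b[of k] by (simp add: powr_divide powr_diff)
      qed simp
      finally show ?thesis .
    qed
    have "(\<Sum>x\<in>F. \<bar>\<Sum>k\<in>I. h k x\<bar> powr p * m x) \<le>
        (\<Sum>x\<in>F. bb powr (p - 1) * (\<Sum>k\<in>I. b k powr (1 - p) * \<bar>h k x\<bar> powr p) * m x)"
      by (intro sum_mono mult_right_mono pt less_imp_le[OF m_pos])
    also have "\<dots> = bb powr (p - 1) * (\<Sum>x\<in>F. \<Sum>k\<in>I. b k powr (1 - p) * (\<bar>h k x\<bar> powr p * m x))"
      by (simp add: sum_distrib_left sum_distrib_right mult.assoc)
    also have "\<dots> = bb powr (p - 1) * (\<Sum>k\<in>I. b k powr (1 - p) * (\<Sum>x\<in>F. \<bar>h k x\<bar> powr p * m x))"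
      by (subst sum.swap) (simp add: sum_distrib_left)
    also have "\<dots> \<le> bb powr (p - 1) * (\<Sum>k\<in>I. b k powr (1 - p) * b k powr p)"
      using h F by (intro mult_left_mono sum_mono) (auto simp: Lp_le_def)
    also have "(\<Sum>k\<in>I. b k powr (1 - p) * b k powr p) = bb"
      unfolding bb_def by (rule sum.cong) (use b in \<open>auto simp: less_imp_le simp flip: powr_add\<close>)
    also have "bb powr (p - 1) * bb = bb powr p" using bb by (simp add: powr_diff)
    finally show "(\<Sum>x\<in>F. \<bar>\<Sum>k\<in>I. h k x\<bar> powr p * m x) \<le> bb powr p" .
  qed
qed

lemma lp_le_suminf:
  assumes h: "\<And>k. lp_le (h k) (b k)" and b: "\<And>k. b k > 0" "summable b"
    and s: "\<And>x. (\<lambda>k. h k x) sums f x"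
  shows "lp_le f (suminf b)"
proof (rule lp_le_limit)
  show "(\<lambda>n. \<Sum>k<n. h k x) \<longlonglongrightarrow> f x" for x using s by (simp add: sums_def)
  fix n
  have "lp_le (\<lambda>x. \<Sum>k<n. h k x) (\<Sum>k<n. b k)"
    by (rule lp_le_sum) (use h b in auto)
  then show "lp_le (\<lambda>x. \<Sum>k<n. h k x) (suminf b)"
    by (rule lp_le_mono) (use b in \<open>auto intro!: sum_le_suminf sum_nonneg intro: less_imp_le\<close>)
qed

lemma lp_le_cmult:
  assumes "lp_le f B" "B \<ge> 0"
  shows "lp_le (\<lambda>x. c * f x) (\<bar>c\<bar> * B)"
  unfolding Lp_le_def
proof (intro allI impI)
  fix F :: "'a set" assume "finite F"
  have "(\<Sum>x\<in>F. \<bar>c * f x\<bar> powr p * m x) = \<bar>c\<bar> powr p * (\<Sum>x\<in>F. \<bar>f x\<bar> powr p * m x)"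
    by (simp add: abs_mult powr_mult sum_distrib_left mult.assoc)
  also have "\<dots> \<le> \<bar>c\<bar> powr p * B powr p"
    using assms \<open>finite F\<close> by (intro mult_left_mono) (auto simp: Lp_le_def)
  finally show "(\<Sum>x\<in>F. \<bar>c * f x\<bar> powr p * m x) \<le> (\<bar>c\<bar> * B) powr p"
    using assms by (simp add: powr_mult)
qed

text \<open>Row sums bound the operator on bounded functions, column sums on integrable ones;
  Jensen's inequality in the row weights and an exchange of sums give the interpolated constant
  directly. The finite set may depend on \<open>x\<close>, as it does for operators of finite
  propagation.\<close>

lemma schur_test:
  assumes K: "\<And>x w. K x w \<ge> 0"
    and row: "\<And>x S. finite S \<Longrightarrow> (\<Sum>w\<in>S. K x w * m w) \<le> A"
    and col: "\<And>w F. finite F \<Longrightarrow> (\<Sum>x\<in>F. K x w * m x) \<le> B"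
    and g: "lp_le g G" "G \<ge> 0"
    and h: "\<And>x. \<exists>S. finite S \<and> \<bar>h x\<bar> \<le> (\<Sum>w\<in>S. K x w * \<bar>g w\<bar> * m w)"
  shows "lp_le h (A powr (1 - 1 / p) * B powr (1 / p) * G)"
  unfolding Lp_le_def
proof (intro allI impI)
  fix F :: "'a set" assume F: "finite F"
  obtain S0 where S0: "\<And>x. finite (S0 x)" "\<And>x. \<bar>h x\<bar> \<le> (\<Sum>w\<in>S0 x. K x w * \<bar>g w\<bar> * m w)"
    using h by metis
  define S where "S = (\<Union>x\<in>F. S0 x)"
  have S: "finite S" using F S0 by (simp add: S_def)
  have A0: "A \<ge> 0" using row[of "{}"] by simp
  have B0: "B \<ge> 0" using col[of "{}"] by simp
  note mnn = less_imp_le[OF m_pos]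
  have pt: "\<bar>h x\<bar> powr p \<le> A powr (p - 1) * (\<Sum>w\<in>S. K x w * m w * \<bar>g w\<bar> powr p)" if "x \<in> F" for x
  proof -
    have "\<bar>h x\<bar> \<le> (\<Sum>w\<in>S0 x. K x w * m w * \<bar>g w\<bar>)" using S0(2)[of x] by (simp add: mult_ac)
    also have "\<dots> \<le> (\<Sum>w\<in>S. K x w * m w * \<bar>g w\<bar>)"
      by (rule sum_mono2) (use S that K mnn in \<open>auto simp: S_def\<close>)
    finally have "\<bar>h x\<bar> powr p \<le> (\<Sum>w\<in>S. K x w * m w * \<bar>g w\<bar>) powr p"
      using p_ge_1 by (intro powr_mono2) auto
    also have "\<dots> \<le> (\<Sum>w\<in>S. K x w * m w) powr (p - 1) * (\<Sum>w\<in>S. K x w * m w * \<bar>g w\<bar> powr p)"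
      by (rule sum_powr_le) (use S K mnn p_ge_1 in auto)
    also have "\<dots> \<le> A powr (p - 1) * (\<Sum>w\<in>S. K x w * m w * \<bar>g w\<bar> powr p)"
      using row[OF S] p_ge_1 K mnn by (intro mult_right_mono powr_mono2 sum_nonneg) auto
    finally show ?thesis .
  qed
  have "(\<Sum>x\<in>F. \<bar>h x\<bar> powr p * m x) \<le> (\<Sum>x\<in>F. A powr (p - 1) * (\<Sum>w\<in>S. K x w * m w * \<bar>g w\<bar> powr p) * m x)"
    by (intro sum_mono mult_right_mono pt mnn)
  also have "\<dots> = A powr (p - 1) * (\<Sum>x\<in>F. \<Sum>w\<in>S. \<bar>g w\<bar> powr p * m w * (K x w * m x))"
    by (simp add: sum_distrib_left sum_distrib_right mult_ac)
  also have "\<dots> = A powr (p - 1) * (\<Sum>w\<in>S. \<bar>g w\<bar> powr p * m w * (\<Sum>x\<in>F. K x w * m x))"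
    by (subst sum.swap) (simp add: sum_distrib_left)
  also have "\<dots> \<le> A powr (p - 1) * (\<Sum>w\<in>S. \<bar>g w\<bar> powr p * m w * B)"
    using col[OF F] mnn by (intro mult_left_mono sum_mono) auto
  also have "\<dots> = A powr (p - 1) * B * (\<Sum>w\<in>S. \<bar>g w\<bar> powr p * m w)"
    by (simp add: sum_distrib_left mult_ac)
  also have "\<dots> \<le> A powr (p - 1) * B * G powr p"
    using g S B0 by (intro mult_left_mono) (auto simp: Lp_le_def)
  also have "\<dots> = (A powr (1 - 1 / p) * B powr (1 / p) * G) powr p"
    using A0 B0 g(2) p_ge_1 by (simp add: powr_mult powr_powr left_diff_distrib)
  finally show "(\<Sum>x\<in>F. \<bar>h x\<bar> powr p * m x) \<le> (A powr (1 - 1 / p) * B powr (1 / p) * G) powr p" .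
qed

text \<open>Hoelder's inequality against the indicator function of \<open>F\<close>.\<close>

lemma sum_le_lp:
  assumes f: "lp_le f B" "B \<ge> 0" and "finite F"
  shows "(\<Sum>x\<in>F. \<bar>f x\<bar> * m x) \<le> B * (\<Sum>x\<in>F. m x) powr (1 - 1 / p)"
proof -
  note mnn = less_imp_le[OF m_pos]
  have nn: "0 \<le> (\<Sum>x\<in>F. \<bar>f x\<bar> * m x)" "0 \<le> (\<Sum>x\<in>F. m x)" using mnn by (auto intro!: sum_nonneg)
  have "(\<Sum>x\<in>F. m x * \<bar>f x\<bar>) powr p \<le> (\<Sum>x\<in>F. m x) powr (p - 1) * (\<Sum>x\<in>F. m x * \<bar>f x\<bar> powr p)"
    by (rule sum_powr_le) (use assms mnn p_ge_1 in auto)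
  also have "\<dots> \<le> (\<Sum>x\<in>F. m x) powr (p - 1) * B powr p"
    using f \<open>finite F\<close> by (intro mult_left_mono) (auto simp: Lp_le_def mult.commute)
  also have "\<dots> = (B * (\<Sum>x\<in>F. m x) powr (1 - 1 / p)) powr p"
  proof -
    have "p * (1 - 1 / p) = p - 1" using p_ge_1 by (simp add: field_simps)
    then show ?thesis using f(2) nn by (simp add: powr_mult powr_powr mult.commute)
  qed
  finally have "(\<Sum>x\<in>F. \<bar>f x\<bar> * m x) powr p \<le> (B * (\<Sum>x\<in>F. m x) powr (1 - 1 / p)) powr p"
    by (simp add: mult.commute)
  moreover have "0 \<le> B * (\<Sum>x\<in>F. m x) powr (1 - 1 / p)" using f(2) by simp
  ultimately show ?thesis
    using powr_less_mono2[of p "B * (\<Sum>x\<in>F. m x) powr (1 - 1 / p)" "\<Sum>x\<in>F. \<bar>f x\<bar> * m x"] p_ge_1 by linarith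
qed

end

section \<open>The space of square-summable functions\<close>

definition square_summable :: "('a \<Rightarrow> real) \<Rightarrow> bool" where
  "square_summable f \<longleftrightarrow> (\<lambda>x. (f x)\<^sup>2) summable_on UNIV"

lemma square_summableI:
  assumes "\<And>F. finite F \<Longrightarrow> (\<Sum>x\<in>F. (f x)\<^sup>2) \<le> B"
  shows "square_summable f"
  unfolding square_summable_def
  by (rule nonneg_bdd_above_summable_on) (use assms in \<open>auto intro!: bdd_aboveI[where M = B]\<close>)

lemma square_summable_mult:
  assumes "square_summable f" "square_summable g"
  shows "(\<lambda>x. f x * g x) summable_on UNIV"
proof (rule summable_on_iff_abs_summable_on_real[THEN iffD2], rule summable_on_comparison_test)
  show "(\<lambda>x. (f x)\<^sup>2 + (g x)\<^sup>2) summable_on UNIV"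
    using assms by (auto simp: square_summable_def intro: summable_on_add)
  show "norm (f x * g x) \<le> (f x)\<^sup>2 + (g x)\<^sup>2" for x
  proof -
    have "2 * \<bar>f x\<bar> * \<bar>g x\<bar> \<le> (f x)\<^sup>2 + (g x)\<^sup>2"
      using sum_squares_bound[of "\<bar>f x\<bar>" "\<bar>g x\<bar>"] by simp
    moreover have "0 \<le> \<bar>f x\<bar> * \<bar>g x\<bar>" by simp
    ultimately show ?thesis unfolding real_norm_def abs_mult by linarith
  qed
qed simp

lemma square_summable_add:
  assumes "square_summable f" "square_summable g"
  shows "square_summable (\<lambda>x. f x + g x)"
proof -
  have "(\<lambda>x. (f x)\<^sup>2 + (g x)\<^sup>2 + 2 * (f x * g x)) summable_on UNIV"
    using assms square_summable_mult[OF assms]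
    by (intro summable_on_add summable_on_cmult_right) (auto simp: square_summable_def)
  then show ?thesis by (simp add: square_summable_def power2_sum mult.assoc)
qed

lemma square_summable_scale: "square_summable f \<Longrightarrow> square_summable (\<lambda>x. c * f x)"
  by (simp add: square_summable_def power_mult_distrib summable_on_cmult_right)

text \<open>Unweighted on purpose: the Hilbert space type must not depend on \<open>\<mu>\<close>.
  The vertex measure enters through the factor \<open>sqrt (m x)\<close> in \<open>of_ell2\<close>,
  a unitary map onto \<open>L2 \<mu>\<close>.\<close>

typedef 'a ell2 = "{f :: 'a \<Rightarrow> real. square_summable f}"
  morphisms vec_of Abs_ell2
  by (rule exI[of _ "\<lambda>_. 0"]) (simp add: square_summable_def)

setup_lifting type_definition_ell2

lemma square_summable_vec_of: "square_summable (vec_of u)"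
  using vec_of[of u] by simp

lemma vec_of_Abs: "square_summable f \<Longrightarrow> vec_of (Abs_ell2 f) = f"
  by (simp add: Abs_ell2_inverse)

instantiation ell2 :: (type) real_vector
begin

lift_definition zero_ell2 :: "'a ell2" is "\<lambda>_. 0" by (simp add: square_summable_def)
lift_definition plus_ell2 :: "'a ell2 \<Rightarrow> 'a ell2 \<Rightarrow> 'a ell2" is "\<lambda>f g x. f x + g x"
  by (rule square_summable_add)
lift_definition uminus_ell2 :: "'a ell2 \<Rightarrow> 'a ell2" is "\<lambda>f x. - f x"
  by (simp add: square_summable_def)
lift_definition minus_ell2 :: "'a ell2 \<Rightarrow> 'a ell2 \<Rightarrow> 'a ell2" is "\<lambda>f g x. f x - g x"
  using square_summable_add[OF _ square_summable_scale[of _ "-1"]] by force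
lift_definition scaleR_ell2 :: "real \<Rightarrow> 'a ell2 \<Rightarrow> 'a ell2" is "\<lambda>c f x. c * f x"
  by (rule square_summable_scale)
instance
proof
  fix a b :: real and u v w :: "'a ell2"
  show "u + v + w = u + (v + w)" by transfer (simp add: add.assoc)
  show "u + v = v + u" by transfer (simp add: add.commute)
  show "0 + u = u" by transfer simp
  show "- u + u = 0" by transfer simp
  show "u - v = u + - v" by transfer simp
  show "a *\<^sub>R (u + v) = a *\<^sub>R u + a *\<^sub>R v" by transfer (simp add: distrib_left)
  show "(a + b) *\<^sub>R u = a *\<^sub>R u + b *\<^sub>R u" by transfer (simp add: distrib_right)
  show "a *\<^sub>R b *\<^sub>R u = (a * b) *\<^sub>R u" by transfer (simp add: mult.assoc)
  show "1 *\<^sub>R u = u" by transfer simp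
qed

end

instantiation ell2 :: (type) real_inner
begin

lift_definition inner_ell2 :: "'a ell2 \<Rightarrow> 'a ell2 \<Rightarrow> real" is "\<lambda>f g. \<Sum>\<^sub>\<infinity>x. f x * g x" .
definition norm_ell2 :: "'a ell2 \<Rightarrow> real" where "norm_ell2 u = sqrt (u \<bullet> u)"
definition dist_ell2 :: "'a ell2 \<Rightarrow> 'a ell2 \<Rightarrow> real" where "dist_ell2 u v = norm (u - v)"
definition sgn_ell2 :: "'a ell2 \<Rightarrow> 'a ell2" where "sgn_ell2 u = u /\<^sub>R norm u"
definition uniformity_ell2 :: "('a ell2 \<times> 'a ell2) filter" where
  "uniformity_ell2 = (INF e\<in>{0 <..}. principal {(x, y). dist x y < e})"
definition open_ell2 :: "'a ell2 set \<Rightarrow> bool" where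
  "open_ell2 U = (\<forall>x\<in>U. eventually (\<lambda>(x', y). x' = x \<longrightarrow> y \<in> U) uniformity)"

instance
proof
  fix a b :: real and u v w :: "'a ell2" and U :: "'a ell2 set"
  show "sgn u = u /\<^sub>R norm u" by (rule sgn_ell2_def)
  show "dist u v = norm (u - v)" by (rule dist_ell2_def)
  show "uniformity = (INF e\<in>{0 <..}. principal {(x :: 'a ell2, y). dist x y < e})"
    by (rule uniformity_ell2_def)
  show "open U = (\<forall>x\<in>U. eventually (\<lambda>(x', y). x' = x \<longrightarrow> y \<in> U) uniformity)"
    by (rule open_ell2_def)
  show "norm u = sqrt (u \<bullet> u)" by (rule norm_ell2_def)
  show "u \<bullet> v = v \<bullet> u" by transfer (simp add: mult.commute)
  show "(u + v) \<bullet> w = u \<bullet> w + v \<bullet> w"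
    by transfer (simp add: distrib_right infsum_add square_summable_mult)
  show "(a *\<^sub>R u) \<bullet> v = a * (u \<bullet> v)"
    by transfer (simp add: mult.assoc infsum_cmult_right square_summable_mult)
  show "0 \<le> u \<bullet> u" by transfer (simp add: infsum_nonneg)
  show "u \<bullet> u = 0 \<longleftrightarrow> u = 0"
  proof (transfer, safe)
    fix f :: "'a \<Rightarrow> real"
    assume f: "square_summable f" and 0: "(\<Sum>\<^sub>\<infinity>x. f x * f x) = 0"
    show "f = (\<lambda>_. 0)"
    proof
      fix x
      have "f x * f x = 0"
        by (rule nonneg_infsum_le_0D[of "\<lambda>x. f x * f x" UNIV])
           (use 0 square_summable_mult[OF f f] in auto)
      then show "f x = 0" by simp
    qed
  qed simp
qed

end

lemma vec_of_simps [simp]: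
  "vec_of 0 = (\<lambda>_. 0)" "vec_of (u + v) = (\<lambda>x. vec_of u x + vec_of v x)"
  "vec_of (u - v) = (\<lambda>x. vec_of u x - vec_of v x)" "vec_of (c *\<^sub>R u) = (\<lambda>x. c * vec_of u x)"
  by (transfer, simp)+

lemma norm_ell2_has_sum: "((\<lambda>x. (vec_of u x)\<^sup>2) has_sum (norm u)\<^sup>2) UNIV"
  using square_summable_vec_of[of u]
  by (simp add: power2_norm_eq_inner inner_ell2.rep_eq square_summable_def flip: power2_eq_square)

lemma sum_square_le_norm_ell2: "finite F \<Longrightarrow> (\<Sum>x\<in>F. (vec_of u x)\<^sup>2) \<le> (norm u)\<^sup>2"
  by (rule finite_sum_le_has_sum[OF norm_ell2_has_sum]) auto

lemma norm_ell2_le: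
  assumes "\<And>F. finite F \<Longrightarrow> (\<Sum>x\<in>F. (vec_of u x)\<^sup>2) \<le> B\<^sup>2" "B \<ge> 0"
  shows "norm u \<le> B"
proof -
  have "(norm u)\<^sup>2 \<le> B\<^sup>2" by (rule has_sum_le_finite_sums[OF norm_ell2_has_sum]) (use assms in auto)
  then show ?thesis by (rule power2_le_imp_le) (rule assms)
qed

lemma abs_vec_of_le: "\<bar>vec_of u x\<bar> \<le> norm u"
  using sum_square_le_norm_ell2[of "{x}" u] by (simp add: abs_le_square_iff[symmetric])

instance ell2 :: (type) banach
proof
  fix X :: "nat \<Rightarrow> 'a ell2"
  assume X: "Cauchy X"
  have "Cauchy (\<lambda>n. vec_of (X n) x)" for x
  proof (rule CauchyI)
    fix e :: real assume "e > 0"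
    then obtain N where "\<And>k n. k \<ge> N \<Longrightarrow> n \<ge> N \<Longrightarrow> norm (X k - X n) < e" using CauchyD[OF X] by blast
    then show "\<exists>M. \<forall>k\<ge>M. \<forall>n\<ge>M. norm (vec_of (X k) x - vec_of (X n) x) < e"
      using abs_vec_of_le[of "X _ - X _" x] by (simp, meson le_less_trans)
  qed
  then have "convergent (\<lambda>n. vec_of (X n) x)" for x by (simp add: Cauchy_convergent_iff)
  then obtain L where L: "\<And>x. (\<lambda>n. vec_of (X n) x) \<longlonglongrightarrow> L x" unfolding convergent_def by metis
  have bd: "(\<Sum>x\<in>F. (vec_of (X k) x - L x)\<^sup>2) \<le> e\<^sup>2"
    if N: "\<And>k n. k \<ge> N \<Longrightarrow> n \<ge> N \<Longrightarrow> norm (X k - X n) < e" and "finite F" "k \<ge> N" for e N F k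
  proof (rule LIMSEQ_le_const2)
    show "(\<lambda>n. \<Sum>x\<in>F. (vec_of (X k) x - vec_of (X n) x)\<^sup>2) \<longlonglongrightarrow> (\<Sum>x\<in>F. (vec_of (X k) x - L x)\<^sup>2)"
      by (intro tendsto_intros L)
    have "(\<Sum>x\<in>F. (vec_of (X k) x - vec_of (X n) x)\<^sup>2) \<le> e\<^sup>2" if "n \<ge> N" for n
      using sum_square_le_norm_ell2[OF \<open>finite F\<close>, of "X k - X n"]
        power_mono[OF less_imp_le[OF N[OF \<open>k \<ge> N\<close> that]], of 2] by simp
    then show "\<exists>M. \<forall>n\<ge>M. (\<Sum>x\<in>F. (vec_of (X k) x - vec_of (X n) x)\<^sup>2) \<le> e\<^sup>2" by blast
  qed
  obtain N where N: "\<And>k n. k \<ge> N \<Longrightarrow> n \<ge> N \<Longrightarrow> norm (X k - X n) < 1" using CauchyD[OF X, of 1] by auto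
  have "square_summable (\<lambda>x. vec_of (X N) x - L x)"
    by (rule square_summableI) (rule bd[OF N], auto)
  then have "square_summable (\<lambda>x. vec_of (X N) x + (-1) * (vec_of (X N) x - L x))"
    by (intro square_summable_add square_summable_scale square_summable_vec_of)
  then have vL: "vec_of (Abs_ell2 L) = L" by (simp add: vec_of_Abs)
  have "X \<longlonglongrightarrow> Abs_ell2 L"
  proof (rule LIMSEQ_I)
    fix r :: real assume r: "r > 0"
    then obtain N where N: "\<And>k n. k \<ge> N \<Longrightarrow> n \<ge> N \<Longrightarrow> norm (X k - X n) < r / 2"
      using CauchyD[OF X, of "r / 2"] by auto
    have "norm (X k - Abs_ell2 L) \<le> r / 2" if "k \<ge> N" for k
      by (rule norm_ell2_le) (use bd[OF N _ that] r in \<open>auto simp: vL\<close>)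
    then have "norm (X k - Abs_ell2 L) < r" if "k \<ge> N" for k
      using that r by fastforce
    then show "\<exists>no. \<forall>n\<ge>no. norm (X n - Abs_ell2 L) < r" by blast
  qed
  then show "convergent X" by (auto simp: convergent_def)
qed

lift_definition basis_vec :: "'a \<Rightarrow> 'a ell2" is "\<lambda>x y. if y = x then 1 else 0"
proof (rule square_summableI[of _ 1])
  fix a :: 'a and F :: "'a set" assume "finite F"
  then show "(\<Sum>x\<in>F. (if x = a then 1 else 0 :: real)\<^sup>2) \<le> 1"
    by (simp add: if_distrib[of "\<lambda>t. t\<^sup>2"] cong: if_cong)
qed

lemma vec_of_basis_vec: "vec_of (basis_vec x) y = (if y = x then 1 else 0)"
  by (simp add: basis_vec.rep_eq)

lemma inner_basis_vec: "basis_vec x \<bullet> u = vec_of u x"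
proof -
  have "basis_vec x \<bullet> u = (\<Sum>\<^sub>\<infinity>y\<in>{x}. vec_of u y)"
    unfolding inner_ell2.rep_eq basis_vec.rep_eq by (rule infsum_cong_neutral) auto
  then show ?thesis by simp
qed

lemma basis_expansion: "((\<lambda>x. vec_of u x *\<^sub>R basis_vec x) has_sum u) UNIV"
proof -
  \<comment> \<open>Pythagoras: convergence in norm becomes convergence of the real series of
    squares.\<close>
  have eq: "(norm ((\<Sum>x\<in>F. vec_of u x *\<^sub>R basis_vec x) - u))\<^sup>2 = (norm u)\<^sup>2 - (\<Sum>x\<in>F. (vec_of u x)\<^sup>2)"
    if "finite F" for F
  proof -
    let ?s = "\<Sum>x\<in>F. vec_of u x *\<^sub>R basis_vec x"
    have su: "?s \<bullet> u = (\<Sum>x\<in>F. (vec_of u x)\<^sup>2)"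
      by (simp add: inner_sum_left inner_basis_vec power2_eq_square)
    have vs: "vec_of ?s y = (if y \<in> F then vec_of u y else 0)" for y
    proof -
      have "vec_of ?s y = (\<Sum>x\<in>F. vec_of u x * (if y = x then 1 else 0))"
        using that by (induction F) (auto simp: vec_of_basis_vec)
      then show ?thesis using that by (simp add: if_distrib cong: if_cong)
    qed
    have ss: "?s \<bullet> ?s = (\<Sum>x\<in>F. (vec_of u x)\<^sup>2)"
      unfolding inner_sum_left by (rule sum.cong) (auto simp: inner_basis_vec vs power2_eq_square)
    show ?thesis
      using su ss by (simp add: power2_norm_eq_inner inner_diff_left inner_diff_right inner_commute)
  qed
  have "((\<lambda>F. \<Sum>x\<in>F. (vec_of u x)\<^sup>2) \<longlongrightarrow> (norm u)\<^sup>2) (finite_subsets_at_top UNIV)"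
    using norm_ell2_has_sum[of u] by (simp add: has_sum_def)
  then have "((\<lambda>F. sqrt ((norm u)\<^sup>2 - (\<Sum>x\<in>F. (vec_of u x)\<^sup>2))) \<longlongrightarrow> sqrt ((norm u)\<^sup>2 - (norm u)\<^sup>2)) (finite_subsets_at_top UNIV)"
    by (intro tendsto_intros)
  then have "((\<lambda>F. norm ((\<Sum>x\<in>F. vec_of u x *\<^sub>R basis_vec x) - u)) \<longlongrightarrow> 0) (finite_subsets_at_top UNIV)"
    by (simp, elim Lim_transform_eventually)
       (auto intro!: eventually_finite_subsets_at_top_weakI simp flip: eq)
  then show ?thesis
    unfolding has_sum_def by (rule LIM_zero_cancel[OF tendsto_norm_zero_cancel])
qed

lemma symmetric_ell2I:
  assumes T: "bounded_linear T"
    and e: "\<And>x v. T (basis_vec x) \<bullet> v = basis_vec x \<bullet> T v"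
  shows "T u \<bullet> v = u \<bullet> T v"
proof -
  have "((\<lambda>x. T (vec_of u x *\<^sub>R basis_vec x) \<bullet> v) has_sum (T u \<bullet> v)) UNIV"
    by (rule has_sum_bounded_linear[OF _ basis_expansion])
       (auto intro!: bounded_linear_compose[OF bounded_linear_inner_left T])
  moreover have "((\<lambda>x. (vec_of u x *\<^sub>R basis_vec x) \<bullet> T v) has_sum (u \<bullet> T v)) UNIV"
    by (rule has_sum_bounded_linear[OF _ basis_expansion]) (rule bounded_linear_inner_left)
  moreover have "T (vec_of u x *\<^sub>R basis_vec x) \<bullet> v = (vec_of u x *\<^sub>R basis_vec x) \<bullet> T v" for x
    using e by (simp add: linear_scale[OF bounded_linear.linear[OF T]])
  ultimately show ?thesis by (metis (no_types, lifting) has_sum_cong has_sum_unique)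
qed

section \<open>The Laplacian as an operator on a Hilbert space\<close>

text \<open>With \<open>g\<close> the embedding \<open>of_ell2\<close>, bijectivity on the set
  \<open>L2 \<mu>\<close> of functions becomes bijectivity on the Hilbert space type, which
  identifies the two notions of spectrum.\<close>

lemma bij_betw_conjugate:
  assumes "inj g" "\<And>u. f (g u) = g (h u)"
  shows "bij_betw f (range g) (range g) \<longleftrightarrow> bij h"
proof -
  have "inj_on f (range g) \<longleftrightarrow> inj h"
  proof -
    have "inj_on f (range g) \<longleftrightarrow> inj (f \<circ> g)" by (rule comp_inj_on_iff[OF assms(1)])
    also have "f \<circ> g = g \<circ> h" using assms(2) by auto
    also have "inj (g \<circ> h) \<longleftrightarrow> inj h"
      using inj_compose[OF assms(1)] inj_on_imageI2[of g h UNIV] by blast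
    finally show ?thesis .
  qed
  moreover have "f ` range g = range g \<longleftrightarrow> range h = UNIV"
  proof -
    have "f ` range g = g ` range h" using assms(2) by (simp add: image_image)
    then show ?thesis using inj_image_eq_iff[OF assms(1), of "range h" UNIV] by simp
  qed
  ultimately show ?thesis by (simp add: bij_betw_def)
qed

lemma poly_op_sum: "poly_op (\<Sum>k<n. q k) T u = (\<Sum>k<n. poly_op (q k) T u)" for n :: nat
  by (induction n) (simp_all add: poly_op_add)

text \<open>The left side is the smallest of the \<open>k + 1\<close> terms
  \<open>t * (1 - t)^j\<close>, whose sum telescopes to at most 1.\<close>

lemma mult_power_one_minus_le:
  fixes t :: real
  assumes "0 \<le> t" "t \<le> 1"
  shows "t * (1 - t) ^ k \<le> 1 / (real k + 1)"
proof -
  have "(real k + 1) * (t * (1 - t) ^ k) = (\<Sum>j<Suc k. t * (1 - t) ^ k)" by simp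
  also have "\<dots> \<le> (\<Sum>j<Suc k. t * (1 - t) ^ j)"
    using assms by (intro sum_mono mult_left_mono power_decreasing) auto
  also have "\<dots> = 1 - (1 - t) ^ Suc k"
    using one_diff_power_eq[of "1 - t" "Suc k"]
    by (simp add: sum_distrib_left[symmetric] del: sum.lessThan_Suc power_Suc)
  also have "\<dots> \<le> 1" using assms by simp
  finally show ?thesis by (simp add: field_simps)
qed

locale lb_graph =
  fixes \<mu> :: "'a \<Rightarrow> 'a \<Rightarrow> real"
  assumes weighted: "weighted_graph \<mu>" and lower_bound: "LB_condition \<mu>"
begin

abbreviation "m \<equiv> vmeas \<mu>"

definition nbh :: "'a \<Rightarrow> 'a set" where "nbh x = {y. adj \<mu> x y}"

lemma mu_sym: "\<mu> x y = \<mu> y x" using weighted by (auto simp: weighted_graph_def)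
lemma mu_nonneg: "\<mu> x y \<ge> 0" using weighted by (auto simp: weighted_graph_def)
lemma adj_sym: "adj \<mu> x y \<longleftrightarrow> adj \<mu> y x" by (simp add: adj_def mu_sym)
lemma adj_refl: "adj \<mu> x x" using lower_bound by (simp add: LB_condition_def)
lemma nbh_sym: "y \<in> nbh x \<longleftrightarrow> x \<in> nbh y" by (simp add: nbh_def adj_sym)
lemma nbh_refl: "x \<in> nbh x" by (simp add: nbh_def adj_refl)
lemma mu_eq_0: "y \<notin> nbh x \<Longrightarrow> \<mu> x y = 0" using mu_nonneg[of x y] by (simp add: nbh_def adj_def)

text \<open>The cap \<open>1 / 2\<close> makes \<open>2 * eps\<close> an admissible argument of
  \<open>mult_power_one_minus_le\<close> and keeps \<open>1 - 2 * eps\<close> nonnegative.\<close>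

definition eps :: real where
  "eps = (SOME e. 0 < e \<and> e \<le> 1 / 2 \<and> (\<forall>x y. adj \<mu> x y \<longrightarrow> \<mu> x y \<ge> e * m x))"

lemma infsum_nbh: "(\<mu> x has_sum m x) (nbh x)"
  using weighted unfolding weighted_graph_def vmeas_def nbh_def by (simp add: has_sum_infsum)

lemma m_pos: "m x > 0"
proof -
  have "(\<Sum>y\<in>{x}. \<mu> x y) \<le> m x"
    by (rule finite_sum_le_has_sum[OF infsum_nbh]) (auto simp: nbh_refl mu_nonneg)
  moreover have "\<mu> x x > 0" using adj_refl[of x] by (simp add: adj_def)
  ultimately show ?thesis by simp
qed

lemma m_nonneg: "m x \<ge> 0" using m_pos[of x] by simp

lemma eps: "0 < eps" "eps \<le> 1 / 2" "y \<in> nbh x \<Longrightarrow> \<mu> x y \<ge> eps * m x"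
proof -
  obtain e where e: "e > 0" "\<And>x y. adj \<mu> x y \<Longrightarrow> \<mu> x y \<ge> e * m x"
    using lower_bound by (auto simp: LB_condition_def)
  have "\<mu> x y \<ge> min e (1/2) * m x" if "adj \<mu> x y" for x y
  proof -
    have "min e (1/2) * m x \<le> e * m x" by (intro mult_right_mono m_nonneg) simp
    then show ?thesis using e(2)[OF that] by simp
  qed
  then have "\<exists>e. 0 < e \<and> e \<le> 1 / 2 \<and> (\<forall>x y. adj \<mu> x y \<longrightarrow> \<mu> x y \<ge> e * m x)"
    using e(1) by (intro exI[of _ "min e (1/2)"]) auto
  then have "0 < eps \<and> eps \<le> 1 / 2 \<and> (\<forall>x y. adj \<mu> x y \<longrightarrow> \<mu> x y \<ge> eps * m x)"
    unfolding eps_def by (rule someI_ex)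
  then show "0 < eps" "eps \<le> 1 / 2" "y \<in> nbh x \<Longrightarrow> \<mu> x y \<ge> eps * m x"
    by (auto simp: nbh_def)
qed

text \<open>Each neighbour carries at least the fraction \<open>eps\<close> of \<open>m x\<close>.
  Bounded degree makes all sums over neighbours finite, at the price of a constant.\<close>

lemma card_nbh_le: assumes "finite F" "F \<subseteq> nbh x" shows "real (card F) \<le> 1 / eps"
proof -
  have "real (card F) * (eps * m x) \<le> (\<Sum>y\<in>F. \<mu> x y)"
    using sum_bounded_below[of F "eps * m x" "\<mu> x"] eps(3) assms by (auto simp: subset_iff)
  also have "\<dots> \<le> m x"
    by (rule finite_sum_le_has_sum[OF infsum_nbh]) (use assms in \<open>auto simp: mu_nonneg\<close>)
  finally have "(real (card F) * eps) * m x \<le> 1 * m x" by (simp add: mult.assoc)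
  then have "real (card F) * eps \<le> 1" using m_pos[of x] by (simp only: mult_le_cancel_right_pos)
  then show ?thesis using eps(1) by (simp add: field_simps)
qed

lemma finite_nbh: "finite (nbh x)"
proof (rule ccontr)
  assume "infinite (nbh x)"
  then obtain F where F: "finite F" "F \<subseteq> nbh x" "card F = nat \<lceil>1 / eps\<rceil> + 1"
    by (meson infinite_arbitrarily_large)
  then have "real (nat \<lceil>1 / eps\<rceil> + 1) \<le> 1 / eps" using card_nbh_le[of F x] by simp
  then show False by linarith
qed

lemma m_eq_sum: "m x = (\<Sum>y\<in>nbh x. \<mu> x y)"
  using infsum_nbh[of x] finite_nbh[of x] by (metis has_sum_finite has_sum_unique)

lemma markov_eq: "markov \<mu> f x = (\<Sum>y\<in>nbh x. \<mu> x y * f y) / m x"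
  unfolding markov_def nbh_def[symmetric] by (simp add: infsum_finite[OF finite_nbh])

lemma mu_le_m: "\<mu> x y \<le> m x"
proof (cases "y \<in> nbh x")
  case True
  then show ?thesis unfolding m_eq_sum by (intro member_le_sum) (auto simp: mu_nonneg finite_nbh)
qed (simp add: mu_eq_0 m_nonneg)

lemma Lp_weight_m: "p \<ge> 1 \<Longrightarrow> Lp_weight m p"
  by unfold_locales (auto simp: m_pos)

text \<open>Stated for a general symmetric kernel because it is applied twice: to
  \<open>\<mu>\<close> itself with \<open>l = 1\<close>, and to \<open>\<mu>\<close> with part of
  the loops removed and \<open>l = 1 - eps\<close>.\<close>

lemma weighted_average_lp_le:
  assumes p: "p \<ge> 1" and \<nu>: "\<And>x y. \<nu> x y = \<nu> y x" "\<And>x y. \<nu> x y \<ge> 0" "\<And>x y. y \<notin> nbh x \<Longrightarrow> \<nu> x y = 0"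
    and l: "\<And>x. (\<Sum>y\<in>nbh x. \<nu> x y) \<le> l * m x"
    and f: "Lp_le m p f B" "B \<ge> 0"
  shows "Lp_le m p (\<lambda>x. (\<Sum>y\<in>nbh x. \<nu> x y * f y) / m x) (l * B)"
proof -
  interpret Lp_weight m p using p by (rule Lp_weight_m)
  have row: "(\<Sum>w\<in>S. \<nu> x w / (m x * m w) * m w) \<le> l" if "finite S" for x S
  proof -
    have "(\<Sum>w\<in>S. \<nu> x w / (m x * m w) * m w) = (\<Sum>w\<in>S. \<nu> x w) / m x"
      unfolding sum_divide_distrib by (rule sum.cong) (use m_pos in \<open>auto simp: less_imp_neq[symmetric]\<close>)
    also have "(\<Sum>w\<in>S. \<nu> x w) \<le> (\<Sum>w\<in>nbh x. \<nu> x w)"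
    proof -
      have "(\<Sum>w\<in>S. \<nu> x w) = (\<Sum>w\<in>S \<inter> nbh x. \<nu> x w)"
        by (rule sum.mono_neutral_right) (use that \<nu> in auto)
      also have "\<dots> \<le> (\<Sum>w\<in>nbh x. \<nu> x w)"
        by (rule sum_mono2) (use \<nu> finite_nbh in auto)
      finally show ?thesis .
    qed
    also have "\<dots> / m x \<le> l" using l[of x] m_pos[of x] by (simp add: field_simps)
    finally show ?thesis using m_nonneg[of x] by (simp add: divide_right_mono)
  qed
  have "Lp_le m p (\<lambda>x. (\<Sum>y\<in>nbh x. \<nu> x y * f y) / m x) (l powr (1 - 1 / p) * l powr (1 / p) * B)"
  proof (rule schur_test[where K = "\<lambda>x w. \<nu> x w / (m x * m w)", OF _ row _ f])
    show "\<nu> x w / (m x * m w) \<ge> 0" for x w using \<nu> m_nonneg by simp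
    show "(\<Sum>x\<in>F. \<nu> x w / (m x * m w) * m x) \<le> l" if "finite F" for w F
      using row[OF that, of w] by (simp add: \<nu>(1)[of w] mult.commute)
    fix x
    have "\<bar>(\<Sum>y\<in>nbh x. \<nu> x y * f y) / m x\<bar> \<le> (\<Sum>y\<in>nbh x. \<bar>\<nu> x y * f y\<bar>) / m x"
      using m_nonneg[of x] by (simp add: divide_right_mono)
    also have "\<dots> = (\<Sum>w\<in>nbh x. \<nu> x w / (m x * m w) * \<bar>f w\<bar> * m w)"
      unfolding sum_divide_distrib
    proof (rule sum.cong)
      fix y
      show "\<bar>\<nu> x y * f y\<bar> / m x = \<nu> x y / (m x * m y) * \<bar>f y\<bar> * m y"
        using m_pos[of y] \<nu>(2)[of x y] by (simp add: abs_mult)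
    qed simp
    finally show "\<exists>S. finite S \<and> \<bar>(\<Sum>y\<in>nbh x. \<nu> x y * f y) / m x\<bar> \<le> (\<Sum>w\<in>S. \<nu> x w / (m x * m w) * \<bar>f w\<bar> * m w)"
      using finite_nbh by blast
  qed
  moreover have "l \<ge> 0" using row[of "{}"] by simp
  ultimately show ?thesis by (cases "l = 0") (auto simp flip: powr_add)
qed

definition of_ell2 :: "'a ell2 \<Rightarrow> 'a \<Rightarrow> real" where
  "of_ell2 u x = vec_of u x / sqrt (m x)"

lemma vec_of_eq: "vec_of u x = sqrt (m x) * of_ell2 u x"
  using m_pos[of x] by (simp add: of_ell2_def)

lemma of_ell2_simps [simp]:
  "of_ell2 0 = (\<lambda>_. 0)" "of_ell2 (u + v) = (\<lambda>x. of_ell2 u x + of_ell2 v x)"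
  "of_ell2 (u - v) = (\<lambda>x. of_ell2 u x - of_ell2 v x)" "of_ell2 (c *\<^sub>R u) = (\<lambda>x. c * of_ell2 u x)"
  by (auto simp: of_ell2_def fun_eq_iff add_divide_distrib diff_divide_distrib)

lemma inj_of_ell2: "inj of_ell2"
proof (rule injI)
  fix u v assume "of_ell2 u = of_ell2 v"
  then have "vec_of u = vec_of v" by (simp add: fun_eq_iff vec_of_eq)
  then show "u = v" by (simp add: vec_of_inject)
qed

lemma lp_le_2_iff: "B \<ge> 0 \<Longrightarrow> Lp_le m 2 f B \<longleftrightarrow> (\<forall>F. finite F \<longrightarrow> (\<Sum>x\<in>F. (sqrt (m x) * f x)\<^sup>2) \<le> B\<^sup>2)"
proof -
  have "\<bar>f x\<bar> powr 2 * m x = (sqrt (m x) * f x)\<^sup>2" for x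
    using m_nonneg[of x] by (simp add: power_mult_distrib)
  then show "B \<ge> 0 \<Longrightarrow> ?thesis" by (simp add: Lp_le_def)
qed

lemma lp_le_of_ell2: "B \<ge> 0 \<Longrightarrow> Lp_le m 2 (of_ell2 u) B \<longleftrightarrow> norm u \<le> B"
proof
  assume B: "B \<ge> 0"
  note * = lp_le_2_iff[OF B, of "of_ell2 u", folded vec_of_eq]
  show "norm u \<le> B" if "Lp_le m 2 (of_ell2 u) B" using * that B by (auto intro: norm_ell2_le)
  show "Lp_le m 2 (of_ell2 u) B" if "norm u \<le> B"
    using * sum_square_le_norm_ell2[of _ u] power_mono[OF that norm_ge_zero, of 2] by (auto intro: order_trans)
qed

lemma lp_le_2_obtain:
  assumes "Lp_le m 2 f B" "B \<ge> 0"
  obtains u where "of_ell2 u = f" "norm u \<le> B"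
proof -
  have "square_summable (\<lambda>x. sqrt (m x) * f x)"
    using assms lp_le_2_iff by (intro square_summableI[of _ "B\<^sup>2"]) auto
  then have "of_ell2 (Abs_ell2 (\<lambda>x. sqrt (m x) * f x)) = f"
    using m_pos by (auto simp: of_ell2_def vec_of_Abs fun_eq_iff less_imp_neq[symmetric])
  then show ?thesis using that lp_le_of_ell2[OF assms(2)] assms(1) by metis
qed

lemma Lp_norm_of_ell2: "Lp_norm \<mu> 2 (of_ell2 u) = ennreal (norm u)"
proof (rule antisym)
  show le: "Lp_norm \<mu> 2 (of_ell2 u) \<le> ennreal (norm u)"
    by (simp add: Lp_norm_le_iff[OF m_pos] lp_le_of_ell2)
  define r where "r = enn2real (Lp_norm \<mu> 2 (of_ell2 u))"
  have r: "Lp_norm \<mu> 2 (of_ell2 u) = ennreal r" "r \<ge> 0"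
    using le_less_trans[OF le ennreal_less_top] unfolding r_def by auto
  then have "norm u \<le> r"
    using Lp_norm_le_iff[OF m_pos, of 2 r "of_ell2 u"] lp_le_of_ell2[of r u] by simp
  then show "ennreal (norm u) \<le> Lp_norm \<mu> 2 (of_ell2 u)" by (simp add: r ennreal_leI)
qed

lemma L2_eq: "L2 \<mu> = range of_ell2"
proof (rule set_eqI)
  fix f
  show "f \<in> L2 \<mu> \<longleftrightarrow> f \<in> range of_ell2"
  proof
    assume f: "f \<in> L2 \<mu>"
    define r where "r = enn2real (Lp_norm \<mu> 2 f)"
    have "Lp_norm \<mu> 2 f = ennreal r" "r \<ge> 0"
      using f unfolding r_def L2_def by auto
    then have "Lp_le m 2 f r" using Lp_norm_le_iff[OF m_pos, of 2 r f] by simp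
    then show "f \<in> range of_ell2" using lp_le_2_obtain[OF _ \<open>r \<ge> 0\<close>] by (metis rangeI)
  qed (auto simp: L2_def Lp_norm_of_ell2)
qed

definition mark :: "'a ell2 \<Rightarrow> 'a ell2" where
  "mark u = (SOME v. of_ell2 v = markov \<mu> (of_ell2 u))"

lemma markov_lp_le: "p \<ge> 1 \<Longrightarrow> Lp_le m p f B \<Longrightarrow> B \<ge> 0 \<Longrightarrow> Lp_le m p (markov \<mu> f) B"
  using weighted_average_lp_le[of p \<mu> 1 f B] mu_sym mu_nonneg mu_eq_0
  by (simp add: markov_eq[abs_def] m_eq_sum[symmetric])

lemma mark: "of_ell2 (mark u) = markov \<mu> (of_ell2 u)"
proof -
  have "Lp_le m 2 (markov \<mu> (of_ell2 u)) (norm u)"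
    by (rule markov_lp_le) (auto simp: lp_le_of_ell2)
  then have "\<exists>v. of_ell2 v = markov \<mu> (of_ell2 u)" by (auto elim: lp_le_2_obtain)
  then show ?thesis unfolding mark_def by (rule someI_ex)
qed

lemma norm_mark_le: "norm (mark u) \<le> norm u"
proof -
  have "Lp_le m 2 (markov \<mu> (of_ell2 u)) (norm u)"
    by (rule markov_lp_le) (auto simp: lp_le_of_ell2)
  then show ?thesis by (simp add: lp_le_of_ell2 flip: mark)
qed

text \<open>Removing the part \<open>eps\<close> of the loops leaves a symmetric nonnegative kernel of mass \<open>1 - eps\<close>.\<close>

lemma norm_mark_lazy_le: "norm (mark u - eps *\<^sub>R u) \<le> (1 - eps) * norm u"
proof -
  define \<nu> where "\<nu> x y = \<mu> x y - (if x = y then eps * m x else 0)" for x y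
  have "Lp_le m 2 (\<lambda>x. (\<Sum>y\<in>nbh x. \<nu> x y * of_ell2 u y) / m x) ((1 - eps) * norm u)"
  proof (rule weighted_average_lp_le)
    show "\<nu> x y = \<nu> y x" for x y by (auto simp: \<nu>_def mu_sym)
    show "\<nu> x y \<ge> 0" for x y using eps(3)[OF nbh_refl] mu_nonneg by (auto simp: \<nu>_def)
    show "\<nu> x y = 0" if "y \<notin> nbh x" for x y using that nbh_refl by (auto simp: \<nu>_def mu_eq_0)
    show "(\<Sum>y\<in>nbh x. \<nu> x y) \<le> (1 - eps) * m x" for x
      using finite_nbh nbh_refl[of x] by (simp add: \<nu>_def sum_subtractf m_eq_sum[symmetric] algebra_simps)
  qed (auto simp: lp_le_of_ell2)
  moreover have "(\<Sum>y\<in>nbh x. \<nu> x y * of_ell2 u y) / m x = of_ell2 (mark u - eps *\<^sub>R u) x" for x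
  proof -
    have "(\<Sum>y\<in>nbh x. \<nu> x y * of_ell2 u y) = (\<Sum>y\<in>nbh x. \<mu> x y * of_ell2 u y - (if x = y then eps * m x * of_ell2 u y else 0))"
      by (rule sum.cong) (auto simp: \<nu>_def algebra_simps)
    also have "\<dots> = (\<Sum>y\<in>nbh x. \<mu> x y * of_ell2 u y) - eps * m x * of_ell2 u x"
      using finite_nbh nbh_refl[of x] by (simp add: sum_subtractf)
    finally show ?thesis using m_pos[of x] by (simp add: mark markov_eq diff_divide_distrib)
  qed
  moreover have "0 \<le> (1 - eps) * norm u" using eps by simp
  ultimately show ?thesis using lp_le_of_ell2[of "(1 - eps) * norm u" "mark u - eps *\<^sub>R u"] by simp
qed

lemma mark_eqI: "of_ell2 v = markov \<mu> (of_ell2 u) \<Longrightarrow> mark u = v"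
  using injD[OF inj_of_ell2] mark by metis

lemma bounded_linear_mark: "bounded_linear mark"
proof (rule bounded_linear_intro)
  show "mark (u + v) = mark u + mark v" for u v
    by (rule mark_eqI) (auto simp: mark markov_eq fun_eq_iff distrib_left sum.distrib add_divide_distrib)
  show "mark (r *\<^sub>R u) = r *\<^sub>R mark u" for r u
    by (rule mark_eqI) (auto simp: mark markov_eq fun_eq_iff sum_distrib_left mult_ac)
  show "norm (mark u) \<le> norm u * 1" for u using norm_mark_le by simp
qed

lemma mark_symmetric: "mark u \<bullet> v = u \<bullet> mark v"
proof (rule symmetric_ell2I[OF bounded_linear_mark])
  fix x v
  have "mark (basis_vec x) = (\<Sum>y\<in>nbh x. (\<mu> x y / (sqrt (m x) * sqrt (m y))) *\<^sub>R basis_vec y)" (is "_ = ?v")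
  proof (rule mark_eqI, rule ext)
    fix z
    have "vec_of ?v z = (\<Sum>y\<in>nbh x. vec_of ((\<mu> x y / (sqrt (m x) * sqrt (m y))) *\<^sub>R basis_vec y) z)"
      using finite_nbh[of x] by (induction rule: finite_induct) auto
    also have "\<dots> = (\<Sum>y\<in>nbh x. if z = y then \<mu> x y / (sqrt (m x) * sqrt (m y)) else 0)"
      by (rule sum.cong) (auto simp: vec_of_basis_vec)
    also have "\<dots> = \<mu> x z / (sqrt (m x) * sqrt (m z))"
      using finite_nbh[of x] mu_eq_0[of z x] by simp
    finally have "of_ell2 ?v z = \<mu> x z / (sqrt (m x) * m z)"
      using m_pos[of z] by (simp add: of_ell2_def)
    moreover have "markov \<mu> (of_ell2 (basis_vec x)) z = \<mu> x z / (sqrt (m x) * m z)"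
    proof -
      have "(\<Sum>y\<in>nbh z. \<mu> z y * of_ell2 (basis_vec x) y) = (\<Sum>y\<in>nbh z. if y = x then \<mu> z x / sqrt (m x) else 0)"
        by (rule sum.cong) (auto simp: of_ell2_def vec_of_basis_vec)
      also have "\<dots> = \<mu> x z / sqrt (m x)"
        using finite_nbh[of z] mu_eq_0[of x z] by (simp add: mu_sym)
      finally show ?thesis by (simp add: markov_eq)
    qed
    ultimately show "of_ell2 ?v z = markov \<mu> (of_ell2 (basis_vec x)) z" by simp
  qed
  then have "mark (basis_vec x) \<bullet> v = (\<Sum>y\<in>nbh x. \<mu> x y / (sqrt (m x) * sqrt (m y)) * vec_of v y)"
    by (simp add: inner_sum_left inner_basis_vec)
  also have "\<dots> = sqrt (m x) * markov \<mu> (of_ell2 v) x"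
  proof -
    have "sqrt (m x) * markov \<mu> (of_ell2 v) x = (\<Sum>y\<in>nbh x. \<mu> x y * of_ell2 v y) / sqrt (m x)"
      using m_pos[of x] by (simp add: markov_eq field_simps real_sqrt_mult_self flip: real_sqrt_mult)
    then show ?thesis by (simp add: sum_divide_distrib of_ell2_def mult_ac)
  qed
  also have "\<dots> = basis_vec x \<bullet> mark v" by (simp add: inner_basis_vec vec_of_eq mark)
  finally show "mark (basis_vec x) \<bullet> v = basis_vec x \<bullet> mark v" .
qed

definition lap :: "'a ell2 \<Rightarrow> 'a ell2" where "lap u = u - mark u"

lemma of_ell2_lap: "of_ell2 (lap u) = laplacian \<mu> (of_ell2 u)"
  by (auto simp: lap_def laplacian_def mark)

lemma bounded_linear_lap: "bounded_linear lap"
  unfolding lap_def by (intro bounded_linear_sub bounded_linear_ident bounded_linear_mark)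

lemma lap_symmetric: "lap u \<bullet> v = u \<bullet> lap v"
  by (simp add: lap_def inner_diff_left inner_diff_right mark_symmetric)

text \<open>Outside the interval the shifted operator is coercive up to sign. The lower end comes
  from \<open>norm_mark_le\<close>. For the upper end, \<open>P - eps\<close> has norm at most
  \<open>1 - eps\<close>, hence \<open>P \<ge> 2 * eps - 1\<close> as a form and
  \<open>\<Delta> \<le> 2 - 2 * eps\<close>.\<close>

lemma spec_lap: "spec_real lap \<subseteq> {0..2 - 2 * eps}"
proof
  fix s assume s: "s \<in> spec_real lap"
  show "s \<in> {0..2 - 2 * eps}"
  proof (rule ccontr)
    assume "\<not> ?thesis"
    then consider "s < 0" | "s > 2 - 2 * eps" by fastforce
    then have "bij (\<lambda>u. s *\<^sub>R u - lap u)"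
    proof cases
      case 1
      have "bij (\<lambda>u. lap u - s *\<^sub>R u)"
      proof (rule coercive_imp_bij)
        show "- s * (u \<bullet> u) \<le> (lap u - s *\<^sub>R u) \<bullet> u" for u
        proof -
          have "mark u \<bullet> u \<le> norm (mark u) * norm u" by (rule norm_cauchy_schwarz)
          also have "\<dots> \<le> u \<bullet> u"
            using mult_right_mono[OF norm_mark_le norm_ge_zero, of u u] by (simp add: dot_square_norm power2_eq_square)
          finally show ?thesis by (simp add: lap_def inner_diff_left)
        qed
      qed (use 1 bounded_linear_lap in \<open>auto intro!: bounded_linear_sub bounded_linear_scaleR_right\<close>)
      from bij_comp[OF this bij_uminus] show ?thesis by (simp add: comp_def)
    next
      case 2
      show ?thesis
      proof (rule coercive_imp_bij)
        show "(s - (2 - 2 * eps)) * (u \<bullet> u) \<le> (s *\<^sub>R u - lap u) \<bullet> u" for u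
        proof -
          have "- ((mark u - eps *\<^sub>R u) \<bullet> u) \<le> norm (mark u - eps *\<^sub>R u) * norm u"
            using Cauchy_Schwarz_ineq2[of "mark u - eps *\<^sub>R u" u] by linarith
          also have "\<dots> \<le> (1 - eps) * (u \<bullet> u)"
            using mult_right_mono[OF norm_mark_lazy_le norm_ge_zero, of u u] by (simp add: dot_square_norm power2_eq_square)
          finally show ?thesis by (simp add: lap_def inner_diff_left algebra_simps)
        qed
      qed (use 2 bounded_linear_lap in \<open>auto intro!: bounded_linear_sub bounded_linear_scaleR_right\<close>)
    qed
    then show False using s by (simp add: spec_real_def)
  qed
qed

lemma L2_spectrum_laplacian: "L2_spectrum \<mu> (laplacian \<mu>) = spec_real lap"
  unfolding L2_spectrum_def spec_real_def L2_eq
  by (rule Collect_cong, subst bij_betw_conjugate[OF inj_of_ell2]) (auto simp: of_ell2_lap)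

lemma poly_operator_of_ell2: "poly_operator q (laplacian \<mu>) (of_ell2 u) = of_ell2 (poly_op q lap u)"
proof
  fix x
  have it: "(laplacian \<mu> ^^ i) (of_ell2 u) = of_ell2 ((lap ^^ i) u)" for i
    by (induction i) (simp_all add: of_ell2_lap)
  have "of_ell2 (\<Sum>i\<in>I. c i *\<^sub>R v i) x = (\<Sum>i\<in>I. c i * of_ell2 (v i) x)" if "finite I" for I :: "nat set" and c v
    using that by induction auto
  then show "poly_operator q (laplacian \<mu>) (of_ell2 u) x = of_ell2 (poly_op q lap u) x"
    by (simp add: poly_operator_def poly_op_def it)
qed

section \<open>Functional calculus of the Laplacian\<close>

lemma norm_poly_op_lap_le:
  assumes "\<And>t. 0 \<le> t \<Longrightarrow> t \<le> 2 - 2 * eps \<Longrightarrow> \<bar>poly q t\<bar> \<le> M" "M \<ge> 0"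
  shows "norm (poly_op q lap u) \<le> M * norm u"
  by (rule norm_poly_op_le[OF bounded_linear_lap lap_symmetric]) (use assms spec_lap in auto)

text \<open>One good sequence suffices: polynomials that are close on the spectrum are close as
  operators, so every admissible sequence has the limit of \<open>r\<close>. Uniqueness of the
  described function follows by testing it with \<open>r\<close> itself.\<close>

lemma functional_calculus_eq:
  assumes r: "uniform_limit {0..2 - 2 * eps} (\<lambda>n. poly (r n)) \<phi> sequentially"
    and v: "(\<lambda>n. poly_op (r n) lap u) \<longlonglongrightarrow> v"
  shows "functional_calculus \<mu> \<phi> (laplacian \<mu>) (of_ell2 u) = of_ell2 v"
proof -
  let ?S = "spec_real lap"
  have rS: "uniform_limit ?S (\<lambda>n. poly (r n)) \<phi> sequentially"
    by (rule uniform_limit_on_subset[OF r spec_lap])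
  have norm_eq: "Lp_norm \<mu> 2 (\<lambda>x. poly_operator q (laplacian \<mu>) (of_ell2 u) x - of_ell2 w x)
      = ennreal (norm (poly_op q lap u - w))" for q w
    by (simp add: poly_operator_of_ell2 flip: Lp_norm_of_ell2)
  have tend_iff: "(\<lambda>n. ennreal (norm (poly_op (q n) lap u - w))) \<longlonglongrightarrow> 0 \<longleftrightarrow> (\<lambda>n. poly_op (q n) lap u) \<longlonglongrightarrow> w" for q :: "nat \<Rightarrow> real poly" and w
    by (subst ennreal_tendsto_0_iff) (auto simp: tendsto_norm_zero_iff LIM_zero_iff)
  show ?thesis
    unfolding functional_calculus_def L2_spectrum_laplacian
  proof (rule the_equality)
    have "(\<lambda>n. poly_op (q n) lap u) \<longlonglongrightarrow> v" if q: "uniform_limit ?S (\<lambda>n. poly (q n)) \<phi> sequentially" for q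
    proof -
      have "(\<lambda>n. poly_op (q n) lap u - poly_op (r n) lap u) \<longlonglongrightarrow> 0"
      proof (rule tendstoI)
        fix e :: real assume e: "e > 0"
        define d where "d = e / (norm u + 1)"
        have d: "d > 0" using e by (simp add: d_def add_nonneg_pos)
        have "\<forall>\<^sub>F n in sequentially. \<forall>t\<in>?S. dist (poly (q n) t) (\<phi> t) < d / 2"
          "\<forall>\<^sub>F n in sequentially. \<forall>t\<in>?S. dist (poly (r n) t) (\<phi> t) < d / 2"
          using uniform_limitD[OF q half_gt_zero[OF d]] uniform_limitD[OF rS half_gt_zero[OF d]] by auto
        then show "\<forall>\<^sub>F n in sequentially. dist (poly_op (q n) lap u - poly_op (r n) lap u) 0 < e"
        proof eventually_elim
          case (elim n)
          have "norm (poly_op (q n - r n) lap u) \<le> d * norm u"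
          proof (rule norm_poly_op_le[OF bounded_linear_lap lap_symmetric])
            fix t assume "t \<in> ?S"
            then have "dist (poly (q n) t) (\<phi> t) < d / 2" "dist (poly (r n) t) (\<phi> t) < d / 2"
              using elim by auto
            then show "\<bar>poly (q n - r n) t\<bar> \<le> d" unfolding dist_real_def poly_diff by arith
          qed (use d in auto)
          also have "\<dots> < d * (norm u + 1)" using d by simp
          also have "\<dots> = e" using norm_ge_zero[of u] by (simp add: d_def add_nonneg_eq_0_iff)
          finally show ?case by (simp add: poly_op_diff)
        qed
      qed
      from tendsto_add[OF this v] show ?thesis by simp
    qed
    then show "of_ell2 v \<in> L2 \<mu> \<and> (\<forall>q. uniform_limit ?S (\<lambda>n. poly (q n)) \<phi> sequentially \<longrightarrow>
        (\<lambda>n. Lp_norm \<mu> 2 (\<lambda>x. poly_operator (q n) (laplacian \<mu>) (of_ell2 u) x - of_ell2 v x)) \<longlonglongrightarrow> 0)"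
      by (simp add: L2_eq norm_eq tend_iff)
  next
    fix g assume g: "g \<in> L2 \<mu> \<and> (\<forall>q. uniform_limit ?S (\<lambda>n. poly (q n)) \<phi> sequentially \<longrightarrow>
        (\<lambda>n. Lp_norm \<mu> 2 (\<lambda>x. poly_operator (q n) (laplacian \<mu>) (of_ell2 u) x - g x)) \<longlonglongrightarrow> 0)"
    then obtain w where w: "g = of_ell2 w" by (auto simp: L2_eq)
    have "(\<lambda>n. poly_op (r n) lap u) \<longlonglongrightarrow> w"
      using g rS by (simp add: w norm_eq tend_iff)
    then show "g = of_ell2 v" using v LIMSEQ_unique w by blast
  qed
qed

lemma poly_op_one_minus_power: "poly_op ([:1, -1:] ^ k) lap u = (mark ^^ k) u"
proof (induction k)
  case (Suc k)
  have "poly_op [:1, -1:] lap v = v - lap v" for v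
    using bounded_linear.linear[OF bounded_linear_lap] by (simp add: linear_0 linear_neg)
  then have "poly_op [:1, -1:] lap v = mark v" for v by (simp add: lap_def)
  then show ?case unfolding power_Suc poly_op_mult[OF bounded_linear.linear[OF bounded_linear_lap]] Suc by simp
qed (use bounded_linear.linear[OF bounded_linear_lap] in \<open>simp add: linear_0 one_pCons\<close>)

lemma of_ell2_mark_power: "of_ell2 ((mark ^^ k) u) = (markov \<mu> ^^ k) (of_ell2 u)"
  by (induction k) (simp_all add: mark)

lemma norm_mark_power_le: "norm ((mark ^^ k) u) \<le> norm u"
  by (induction k) (auto intro: order_trans[OF norm_mark_le])

text \<open>The partial sums of the binomial series in \<open>1 - t\<close> are the approximating
  polynomials. They converge on vectors because \<open>P\<close> is a contraction and the
  coefficients are absolutely summable; pairing with a basis vector then gives the value at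
  \<open>x\<close>.\<close>

lemma laplacian_power_of_ell2:
  assumes g: "0 < \<gamma>" "\<gamma> < 1"
  shows "laplacian_power \<mu> \<gamma> (of_ell2 u) x = (\<Sum>k. neg_binom (- \<gamma>) k * (markov \<mu> ^^ k) (of_ell2 u) x)"
proof -
  define r where "r n = (\<Sum>k<n. smult (neg_binom (- \<gamma>) k) ([:1, -1:] ^ k))" for n
  have rop: "poly_op (r n) lap u = (\<Sum>k<n. neg_binom (- \<gamma>) k *\<^sub>R (mark ^^ k) u)" for n
    by (simp add: r_def poly_op_sum poly_op_smult poly_op_one_minus_power)
  have sm: "summable (\<lambda>k. neg_binom (- \<gamma>) k *\<^sub>R (mark ^^ k) u)"
  proof (rule summable_comparison_test'[where N = 0])
    show "summable (\<lambda>k. \<bar>neg_binom (- \<gamma>) k\<bar> * norm u)"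
      by (intro summable_mult2 neg_binom_abs_summable g)
    show "norm (neg_binom (- \<gamma>) n *\<^sub>R (mark ^^ n) u) \<le> \<bar>neg_binom (- \<gamma>) n\<bar> * norm u" for n
      by (simp add: mult_left_mono norm_mark_power_le)
  qed
  define v where "v = (\<Sum>k. neg_binom (- \<gamma>) k *\<^sub>R (mark ^^ k) u)"
  have "functional_calculus \<mu> (\<lambda>t. t powr \<gamma>) (laplacian \<mu>) (of_ell2 u) = of_ell2 v"
  proof (rule functional_calculus_eq)
    show "uniform_limit {0..2 - 2 * eps} (\<lambda>n. poly (r n)) (\<lambda>t. t powr \<gamma>) sequentially"
    proof -
      have "poly (r n) = (\<lambda>t. \<Sum>k<n. neg_binom (- \<gamma>) k * (1 - t) ^ k)" for n
        by (auto simp: r_def poly_sum poly_power fun_eq_iff)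
      then show ?thesis using neg_binom_uniform_limit[OF g, of "2 * eps"] eps(1) by simp
    qed
    show "(\<lambda>n. poly_op (r n) lap u) \<longlonglongrightarrow> v"
      using summable_LIMSEQ[OF sm] by (simp add: rop v_def)
  qed
  moreover have "(\<lambda>k. neg_binom (- \<gamma>) k * of_ell2 ((mark ^^ k) u) x) sums of_ell2 v x"
  proof -
    have "(\<lambda>k. basis_vec x \<bullet> (neg_binom (- \<gamma>) k *\<^sub>R (mark ^^ k) u)) sums (basis_vec x \<bullet> v)"
      using summable_sums[OF sm] unfolding v_def[symmetric]
      by (rule bounded_linear.sums[OF bounded_linear_inner_right])
    then have "(\<lambda>k. (neg_binom (- \<gamma>) k * vec_of ((mark ^^ k) u) x) / sqrt (m x)) sums (vec_of v x / sqrt (m x))"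
      by (intro sums_divide) (simp add: inner_basis_vec)
    then show ?thesis by (simp add: of_ell2_def)
  qed
  ultimately show ?thesis
    by (simp add: laplacian_power_def sums_iff of_ell2_mark_power)
qed

lemma finite_support_of_ell2:
  assumes "finite {x. f x \<noteq> 0}"
  obtains u where "of_ell2 u = f"
proof -
  let ?X = "{x. f x \<noteq> 0}"
  have "Lp_le m 2 f (sqrt (\<Sum>x\<in>?X. (sqrt (m x) * f x)\<^sup>2))"
  proof (subst lp_le_2_iff, safe)
    fix F :: "'a set" assume "finite F"
    have "(\<Sum>x\<in>F. (sqrt (m x) * f x)\<^sup>2) = (\<Sum>x\<in>F \<inter> ?X. (sqrt (m x) * f x)\<^sup>2)"
      by (rule sum.mono_neutral_right) (use \<open>finite F\<close> in auto)
    also have "\<dots> \<le> (\<Sum>x\<in>?X. (sqrt (m x) * f x)\<^sup>2)"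
      by (rule sum_mono2) (use assms in auto)
    finally show "(\<Sum>x\<in>F. (sqrt (m x) * f x)\<^sup>2) \<le> (sqrt (\<Sum>x\<in>?X. (sqrt (m x) * f x)\<^sup>2))\<^sup>2"
      by (simp add: sum_nonneg)
  qed (simp add: sum_nonneg)
  from lp_le_2_obtain[OF this] show ?thesis using that by (auto simp: sum_nonneg)
qed

lemma laplacian_power_eq:
  assumes "0 < \<gamma>" "\<gamma> < 1" "finite {x. f x \<noteq> 0}"
  shows "laplacian_power \<mu> \<gamma> f x = (\<Sum>k. neg_binom (- \<gamma>) k * (markov \<mu> ^^ k) f x)"
  using laplacian_power_of_ell2[OF assms(1,2)] finite_support_of_ell2[OF assms(3)] by metis

text \<open>On \<open>[0, 1]\<close> this is \<open>mult_power_one_minus_le\<close>. Beyond 1 the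
  gap gives \<open>|1 - t| \<le> 1 - 2 * eps\<close>, and the resulting geometric decay is converted
  into \<open>1 / (k + 1)\<close> by the same inequality at \<open>2 * eps\<close>, whence the
  constant \<open>1 / eps\<close>.\<close>

lemma norm_lap_mark_power_le: "norm (lap ((mark ^^ k) u)) \<le> (1 + 1 / eps) / (real k + 1) * norm u"
proof -
  have "norm (poly_op ([:0, 1:] * [:1, -1:] ^ k) lap u) \<le> (1 + 1 / eps) / (real k + 1) * norm u"
  proof (rule norm_poly_op_lap_le)
    fix t assume t: "0 \<le> t" "t \<le> 2 - 2 * eps"
    have "\<bar>poly ([:0, 1:] * [:1, -1:] ^ k) t\<bar> = t * \<bar>1 - t\<bar> ^ k"
      using t by (simp add: poly_power abs_mult power_abs)
    also have "\<dots> \<le> (1 + 1 / eps) / (real k + 1)"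
    proof (cases "t \<le> 1")
      case True
      then have "t * \<bar>1 - t\<bar> ^ k \<le> 1 / (real k + 1)" using mult_power_one_minus_le[of t k] t by simp
      also have "\<dots> \<le> (1 + 1 / eps) / (real k + 1)" using eps by (intro divide_right_mono) auto
      finally show ?thesis .
    next
      case False
      have "t * \<bar>1 - t\<bar> ^ k \<le> 2 * (1 - 2 * eps) ^ k"
        using t False eps by (intro mult_mono power_mono) auto
      also have "\<dots> = (2 * eps * (1 - 2 * eps) ^ k) / eps" using eps by simp
      also have "\<dots> \<le> (1 / (real k + 1)) / eps"
        using eps mult_power_one_minus_le[of "2 * eps" k] by (intro divide_right_mono) auto
      also have "\<dots> = (1 / eps) / (real k + 1)" by simp
      also have "\<dots> \<le> (1 + 1 / eps) / (real k + 1)" by (intro divide_right_mono) auto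
      finally show ?thesis .
    qed
    finally show "\<bar>poly ([:0, 1:] * [:1, -1:] ^ k) t\<bar> \<le> (1 + 1 / eps) / (real k + 1)" .
  qed (use eps in auto)
  moreover have "poly_op ([:0, 1:] * [:1, -1:] ^ k) lap u = lap ((mark ^^ k) u)"
    using bounded_linear.linear[OF bounded_linear_lap]
    by (simp only: poly_op_mult poly_op_one_minus_power) (simp add: linear_0)
  ultimately show ?thesis by simp
qed

end

section \<open>Graph distance, heat kernel and tree structure\<close>

context lb_graph
begin

abbreviation "gd \<equiv> gdist \<mu>"
abbreviation "hk \<equiv> heat_kernel \<mu>"

lemma ex_walk: "\<exists>n. (adj \<mu> ^^ n) x y"
  using weighted by (auto simp: weighted_graph_def rtranclp_power)

lemma gd_walk: "(adj \<mu> ^^ gd x y) x y"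
  unfolding gdist_def using ex_walk by (rule LeastI_ex)

lemma gd_le_iff: "gd x y \<le> n \<longleftrightarrow> (adj \<mu> ^^ n) x y"
proof
  assume "gd x y \<le> n"
  then show "(adj \<mu> ^^ n) x y"
    by (induction n rule: dec_induct) (auto simp: gd_walk adj_refl intro!: relcomppI)
next
  show "gd x y \<le> n" if "(adj \<mu> ^^ n) x y" unfolding gdist_def using that by (rule Least_le)
qed

lemma gd_triangle: "gd x z \<le> gd x y + gd y z"
  unfolding gd_le_iff relpowp_add using gd_walk by blast

lemma gd_sym: "gd x y = gd y x"
proof -
  have "(adj \<mu> ^^ n) y x" if "(adj \<mu> ^^ n) x y" for n x y
    using that
  proof (induction n arbitrary: y)
    case (Suc n)
    then obtain b where "(adj \<mu> ^^ n) x b" "adj \<mu> b y" by (auto elim: relpowp_Suc_E)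
    then show ?case using Suc.IH[of b] adj_sym by (blast intro: relpowp_Suc_I2)
  qed auto
  then have "gd y x \<le> gd x y" for x y using gd_walk gd_le_iff by blast
  then show ?thesis by (simp add: antisym)
qed

lemma gd_eq_0_iff [simp]: "gd x y = 0 \<longleftrightarrow> x = y"
  using gd_le_iff[of x y 0] by simp

lemma gd_refl [simp]: "gd x x = 0" by simp

lemma gd_nbh_le: "y \<in> nbh x \<Longrightarrow> gd x y \<le> 1"
  by (simp add: gd_le_iff nbh_def eq_OO)

lemma gd_nbh: "y \<in> nbh x \<Longrightarrow> gd w y \<le> gd w x + 1"
  using gd_triangle[of w y x] gd_nbh_le[of y x] by simp

lemma gd_pred:
  assumes "gd w z = Suc n"
  obtains u where "u \<in> nbh z" "gd w u = n"
proof -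
  have "(adj \<mu> ^^ Suc n) w z" using gd_walk[of w z] assms by simp
  then obtain u where u: "(adj \<mu> ^^ n) w u" "adj \<mu> u z" by (auto elim: relpowp_Suc_E)
  then have "gd w u \<le> n" by (simp add: gd_le_iff)
  moreover have "u \<in> nbh z" using u by (simp add: nbh_def adj_sym)
  moreover have "gd w z \<le> gd w u + 1" using \<open>u \<in> nbh z\<close> by (intro gd_nbh) (simp add: nbh_sym)
  ultimately show ?thesis using that assms by simp
qed

definition cb :: "'a \<Rightarrow> nat \<Rightarrow> 'a set" where "cb x n = {y. gd x y \<le> n}"

lemma finite_cb: "finite (cb x n)"
proof (induction n)
  case (Suc n)
  have "cb x (Suc n) \<subseteq> insert x (\<Union>y\<in>cb x n. nbh y)"
  proof
    fix z assume z: "z \<in> cb x (Suc n)"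
    show "z \<in> insert x (\<Union>y\<in>cb x n. nbh y)"
    proof (cases "gd x z")
      case (Suc j)
      then obtain u where "u \<in> nbh z" "gd x u = j" by (rule gd_pred)
      then show ?thesis using z Suc by (auto simp: cb_def nbh_sym)
    qed simp
  qed
  then show ?case using Suc finite_nbh by (meson finite_UN_I finite_insert finite_subset)
qed (simp add: cb_def)

lemma sum_m_mono: "finite B \<Longrightarrow> A \<subseteq> B \<Longrightarrow> sum m A \<le> sum m B"
  by (rule sum_mono2) (auto simp: m_nonneg)

lemma vol_eq:
  assumes "gball \<mu> x r \<subseteq> cb x n"
  shows "vol \<mu> x r = sum m (gball \<mu> x r)"
  unfolding vol_def by (rule infsum_finite) (use assms finite_cb finite_subset in blast)

text \<open>Finite propagation speed: each application of \<open>P\<close> looks one edge further.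
  Thus \<open>P^k\<close> at a vertex is a finite sum even on functions without finite
  support.\<close>

lemma markov_power_cong: "(\<And>y. y \<in> cb x k \<Longrightarrow> f y = g y) \<Longrightarrow> (markov \<mu> ^^ k) f x = (markov \<mu> ^^ k) g x"
proof (induction k arbitrary: x)
  case (Suc k)
  have "(markov \<mu> ^^ k) f y = (markov \<mu> ^^ k) g y" if "y \<in> nbh x" for y
  proof (rule Suc.IH)
    fix z assume "z \<in> cb y k"
    then show "f z = g z"
      using gd_triangle[of x z y] gd_nbh_le[OF that] by (intro Suc.prems) (auto simp: cb_def)
  qed
  then show ?case unfolding funpow.simps comp_def by (subst (1 2) markov_eq) simp
qed (simp add: cb_def)

lemma markov_add: "markov \<mu> (\<lambda>x. f x + g x) = (\<lambda>x. markov \<mu> f x + markov \<mu> g x)"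
  by (simp add: markov_eq[abs_def] distrib_left sum.distrib add_divide_distrib)

lemma markov_cmult: "markov \<mu> (\<lambda>x. c * f x) = (\<lambda>x. c * markov \<mu> f x)"
  by (simp add: markov_eq[abs_def] sum_distrib_left mult_ac)

lemma markov_power_add: "(markov \<mu> ^^ k) (\<lambda>x. f x + g x) = (\<lambda>x. (markov \<mu> ^^ k) f x + (markov \<mu> ^^ k) g x)"
  by (induction k) (simp_all add: markov_add)

lemma markov_power_cmult: "(markov \<mu> ^^ k) (\<lambda>x. c * f x) = (\<lambda>x. c * (markov \<mu> ^^ k) f x)"
  by (induction k) (simp_all add: markov_cmult)

lemma markov_power_diff: "(markov \<mu> ^^ k) (\<lambda>x. f x - g x) = (\<lambda>x. (markov \<mu> ^^ k) f x - (markov \<mu> ^^ k) g x)"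
  using markov_power_add[of k f "\<lambda>x. -1 * g x"] markov_power_cmult[of k "-1" g] by simp

lemma markov_power_sum: "finite I \<Longrightarrow> (markov \<mu> ^^ k) (\<lambda>x. \<Sum>i\<in>I. f i x) = (\<lambda>x. \<Sum>i\<in>I. (markov \<mu> ^^ k) (f i) x)"
proof (induction I rule: finite_induct)
  case empty
  then show ?case using markov_power_cmult[of k 0 "\<lambda>_. 0"] by simp
qed (simp add: markov_power_add)

lemma markov_power_const: "(markov \<mu> ^^ k) (\<lambda>_. c) = (\<lambda>_. c)"
proof (induction k)
  case (Suc k)
  then show ?case
    using m_pos by (auto simp: markov_eq fun_eq_iff m_eq_sum[symmetric] less_imp_neq[symmetric] simp flip: sum_distrib_right)
qed simp

lemma markov_power_nonneg: "(\<And>x. f x \<ge> 0) \<Longrightarrow> (markov \<mu> ^^ k) f x \<ge> 0"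
  by (induction k arbitrary: x) (auto simp: markov_eq mu_nonneg m_nonneg intro!: divide_nonneg_nonneg sum_nonneg)

section \<open>Heat kernels\<close>

lemma hk_nonneg: "hk k x y \<ge> 0"
  unfolding heat_kernel_def by (intro divide_nonneg_nonneg markov_power_nonneg m_nonneg) simp

lemma hk_eq_0: "k < gd x y \<Longrightarrow> hk k x y = 0"
proof -
  assume "k < gd x y"
  then have "(markov \<mu> ^^ k) (indicator {y}) x = (markov \<mu> ^^ k) (\<lambda>_. 0) x"
    by (intro markov_power_cong) (auto simp: cb_def indicator_def)
  then show ?thesis by (simp add: heat_kernel_def markov_power_const)
qed

lemma markov_power_eq:
  assumes S: "finite S" and 0: "\<And>y. y \<notin> S \<Longrightarrow> gd x y \<le> k \<Longrightarrow> f y = 0"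
  shows "(markov \<mu> ^^ k) f x = (\<Sum>y\<in>S. hk k x y * f y * m y)"
proof -
  have "(markov \<mu> ^^ k) f x = (markov \<mu> ^^ k) (\<lambda>z. \<Sum>y\<in>S. f y * indicator {y} z) x"
  proof (rule markov_power_cong)
    fix z assume "z \<in> cb x k"
    have "(\<Sum>y\<in>S. f y * indicator {y} z) = (\<Sum>y\<in>S. if z = y then f y else 0)"
      by (rule sum.cong) (auto simp: indicator_def)
    also have "\<dots> = f z" using S 0[of z] \<open>z \<in> cb x k\<close> by (auto simp: cb_def)
    finally show "f z = (\<Sum>y\<in>S. f y * indicator {y} z)" ..
  qed
  also have "\<dots> = (\<Sum>y\<in>S. f y * (markov \<mu> ^^ k) (indicator {y}) x)"
    by (simp add: markov_power_sum[OF S] markov_power_cmult)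
  also have "\<dots> = (\<Sum>y\<in>S. hk k x y * f y * m y)"
    by (rule sum.cong) (use m_pos in \<open>auto simp: heat_kernel_def less_imp_neq[symmetric]\<close>)
  finally show ?thesis .
qed

lemma sum_hk: assumes "finite S" "cb x k \<subseteq> S" shows "(\<Sum>y\<in>S. hk k x y * m y) = 1"
  using markov_power_eq[of S x k "\<lambda>_. 1"] assms by (auto simp: markov_power_const cb_def)

lemma sum_hk_le: assumes "finite S" shows "(\<Sum>y\<in>S. hk k x y * m y) \<le> 1"
proof -
  have "(\<Sum>y\<in>S. hk k x y * m y) \<le> (\<Sum>y\<in>S \<union> cb x k. hk k x y * m y)"
    by (rule sum_mono2) (use assms finite_cb hk_nonneg m_nonneg in auto)
  also have "\<dots> = 1" by (rule sum_hk) (use assms finite_cb in auto)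
  finally show ?thesis .
qed

text \<open>The vector of the function \<open>p_0(\<cdot>, w)\<close>: its inner product with a
  vector is the value of the corresponding function at \<open>w\<close>.\<close>

definition delta_vec :: "'a \<Rightarrow> 'a ell2" where
  "delta_vec w = (1 / sqrt (m w)) *\<^sub>R basis_vec w"

lemma inner_delta_vec: "delta_vec w \<bullet> u = of_ell2 u w"
  by (simp add: delta_vec_def inner_basis_vec of_ell2_def)

lemma of_ell2_delta_vec: "of_ell2 (delta_vec w) = (\<lambda>x. 1 / m w * indicator {w} x)"
  using m_pos[of w] by (auto simp: of_ell2_def delta_vec_def vec_of_basis_vec indicator_def)

lemma of_ell2_mark_power_delta: "of_ell2 ((mark ^^ k) (delta_vec w)) z = hk k z w"
  unfolding of_ell2_mark_power of_ell2_delta_vec markov_power_cmult heat_kernel_def by simp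

lemma mark_power_symmetric: "(mark ^^ k) u \<bullet> v = u \<bullet> (mark ^^ k) v"
  by (induction k arbitrary: u v) (simp_all add: mark_symmetric funpow_swap1)

lemma hk_add: "hk (j + k) z w = (mark ^^ j) (delta_vec z) \<bullet> (mark ^^ k) (delta_vec w)"
  by (simp add: mark_power_symmetric funpow_add inner_delta_vec flip: of_ell2_mark_power_delta)

lemma hk_sym: "hk k z w = hk k w z"
  using hk_add[of 0 k z w] hk_add[of k 0 w z] by (simp add: inner_commute)

text \<open>The difference is the inner product of \<open>P^j\<close> applied to the point mass at
  \<open>z\<close> with \<open>\<Delta> P^b P^j\<close> applied to that at \<open>w\<close>. The
  middle factor supplies \<open>1 / b\<close>, the outer ones have norm
  \<open>sqrt (hk (2 * j) x x)\<close>.\<close>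

lemma hk_diff_le:
  "\<bar>hk (2 * j + b) z w - hk (Suc (2 * j + b)) z w\<bar> \<le>
     (1 + 1 / eps) / (real b + 1) * sqrt (hk (2 * j) z z) * sqrt (hk (2 * j) w w)"
proof -
  let ?u = "(mark ^^ j) (delta_vec z)" and ?v = "(mark ^^ j) (delta_vec w)"
  have n: "norm ((mark ^^ j) (delta_vec x)) = sqrt (hk (2 * j) x x)" for x
    using hk_add[of j j x x] by (simp add: norm_eq_sqrt_inner mult_2)
  have "hk (2 * j + b) z w - hk (Suc (2 * j + b)) z w = ?u \<bullet> lap ((mark ^^ b) ?v)"
    using hk_add[of j "b + j" z w] hk_add[of j "Suc (b + j)" z w]
    by (simp add: lap_def inner_diff_right funpow_add mult_2 add_ac)
  also have "\<bar>\<dots>\<bar> \<le> norm ?u * norm (lap ((mark ^^ b) ?v))" by (rule Cauchy_Schwarz_ineq2)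
  also have "\<dots> \<le> norm ?u * ((1 + 1 / eps) / (real b + 1) * norm ?v)"
    by (intro mult_left_mono norm_lap_mark_power_le) auto
  finally show ?thesis by (simp add: n mult_ac)
qed

lemma hk_Suc: "markov \<mu> (\<lambda>x. hk k x w) x = hk (Suc k) x w"
  using markov_cmult[of "1 / m w" "(markov \<mu> ^^ k) (indicator {w})"] by (simp add: heat_kernel_def)

lemma finite_support_hk: "finite {z. hk k z w \<noteq> 0}"
  by (rule finite_subset[OF _ finite_cb[of w k]]) (use hk_eq_0 gd_sym in \<open>force simp: cb_def not_less[symmetric]\<close>)

lemma geodesic:
  obtains g where "g 0 = w" "g (gd w u) = u" "\<And>j. j < gd w u \<Longrightarrow> adj \<mu> (g j) (g (Suc j))"
    "\<And>j. j \<le> gd w u \<Longrightarrow> gd w (g j) = j"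
proof -
  obtain g where g: "g 0 = w" "g (gd w u) = u" "\<And>j. j < gd w u \<Longrightarrow> adj \<mu> (g j) (g (Suc j))"
    using gd_walk[of w u] unfolding relpowp_fun_conv by blast
  have step: "gd w (g (i + j)) \<le> gd w (g i) + j" if "i + j \<le> gd w u" for i j
    using that
  proof (induction j)
    case (Suc j)
    have "g (Suc (i + j)) \<in> nbh (g (i + j))" using Suc.prems g(3)[of "i + j"] by (simp add: nbh_def)
    then show ?case using gd_nbh[of "g (Suc (i + j))" "g (i + j)" w] Suc by simp
  qed simp
  have "gd w (g j) = j" if "j \<le> gd w u" for j
    using step[of 0 j] step[of j "gd w u - j"] that g by simp
  then show ?thesis using that g by blast
qed

end

section \<open>Rooted tree structure and the flux through an edge\<close>

locale tree_graph = lb_graph +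
  assumes tree: "tree_condition \<mu>"
begin

text \<open>Walk up along \<open>A\<close>, across the closing edge and back along \<open>B\<close>.
  Equal vertices have equal level, so a repetition can only be some \<open>A j = B j\<close> with
  \<open>j > 0\<close>, which \<open>ne\<close> excludes; the common start counts once, as the tree
  condition ranges over indices from 1.\<close>

lemma no_cycle:
  assumes "A 0 = B 0" "\<And>j. j < L \<Longrightarrow> adj \<mu> (A j) (A (Suc j))" "\<And>j. j < L' \<Longrightarrow> adj \<mu> (B j) (B (Suc j))"
    and "adj \<mu> (A L) (B L')" and lev: "\<And>j. j \<le> L \<Longrightarrow> gd w (A j) = i + j" "\<And>j. j \<le> L' \<Longrightarrow> gd w (B j) = i + j"
    and ne: "\<And>j. 0 < j \<Longrightarrow> j \<le> L \<Longrightarrow> j \<le> L' \<Longrightarrow> A j \<noteq> B j" and L: "L + L' \<ge> 2"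
  shows False
proof -
  define N where "N = L + L' + 1"
  define x where "x j = (if j \<le> L then A j else B (N - j))" for j
  have "N \<ge> 3" using L by (simp add: N_def)
  moreover have "x 0 = x N" using assms(1) by (simp add: x_def N_def)
  moreover have "\<forall>j\<in>{1..N}. adj \<mu> (x (j - 1)) (x j)"
  proof
    fix j assume j: "j \<in> {1..N}"
    consider "j \<le> L" | "j = Suc L" | "j > Suc L" by linarith
    then show "adj \<mu> (x (j - 1)) (x j)"
    proof cases
      case 1
      then show ?thesis using assms(2)[of "j - 1"] j by (auto simp: x_def)
    next
      case 2
      then show ?thesis using assms(4) by (simp add: x_def N_def)
    next
      case 3
      then have "adj \<mu> (B (N - j)) (B (Suc (N - j)))" using j by (intro assms(3)) (auto simp: N_def)
      moreover have "Suc (N - j) = N - (j - 1)" using j by auto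
      ultimately have "adj \<mu> (B (N - (j - 1))) (B (N - j))" by (metis adj_sym)
      moreover have "\<not> j - 1 \<le> L" "\<not> j \<le> L" using 3 by auto
      ultimately show ?thesis unfolding x_def by (simp only: if_False)
    qed
  qed
  ultimately obtain i' j' where ij: "1 \<le> i'" "i' < j'" "j' \<le> N" "x i' = x j'"
    using tree unfolding tree_condition_def by blast
  have levx: "gd w (x j) = i + (if j \<le> L then j else N - j)" if "j \<le> N" for j
    using that lev(1)[of j] lev(2)[of "N - j"] by (auto simp: x_def N_def)
  have eq: "(if i' \<le> L then i' else N - i') = (if j' \<le> L then j' else N - j')"
    using levx[of i'] levx[of j'] ij by simp
  then have "i' \<le> L" "\<not> j' \<le> L" "i' = N - j'" using ij by (auto split: if_splits)
  then have "A i' = B i'" using ij by (simp add: x_def)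
  moreover have "i' \<le> L'" using \<open>\<not> j' \<le> L\<close> \<open>i' = N - j'\<close> by (simp add: N_def)
  ultimately show False using ne[of i'] \<open>i' \<le> L\<close> ij(1) by simp
qed

text \<open>Follow geodesics from \<open>w\<close> to \<open>u\<close> and \<open>v\<close> beyond
  their last common level \<open>i\<close>. An edge between \<open>u\<close> and \<open>v\<close>,
  or a common neighbour \<open>z\<close> one level higher, would close them to a cycle; in the
  second case the geodesic to \<open>u\<close> is prolonged by \<open>z\<close>.\<close>

lemma same_level_separated:
  assumes uv: "u \<noteq> v" "gd w u = n" "gd w v = n"
  shows "\<not> adj \<mu> u v" and "gd w z = Suc n \<Longrightarrow> adj \<mu> z u \<Longrightarrow> \<not> adj \<mu> z v"
proof -
  obtain a where a: "a 0 = w" "a n = u" "\<And>j. j < n \<Longrightarrow> adj \<mu> (a j) (a (Suc j))" "\<And>j. j \<le> n \<Longrightarrow> gd w (a j) = j"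
    using geodesic[of w u] uv(2) by metis
  obtain b where b: "b 0 = w" "b n = v" "\<And>j. j < n \<Longrightarrow> adj \<mu> (b j) (b (Suc j))" "\<And>j. j \<le> n \<Longrightarrow> gd w (b j) = j"
    using geodesic[of w v] uv(3) by metis
  define i where "i = Max {j. j \<le> n \<and> a j = b j}"
  have fin: "finite {j. j \<le> n \<and> a j = b j}" by (rule finite_subset[of _ "{..n}"]) auto
  have "0 \<in> {j. j \<le> n \<and> a j = b j}" using a b by simp
  then have "i \<in> {j. j \<le> n \<and> a j = b j}" unfolding i_def using fin by (intro Max_in) auto
  then have i: "i \<le> n" "a i = b i" by auto
  have "i \<noteq> n" using i a b uv by auto
  then have in': "i < n" using i by simp
  have ne: "a j \<noteq> b j" if "i < j" "j \<le> n" for j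
  proof
    assume "a j = b j"
    then have "j \<le> i" unfolding i_def using fin that by (intro Max_ge) auto
    then show False using that by simp
  qed
  show "\<not> adj \<mu> u v"
  proof
    assume "adj \<mu> u v"
    then show False
    proof -
      have "2 \<le> n - i + (n - i)" using in' by simp
      then show ?thesis
        using no_cycle[of "\<lambda>j. a (i + j)" "\<lambda>j. b (i + j)" "n - i" "n - i" w i] a b i in' ne \<open>adj \<mu> u v\<close>
        by auto
    qed
  qed
  assume z: "gd w z = Suc n" "adj \<mu> z u"
  show "\<not> adj \<mu> z v"
  proof
    assume zv: "adj \<mu> z v"
    define a' where "a' j = (if j = Suc n then z else a j)" for j
    show False
    proof (rule no_cycle[of "\<lambda>j. a' (i + j)" "\<lambda>j. b (i + j)" "Suc n - i" "n - i" w i])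
      show "adj \<mu> (a' (i + j)) (a' (i + Suc j))" if "j < Suc n - i" for j
      proof (cases "i + j = n")
        case True
        then show ?thesis using z a(2) by (simp add: a'_def adj_sym)
      next
        case False
        then show ?thesis using that a(3)[of "i + j"] in' by (auto simp: a'_def)
      qed
      show "gd w (a' (i + j)) = i + j" if "j \<le> Suc n - i" for j
        using that z(1) a(4)[of "i + j"] in' by (auto simp: a'_def)
      show "a' (i + j) \<noteq> b (i + j)" if "0 < j" "j \<le> Suc n - i" "j \<le> n - i" for j
        using ne[of "i + j"] that in' by (auto simp: a'_def)
    qed (use i in' b zv in \<open>auto simp: a'_def\<close>)
  qed
qed

text \<open>The choice is unique in a tree. The root is its own parent, so parents can be iterated
  without a side condition.\<close>

definition par :: "'a \<Rightarrow> 'a \<Rightarrow> 'a" where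
  "par w z = (if z = w then w else SOME u. u \<in> nbh z \<and> gd w z = Suc (gd w u))"

lemma par_root [simp]: "par w w = w" by (simp add: par_def)

lemma par: assumes "z \<noteq> w" shows "par w z \<in> nbh z" "gd w z = Suc (gd w (par w z))"
proof -
  obtain n where "gd w z = Suc n" using assms by (metis gd_eq_0_iff not0_implies_Suc)
  then have "\<exists>u. u \<in> nbh z \<and> gd w z = Suc (gd w u)" by (metis gd_pred)
  then have "par w z \<in> nbh z \<and> gd w z = Suc (gd w (par w z))"
    using assms someI_ex[of "\<lambda>u. u \<in> nbh z \<and> gd w z = Suc (gd w u)"] unfolding par_def by simp
  then show "par w z \<in> nbh z" "gd w z = Suc (gd w (par w z))" by auto
qed

text \<open>Distinct neighbours never share a level, and a neighbour one level closer to
  \<open>w\<close> is unique, hence the parent.\<close>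

lemma nbh_cases:
  assumes "z' \<in> nbh z" "z' \<noteq> z"
  shows "z \<noteq> w \<and> z' = par w z \<or> z' \<noteq> w \<and> z = par w z'"
proof -
  have up: "y' = par w y" if "y' \<in> nbh y" "gd w y = Suc (gd w y')" for y y'
  proof (rule ccontr)
    assume "y' \<noteq> par w y"
    have "y \<noteq> w" using that by (metis gd_eq_0_iff nat.distinct(1))
    from same_level_separated(2)[OF \<open>y' \<noteq> par w y\<close>, of w "gd w y'" y]
    show False using that par[OF \<open>y \<noteq> w\<close>] by (auto simp: nbh_def)
  qed
  have "gd w z \<noteq> gd w z'"
    using same_level_separated(1)[of z z' w "gd w z"] assms by (auto simp: nbh_def)
  moreover have "gd w z' \<le> gd w z + 1" "gd w z \<le> gd w z' + 1"
    using assms gd_nbh nbh_sym by metis+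
  ultimately consider "gd w z = Suc (gd w z')" | "gd w z' = Suc (gd w z)" by linarith
  then show ?thesis
  proof cases
    case 1
    then show ?thesis using up[OF assms(1)] by (metis gd_eq_0_iff nat.distinct(1))
  next
    case 2
    then show ?thesis using up[of z z'] assms by (metis gd_eq_0_iff nat.distinct(1) nbh_sym)
  qed
qed

text \<open>For \<open>y \<noteq> w\<close> this is the side of the edge between \<open>y\<close>
  and its parent that is away from \<open>w\<close>; \<open>j = 0\<close> includes \<open>y\<close>
  itself.\<close>

definition desc :: "'a \<Rightarrow> 'a \<Rightarrow> 'a set" where
  "desc w y = {z. \<exists>j. (par w ^^ j) z = y}"

lemma desc_boundary:
  assumes "z \<in> desc w y" "z' \<notin> desc w y" "z' \<in> nbh z"
  shows "z = y \<and> z' = par w y"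
proof -
  have "z' \<noteq> z" using assms by auto
  from nbh_cases[OF assms(3) this, of w] show ?thesis
  proof
    assume c: "z \<noteq> w \<and> z' = par w z"
    obtain j where j: "(par w ^^ j) z = y" using assms(1) by (auto simp: desc_def)
    show ?thesis
    proof (cases j)
      case (Suc i)
      then have "(par w ^^ i) z' = y" using j c by (simp add: funpow_swap1)
      then show ?thesis using assms(2) by (auto simp: desc_def)
    qed (use j c in simp)
  next
    assume c: "z' \<noteq> w \<and> z = par w z'"
    obtain j where "(par w ^^ j) z = y" using assms(1) by (auto simp: desc_def)
    then have "(par w ^^ Suc j) z' = y" using c by (simp add: funpow_swap1)
    then show ?thesis using assms(2) unfolding desc_def by blast
  qed
qed

lemma gd_par_power: "gd w ((par w ^^ j) z) = gd w z - j"
proof (induction j)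
  case (Suc j)
  then show ?case
    by (cases "(par w ^^ j) z = w") (use par(2)[of "(par w ^^ j) z" w] in auto)
qed simp

text \<open>Every ancestor other than the root is \<open>(par w ^^ j) z\<close> with
  \<open>j < gd w z\<close>, since each step towards the root lowers the level by one.\<close>

lemma card_ancestors_le:
  "finite F \<Longrightarrow> card {y \<in> F. y \<noteq> w \<and> z \<in> desc w y} \<le> gd w z"
proof -
  assume "finite F"
  have "{y \<in> F. y \<noteq> w \<and> z \<in> desc w y} \<subseteq> (\<lambda>j. (par w ^^ j) z) ` {..<gd w z}"
  proof
    fix y assume "y \<in> {y \<in> F. y \<noteq> w \<and> z \<in> desc w y}"
    then obtain j where j: "(par w ^^ j) z = y" "y \<noteq> w" by (auto simp: desc_def)
    then have "gd w z - j \<noteq> 0" using gd_par_power[of w j z] by (metis gd_eq_0_iff)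
    then show "y \<in> (\<lambda>j. (par w ^^ j) z) ` {..<gd w z}" using j by auto
  qed
  from card_mono[OF _ this] card_image_le[of "{..<gd w z}" "\<lambda>j. (par w ^^ j) z"]
  show ?thesis by auto
qed

text \<open>The edge from \<open>y\<close> to its parent is the only one leaving \<open>desc w y\<close>, so it carries all
  of the Laplacian of \<open>\<phi>\<close> on \<open>desc w y\<close>.\<close>

lemma flux:
  assumes fin: "finite S" and S: "{z. \<phi> z \<noteq> 0} \<subseteq> S" "\<And>z. \<phi> z \<noteq> 0 \<Longrightarrow> nbh z \<subseteq> S" "y \<in> S" "par w y \<in> S"
    and y: "y \<noteq> w"
  shows "\<mu> y (par w y) * (\<phi> y - \<phi> (par w y)) = (\<Sum>z\<in>desc w y \<inter> S. (\<phi> z - markov \<mu> \<phi> z) * m z)"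
proof -
  let ?U = "desc w y \<inter> S" and ?V = "S - desc w y"
  \<comment> \<open>Replacing \<open>nbh z\<close> by \<open>S\<close> changes nothing: terms added
    have weight 0, and for terms left out both values of \<open>\<phi>\<close> vanish by the
    hypotheses on \<open>S\<close>.\<close>
  have loc: "(\<phi> z - markov \<mu> \<phi> z) * m z = (\<Sum>z'\<in>S. \<mu> z z' * (\<phi> z - \<phi> z'))" for z
  proof -
    have "(\<phi> z - markov \<mu> \<phi> z) * m z = \<phi> z * m z - (\<Sum>z'\<in>nbh z. \<mu> z z' * \<phi> z')"
      using m_pos[of z] by (simp add: markov_eq left_diff_distrib)
    also have "\<dots> = (\<Sum>z'\<in>nbh z. \<mu> z z' * (\<phi> z - \<phi> z'))"
      by (simp add: m_eq_sum sum_distrib_left right_diff_distrib sum_subtractf mult.commute)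
    also have "\<dots> = (\<Sum>z'\<in>nbh z \<union> S. \<mu> z z' * (\<phi> z - \<phi> z'))"
      by (rule sum.mono_neutral_left) (use fin finite_nbh mu_eq_0 in auto)
    also have "\<dots> = (\<Sum>z'\<in>S. \<mu> z z' * (\<phi> z - \<phi> z'))"
    proof (rule sum.mono_neutral_right)
      show "\<forall>z'\<in>nbh z \<union> S - S. \<mu> z z' * (\<phi> z - \<phi> z') = 0"
        using S(1) S(2)[of z] by fastforce
    qed (use fin finite_nbh in auto)
    finally show ?thesis .
  qed
  have yU: "y \<in> ?U"
  proof -
    have "(par w ^^ 0) y = y" by simp
    then show ?thesis using S(3) unfolding desc_def by blast
  qed
  have pV: "par w y \<in> ?V"
  proof -
    have "par w y \<notin> desc w y"
    proof
      assume "par w y \<in> desc w y"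
      then obtain j where "(par w ^^ j) (par w y) = y" by (auto simp: desc_def)
      then have "gd w y = gd w (par w y) - j" using gd_par_power by metis
      then show False using par(2)[OF y] by simp
    qed
    then show ?thesis using S(4) by simp
  qed
  have "(\<Sum>z\<in>?U. (\<phi> z - markov \<mu> \<phi> z) * m z) = (\<Sum>z\<in>?U. \<Sum>z'\<in>S. \<mu> z z' * (\<phi> z - \<phi> z'))"
    by (simp add: loc)
  also have "\<dots> = (\<Sum>z\<in>?U. (\<Sum>z'\<in>?U. \<mu> z z' * (\<phi> z - \<phi> z')) + (\<Sum>z'\<in>?V. \<mu> z z' * (\<phi> z - \<phi> z')))"
  proof (rule sum.cong)
    fix z
    have "S = ?U \<union> ?V" by auto
    then show "(\<Sum>z'\<in>S. \<mu> z z' * (\<phi> z - \<phi> z')) =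
        (\<Sum>z'\<in>?U. \<mu> z z' * (\<phi> z - \<phi> z')) + (\<Sum>z'\<in>?V. \<mu> z z' * (\<phi> z - \<phi> z'))"
      using sum.union_disjoint[of ?U ?V "\<lambda>z'. \<mu> z z' * (\<phi> z - \<phi> z')"] fin by auto
  qed simp
  also have "\<dots> = (\<Sum>z\<in>?U. \<Sum>z'\<in>?U. \<mu> z z' * (\<phi> z - \<phi> z')) + (\<Sum>z\<in>?U. \<Sum>z'\<in>?V. \<mu> z z' * (\<phi> z - \<phi> z'))"
    by (rule sum.distrib)
  \<comment> \<open>Each inner edge occurs in both directions with opposite signs.\<close>
  also have "(\<Sum>z\<in>?U. \<Sum>z'\<in>?U. \<mu> z z' * (\<phi> z - \<phi> z')) = 0"
  proof -
    have "(\<Sum>z\<in>?U. \<Sum>z'\<in>?U. \<mu> z z' * (\<phi> z - \<phi> z')) = (\<Sum>z\<in>?U. \<Sum>z'\<in>?U. \<mu> z' z * (\<phi> z' - \<phi> z))"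
      by (rule sum.swap)
    also have "\<dots> = (\<Sum>z\<in>?U. \<Sum>z'\<in>?U. - (\<mu> z z' * (\<phi> z - \<phi> z')))"
      by (intro sum.cong) (auto simp: mu_sym algebra_simps)
    also have "\<dots> = - (\<Sum>z\<in>?U. \<Sum>z'\<in>?U. \<mu> z z' * (\<phi> z - \<phi> z'))" by (simp add: sum_negf)
    finally show ?thesis by simp
  qed
  also have "(\<Sum>z\<in>?U. \<Sum>z'\<in>?V. \<mu> z z' * (\<phi> z - \<phi> z')) =
      (\<Sum>z\<in>?U. if z = y then \<mu> y (par w y) * (\<phi> y - \<phi> (par w y)) else 0)"
  proof (rule sum.cong)
    fix z assume z: "z \<in> ?U"
    have "(\<Sum>z'\<in>?V. \<mu> z z' * (\<phi> z - \<phi> z')) = (\<Sum>z'\<in>?V. if z' = par w y then if z = y then \<mu> y (par w y) * (\<phi> y - \<phi> (par w y)) else 0 else 0)"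
    proof (rule sum.cong)
      fix z' assume z': "z' \<in> ?V"
      show "\<mu> z z' * (\<phi> z - \<phi> z') = (if z' = par w y then if z = y then \<mu> y (par w y) * (\<phi> y - \<phi> (par w y)) else 0 else 0)"
      proof (cases "z' \<in> nbh z")
        case True
        then show ?thesis using desc_boundary[of z w y z'] z z' by auto
      next
        case False
        then show ?thesis using mu_eq_0[OF False] by auto
      qed
    qed simp
    also have "\<dots> = (if z = y then \<mu> y (par w y) * (\<phi> y - \<phi> (par w y)) else 0)"
      using fin pV by (simp add: sum.delta)
    finally show "(\<Sum>z'\<in>?V. \<mu> z z' * (\<phi> z - \<phi> z')) = (if z = y then \<mu> y (par w y) * (\<phi> y - \<phi> (par w y)) else 0)" .
  qed simp
  also have "\<dots> = \<mu> y (par w y) * (\<phi> y - \<phi> (par w y))"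
    using fin yU by (simp add: sum.delta)
  finally show ?thesis by simp
qed

end

section \<open>Kernel estimates on Vicsek graphs\<close>

lemma exp_neg_powr_le:
  fixes c \<kappa> M :: real
  assumes c: "c > 0" and \<kappa>: "\<kappa> > 0"
  obtains C where "C > 0" "\<And>x :: real. x \<ge> 1 \<Longrightarrow> exp (- c * x powr \<kappa>) \<le> C * x powr (- M)"
proof -
  obtain j :: nat where j: "M / \<kappa> < real j" using reals_Archimedean2 by blast
  define i where "i = Suc j"
  have i: "real i > 0" "M \<le> \<kappa> * real i" using j \<kappa> by (auto simp: i_def field_simps)
  have "exp (- c * x powr \<kappa>) \<le> (real i / c) ^ i * x powr (- M)" if x: "x \<ge> 1" for x :: real
  proof -
    define u where "u = c * x powr \<kappa>"
    have u: "u > 0" using x c by (simp add: u_def)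
    have "u / real i \<le> exp (u / real i)" using exp_ge_add_one_self[of "u / real i"] by linarith
    then have "(u / real i) ^ i \<le> (exp (u / real i)) ^ i"
      using u i by (intro power_mono) auto
    also have "\<dots> = exp u" using i by (simp flip: exp_of_nat_mult)
    finally have "(u / real i) ^ i \<le> exp u" .
    then have "inverse (exp u) \<le> inverse ((u / real i) ^ i)"
      using u i by (intro le_imp_inverse_le) auto
    also have "\<dots> = (real i / c) ^ i * x powr (- (\<kappa> * real i))"
      using x c by (simp add: u_def power_divide power_mult_distrib powr_power powr_minus field_simps)
    also have "\<dots> \<le> (real i / c) ^ i * x powr (- M)"
      using x c i by (intro mult_left_mono powr_mono) auto
    finally show ?thesis by (simp add: u_def exp_minus)
  qed
  then show ?thesis using that[of "(real i / c) ^ i"] c i by simp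
qed

context tree_graph
begin

text \<open>Rooted at \<open>x\<close>, a neighbour \<open>y \<noteq> x\<close> is a child of the
  root, so \<open>\<mu> x y * (\<phi> y - \<phi> x)\<close> is the total Laplacian on the branch of
  \<open>y\<close>.\<close>

lemma edge_diff_le:
  assumes fin: "finite {z. \<phi> z \<noteq> 0}" and y: "y \<in> nbh x"
  shows "\<exists>S. finite S \<and> \<mu> x y * \<bar>\<phi> x - \<phi> y\<bar> \<le> (\<Sum>z\<in>S. \<bar>\<phi> z - markov \<mu> \<phi> z\<bar> * m z)"
proof (cases "x = y")
  case False
  define S where "S = {z. \<phi> z \<noteq> 0} \<union> (\<Union>z\<in>{z. \<phi> z \<noteq> 0}. nbh z) \<union> {x, y}"
  have S: "finite S" using fin finite_nbh by (simp add: S_def)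
  have par: "par x y = x" using nbh_cases[OF y, of x] False by auto
  have "\<mu> x y * \<bar>\<phi> x - \<phi> y\<bar> = \<bar>\<mu> y (par x y) * (\<phi> y - \<phi> (par x y))\<bar>"
    using mu_nonneg[of x y] by (simp add: par abs_mult mu_sym abs_minus_commute)
  also have "\<dots> = \<bar>\<Sum>z\<in>desc x y \<inter> S. (\<phi> z - markov \<mu> \<phi> z) * m z\<bar>"
    by (subst flux[OF S]) (use False par in \<open>auto simp: S_def\<close>)
  also have "\<dots> \<le> (\<Sum>z\<in>desc x y \<inter> S. \<bar>\<phi> z - markov \<mu> \<phi> z\<bar> * m z)"
    by (rule order_trans[OF sum_abs]) (simp add: abs_mult m_nonneg)
  finally show ?thesis using S by (intro exI[of _ "desc x y \<inter> S"]) auto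
qed (auto intro: exI[of _ "{}"])

text \<open>In the sum of the fluxes over all edges the vertex \<open>z\<close> is counted once for each edge on the
  path from \<open>w\<close> to \<open>z\<close>, that is \<open>gd w z\<close> times.\<close>

lemma total_diff_le:
  assumes fin: "finite {z. \<phi> z \<noteq> 0}" and F: "finite F"
  shows "\<exists>S. finite S \<and> (\<Sum>x\<in>F. (\<Sum>y\<in>nbh x. \<bar>\<phi> x - \<phi> y\<bar>) * m x) \<le>
     2 / eps * (\<Sum>z\<in>S. \<bar>\<phi> z - markov \<mu> \<phi> z\<bar> * real (gd w z) * m z)"
proof -
  define F' where "F' = F \<union> (\<Union>x\<in>F. nbh x)"
  define S where "S = {z. \<phi> z \<noteq> 0} \<union> (\<Union>z\<in>{z. \<phi> z \<noteq> 0}. nbh z) \<union> F' \<union> par w ` F'"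
  define G where "G c = \<mu> c (par w c) * \<bar>\<phi> c - \<phi> (par w c)\<bar>" for c
  define H where "H z = \<bar>\<phi> z - markov \<mu> \<phi> z\<bar> * m z" for z
  have F': "finite F'" using F finite_nbh by (simp add: F'_def)
  have S: "finite S" using fin finite_nbh F' by (simp add: S_def)
  have G0: "G c \<ge> 0" for c by (simp add: G_def mu_nonneg)
  have H0: "H c \<ge> 0" for c by (simp add: H_def m_nonneg)
  have Gle: "G c \<le> (\<Sum>z\<in>desc w c \<inter> S. H z)" if "c \<in> F'" "c \<noteq> w" for c
  proof -
    have "G c = \<bar>\<mu> c (par w c) * (\<phi> c - \<phi> (par w c))\<bar>" by (simp add: G_def abs_mult mu_nonneg)
    also have "\<dots> = \<bar>\<Sum>z\<in>desc w c \<inter> S. (\<phi> z - markov \<mu> \<phi> z) * m z\<bar>"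
      by (subst flux[OF S]) (use that in \<open>auto simp: S_def\<close>)
    also have "\<dots> \<le> (\<Sum>z\<in>desc w c \<inter> S. H z)"
      by (rule order_trans[OF sum_abs]) (simp add: H_def abs_mult m_nonneg)
    finally show ?thesis .
  qed
  have sumG: "(\<Sum>c\<in>F' - {w}. G c) \<le> (\<Sum>z\<in>S. H z * real (gd w z))"
  proof -
    have "(\<Sum>c\<in>F' - {w}. G c) \<le> (\<Sum>c\<in>F' - {w}. \<Sum>z\<in>desc w c \<inter> S. H z)"
      by (intro sum_mono Gle) auto
    also have "\<dots> = (\<Sum>c\<in>F' - {w}. \<Sum>z\<in>S. if z \<in> desc w c then H z else 0)"
      using S by (simp add: sum.inter_restrict Int_commute)
    also have "\<dots> = (\<Sum>z\<in>S. \<Sum>c\<in>F' - {w}. if z \<in> desc w c then H z else 0)"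
      by (rule sum.swap)
    also have "\<dots> = (\<Sum>z\<in>S. H z * real (card {c \<in> F'. c \<noteq> w \<and> z \<in> desc w c}))"
    proof (rule sum.cong)
      fix z
      have "(\<Sum>c\<in>F' - {w}. if z \<in> desc w c then H z else 0) = (\<Sum>c\<in>{c \<in> F' - {w}. z \<in> desc w c}. H z)"
        by (rule sum.inter_filter[symmetric]) (use F' in simp)
      also have "{c \<in> F' - {w}. z \<in> desc w c} = {c \<in> F'. c \<noteq> w \<and> z \<in> desc w c}" by auto
      finally show "(\<Sum>c\<in>F' - {w}. if z \<in> desc w c then H z else 0) = H z * real (card {c \<in> F'. c \<noteq> w \<and> z \<in> desc w c})"
        by (simp add: mult.commute)
    qed simp
    also have "\<dots> \<le> (\<Sum>z\<in>S. H z * real (gd w z))"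
      by (intro sum_mono mult_left_mono H0) (use card_ancestors_le[OF F'] in simp)
    finally show ?thesis .
  qed
  \<comment> \<open>Every edge is seen from both of its ends, once as child and once as parent,
    which is the origin of the factor 2; \<open>1 / eps\<close> trades \<open>m x\<close> for the
    edge weight.\<close>
  have step: "(\<Sum>y\<in>nbh x. \<bar>\<phi> x - \<phi> y\<bar>) * m x \<le>
      1 / eps * (\<Sum>y\<in>F'. (if y \<noteq> w \<and> par w y = x then G y else 0) + (if x \<noteq> w \<and> par w x = y then G x else 0))"
    if x: "x \<in> F" for x
  proof -
    let ?r = "\<lambda>y. (if y \<noteq> w \<and> par w y = x then G y else 0) + (if x \<noteq> w \<and> par w x = y then G x else 0)"
    have "\<bar>\<phi> x - \<phi> y\<bar> * m x \<le> 1 / eps * ?r y" if y: "y \<in> nbh x" for y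
    proof (cases "y = x")
      case False
      have "eps * (\<bar>\<phi> x - \<phi> y\<bar> * m x) \<le> \<mu> x y * \<bar>\<phi> x - \<phi> y\<bar>"
        using mult_right_mono[OF eps(3)[OF y], of "\<bar>\<phi> x - \<phi> y\<bar>"] by (simp add: mult_ac)
      also have "\<dots> \<le> ?r y"
        using nbh_cases[OF y False, of w]
      proof
        assume "x \<noteq> w \<and> y = par w x"
        then show ?thesis using G0[of y] by (auto simp: G_def)
      next
        assume "y \<noteq> w \<and> x = par w y"
        then show ?thesis using G0[of x] by (auto simp: G_def mu_sym abs_minus_commute)
      qed
      finally show ?thesis using eps(1) by (simp add: field_simps)
    qed (use eps G0 in auto)
    then have "(\<Sum>y\<in>nbh x. \<bar>\<phi> x - \<phi> y\<bar>) * m x \<le> (\<Sum>y\<in>nbh x. 1 / eps * ?r y)"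
      unfolding sum_distrib_right by (intro sum_mono)
    also have "\<dots> \<le> (\<Sum>y\<in>F'. 1 / eps * ?r y)"
      by (rule sum_mono2) (use F' x eps G0 in \<open>auto simp: F'_def\<close>)
    finally show ?thesis by (simp only: sum_distrib_left)
  qed
  have "(\<Sum>x\<in>F. (\<Sum>y\<in>nbh x. \<bar>\<phi> x - \<phi> y\<bar>) * m x) \<le>
      1 / eps * ((\<Sum>x\<in>F. \<Sum>y\<in>F'. if y \<noteq> w \<and> par w y = x then G y else 0) +
        (\<Sum>x\<in>F. \<Sum>y\<in>F'. if x \<noteq> w \<and> par w x = y then G x else 0))"
    using sum_mono[OF step] by (simp only: sum_distrib_left[symmetric] sum.distrib)
  also have "(\<Sum>x\<in>F. \<Sum>y\<in>F'. if y \<noteq> w \<and> par w y = x then G y else 0) \<le> (\<Sum>c\<in>F' - {w}. G c)"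
  proof -
    have "(\<Sum>x\<in>F. \<Sum>y\<in>F'. if y \<noteq> w \<and> par w y = x then G y else 0)
        = (\<Sum>y\<in>F'. \<Sum>x\<in>F. if x = par w y then (if y \<noteq> w then G y else 0) else 0)"
      by (subst sum.swap) (auto intro!: sum.cong)
    also have "\<dots> \<le> (\<Sum>y\<in>F'. if y \<noteq> w then G y else 0)"
      by (intro sum_mono) (use F G0 in simp)
    also have "\<dots> = (\<Sum>c\<in>F' - {w}. G c)"
      by (rule sum.mono_neutral_cong_right) (use F' in auto)
    finally show ?thesis .
  qed
  also have "(\<Sum>x\<in>F. \<Sum>y\<in>F'. if x \<noteq> w \<and> par w x = y then G x else 0) \<le> (\<Sum>c\<in>F' - {w}. G c)"
  proof -
    have "(\<Sum>x\<in>F. \<Sum>y\<in>F'. if x \<noteq> w \<and> par w x = y then G x else 0)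
        = (\<Sum>x\<in>F. \<Sum>y\<in>F'. if y = par w x then (if x \<noteq> w then G x else 0) else 0)"
      by (auto intro!: sum.cong)
    also have "\<dots> \<le> (\<Sum>x\<in>F. if x \<noteq> w then G x else 0)"
      by (intro sum_mono) (use F' G0 in simp)
    also have "\<dots> = (\<Sum>c\<in>F - {w}. G c)"
      by (rule sum.mono_neutral_cong_right) (use F in auto)
    also have "\<dots> \<le> (\<Sum>c\<in>F' - {w}. G c)"
      by (rule sum_mono2) (use F' G0 in \<open>auto simp: F'_def\<close>)
    finally show ?thesis .
  qed
  finally have "(\<Sum>x\<in>F. (\<Sum>y\<in>nbh x. \<bar>\<phi> x - \<phi> y\<bar>) * m x) \<le> 1 / eps * (2 * (\<Sum>c\<in>F' - {w}. G c))"
    using eps by (simp add: divide_right_mono)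
  also have "\<dots> \<le> 1 / eps * (2 * (\<Sum>z\<in>S. H z * real (gd w z)))"
    using eps sumG by (intro mult_left_mono) auto
  finally show ?thesis
    using S by (intro exI[of _ S]) (simp add: H_def mult_ac)
qed

end

section \<open>Consequences of (AR) and (UE)\<close>

locale vicsek =
  fixes \<mu> :: "'a \<Rightarrow> 'a \<Rightarrow> real" and D :: real
  assumes D: "D \<ge> 1" and vicsek: "vicsek_graph D \<mu>"

sublocale vicsek \<subseteq> tree_graph \<mu>
  by unfold_locales (use vicsek in \<open>auto simp: vicsek_graph_def\<close>)

context vicsek
begin

abbreviation "\<beta> \<equiv> D + 1"

text \<open>The open ball of radius 1 is a single vertex.\<close>

lemma m_lower_bound: obtains c where "0 < c" "\<And>x. c \<le> m x"
proof -
  obtain C where C: "C > 0" "\<And>x r. r > 0 \<Longrightarrow> inverse C * (1 + r) powr D \<le> vol \<mu> x r"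
    using vicsek by (auto simp: vicsek_graph_def ahlfors_regular_def)
  have "vol \<mu> x 1 = m x" for x
  proof -
    have "gball \<mu> x 1 = {x}" by (auto simp: gball_def)
    then show ?thesis by (simp add: vol_def)
  qed
  then show ?thesis using that[of "inverse C * 2 powr D"] C(1) C(2)[of 1] by simp
qed

lemma ball_mass_le:
  obtains C where "C > 0"
    "\<And>A x r. finite A \<Longrightarrow> (\<And>y. y \<in> A \<Longrightarrow> real (gd x y) \<le> r) \<Longrightarrow> r \<ge> 1 \<Longrightarrow> sum m A \<le> C * r powr D"
proof -
  obtain C where C: "C > 0" "\<And>x r. r > 0 \<Longrightarrow> vol \<mu> x r \<le> C * (1 + r) powr D"
    using vicsek by (auto simp: vicsek_graph_def ahlfors_regular_def)
  have "sum m A \<le> C * 3 powr D * r powr D"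
    if A: "finite A" "\<And>y. y \<in> A \<Longrightarrow> real (gd x y) \<le> r" "r \<ge> 1" for A x r
  proof -
    have sub: "gball \<mu> x (2 * r) \<subseteq> cb x (nat \<lceil>2 * r\<rceil>)"
      by (auto simp: gball_def cb_def) linarith
    have "sum m A \<le> sum m (gball \<mu> x (2 * r))"
    proof (rule sum_m_mono)
      show "finite (gball \<mu> x (2 * r))" using sub finite_cb finite_subset by blast
      show "A \<subseteq> gball \<mu> x (2 * r)" using A by (force simp: gball_def)
    qed
    also have "\<dots> = vol \<mu> x (2 * r)" using vol_eq[OF sub] by simp
    also have "\<dots> \<le> C * (1 + 2 * r) powr D" using A by (intro C) auto
    also have "\<dots> \<le> C * (3 * r) powr D" using A C D by (intro mult_left_mono powr_mono2) auto
    also have "\<dots> = C * 3 powr D * r powr D" using A by (simp add: powr_mult)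
    finally show ?thesis .
  qed
  with C(1) show ?thesis by (intro that[of "C * 3 powr D"]) auto
qed

lemma hk_upper:
  obtains C c where "C > 0" "c > 0"
    "\<And>k x y. hk k x y \<le> C * (real k + 1) powr (- D / \<beta>) *
       exp (- c * (real (gd x y) powr \<beta> / (real k + 1)) powr (1 / D))"
proof -
  obtain C0 where C0: "C0 > 0" "\<And>x r. r > 0 \<Longrightarrow> inverse C0 * (1 + r) powr D \<le> vol \<mu> x r"
    using vicsek by (auto simp: vicsek_graph_def ahlfors_regular_def)
  obtain C c where C: "C > 0" "c > 0"
    "\<And>x y k. k \<ge> 1 \<Longrightarrow> hk (k - 1) x y \<le> C / vol \<mu> x (real k powr (1 / \<beta>)) *
          exp (- c * (real (gd x y) powr \<beta> / real k) powr (1 / (\<beta> - 1)))"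
    using vicsek by (auto simp: vicsek_graph_def UE_condition_def)
  have "hk k x y \<le> C * C0 * (real k + 1) powr (- D / \<beta>) *
       exp (- c * (real (gd x y) powr \<beta> / (real k + 1)) powr (1 / D))" for k x y
  proof -
    let ?E = "exp (- c * (real (gd x y) powr \<beta> / (real k + 1)) powr (1 / D))"
    have "hk k x y \<le> C / vol \<mu> x ((real k + 1) powr (1 / \<beta>)) * ?E"
      using C(3)[of "Suc k" x y] by (simp add: add.commute)
    also have "\<dots> \<le> C * C0 * (real k + 1) powr (- D / \<beta>) * ?E"
    proof (rule mult_right_mono)
      have "inverse C0 * (real k + 1) powr (D / \<beta>) = inverse C0 * ((real k + 1) powr (1 / \<beta>)) powr D"
        by (simp add: powr_powr)
      also have "\<dots> \<le> inverse C0 * (1 + (real k + 1) powr (1 / \<beta>)) powr D"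
        using C0(1) D by (intro mult_left_mono powr_mono2) auto
      also have "\<dots> \<le> vol \<mu> x ((real k + 1) powr (1 / \<beta>))" by (rule C0) simp
      finally have "C / vol \<mu> x ((real k + 1) powr (1 / \<beta>)) \<le> C / (inverse C0 * (real k + 1) powr (D / \<beta>))"
        using C C0 by (intro divide_left_mono) (auto intro!: mult_pos_pos elim: less_le_trans[rotated])
      then show "C / vol \<mu> x ((real k + 1) powr (1 / \<beta>)) \<le> C * C0 * (real k + 1) powr (- D / \<beta>)"
        by (simp add: powr_minus divide_simps)
    qed simp
    finally show ?thesis .
  qed
  then show ?thesis using that[of "C * C0" c] C C0 by simp
qed

lemma hk_le:
  obtains C where "C > 0" "\<And>k x y. hk k x y \<le> C * (real k + 1) powr (- D / \<beta>)"
proof -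
  obtain C c where C: "C > 0" "c > 0" and le: "\<And>k x y. hk k x y \<le> C * (real k + 1) powr (- D / \<beta>) *
       exp (- c * (real (gd x y) powr \<beta> / (real k + 1)) powr (1 / D))" using hk_upper by blast
  have "hk k x y \<le> C * (real k + 1) powr (- D / \<beta>)" for k x y
    by (rule order_trans[OF le]) (use C in \<open>auto intro!: mult_left_le\<close>)
  then show ?thesis using that C by blast
qed

text \<open>Beyond this radius the argument of the exponential is at least
  \<open>c * n powr (\<beta> * \<epsilon> / D)\<close> with \<open>n = k + 1\<close>, which beats
  every power \<open>M\<close>.\<close>

lemma hk_tail:
  assumes \<epsilon>: "\<epsilon> > 0"
  obtains C where "C > 0"
    "\<And>k x y. real (gd x y) \<ge> (real k + 1) powr (1 / \<beta> + \<epsilon>) \<Longrightarrow> hk k x y \<le> C * (real k + 1) powr (- M)"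
proof -
  obtain C c where C: "C > 0" "c > 0" and le: "\<And>k x y. hk k x y \<le> C * (real k + 1) powr (- D / \<beta>) *
       exp (- c * (real (gd x y) powr \<beta> / (real k + 1)) powr (1 / D))" using hk_upper by blast
  define \<kappa> where "\<kappa> = \<beta> * \<epsilon> / D"
  have \<kappa>: "\<kappa> > 0" using \<epsilon> D by (simp add: \<kappa>_def)
  obtain C' where C': "C' > 0" "\<And>x. x \<ge> 1 \<Longrightarrow> exp (- c * x powr \<kappa>) \<le> C' * x powr (- M)"
    using exp_neg_powr_le[OF C(2) \<kappa>] by blast
  have "hk k x y \<le> C * C' * (real k + 1) powr (- M)"
    if far: "real (gd x y) \<ge> (real k + 1) powr (1 / \<beta> + \<epsilon>)" for k x y
  proof -
    define n where "n = real k + 1"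
    have n: "n \<ge> 1" by (simp add: n_def)
    have "(1 / \<beta> + \<epsilon>) * \<beta> = 1 + \<beta> * \<epsilon>" using D by (simp add: field_simps)
    then have "n powr (1 + \<beta> * \<epsilon>) = (n powr (1 / \<beta> + \<epsilon>)) powr \<beta>"
      by (simp only: powr_powr)
    also have "\<dots> \<le> real (gd x y) powr \<beta>" using far D by (intro powr_mono2) (auto simp: n_def)
    finally have "n powr (\<beta> * \<epsilon>) \<le> real (gd x y) powr \<beta> / n"
      using n by (simp add: powr_add field_simps)
    then have "(n powr (\<beta> * \<epsilon>)) powr (1 / D) \<le> (real (gd x y) powr \<beta> / n) powr (1 / D)"
      using D by (intro powr_mono2) auto
    then have "n powr \<kappa> \<le> (real (gd x y) powr \<beta> / n) powr (1 / D)" by (simp add: powr_powr \<kappa>_def)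
    then have "exp (- c * (real (gd x y) powr \<beta> / n) powr (1 / D)) \<le> exp (- c * n powr \<kappa>)" using C by simp
    also have "\<dots> \<le> C' * n powr (- M)" by (rule C'(2)[OF n])
    finally have e: "exp (- c * (real (gd x y) powr \<beta> / n) powr (1 / D)) \<le> C' * n powr (- M)" .
    have "n powr (- D / \<beta>) \<le> 1" using n D powr_mono[of "- D / \<beta>" 0 n] by simp
    then have "C * n powr (- D / \<beta>) * exp (- c * (real (gd x y) powr \<beta> / n) powr (1 / D)) \<le> C * 1 * (C' * n powr (- M))"
      using e C by (intro mult_mono) auto
    then show ?thesis using le[of k x y] by (simp add: n_def mult.assoc)
  qed
  then show ?thesis using that[of "C * C'"] C C' by simp
qed

section \<open>The time derivative of the heat kernel\<close>

definition hkd :: "nat \<Rightarrow> 'a \<Rightarrow> 'a \<Rightarrow> real" where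
  "hkd k z w = \<bar>hk k z w - hk (Suc k) z w\<bar>"

lemma hkd_nonneg: "hkd k z w \<ge> 0" by (simp add: hkd_def)
lemma hkd_sym: "hkd k z w = hkd k w z" by (simp add: hkd_def hk_sym)

lemma hkd_eq_0: "Suc k < gd z w \<Longrightarrow> hkd k z w = 0"
  by (simp add: hkd_def hk_eq_0)

lemma hkd_le:
  obtains C where "C > 0" "\<And>k z w. hkd k z w \<le> C * (real k + 1) powr (- 1 - D / \<beta>)"
proof -
  obtain C where C: "C > 0" "\<And>k x y. hk k x y \<le> C * (real k + 1) powr (- D / \<beta>)" using hk_le by blast
  define C' where "C' = (1 + 1 / eps) * 3 * (C * 3 powr (D / \<beta>))"
  have "hkd k z w \<le> C' * (real k + 1) powr (- 1 - D / \<beta>)" for k z w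
  proof -
    define n where "n = real k + 1"
    have n: "n \<ge> 1" by (simp add: n_def)
    \<comment> \<open>Of the \<open>k\<close> steps about two thirds give the on-diagonal decay
      \<open>n powr (- D / \<beta>)\<close> and the remaining third gives the factor
      \<open>1 / n\<close>.\<close>
    define j b where "j = k div 3" and "b = k - 2 * j"
    have k: "k = 2 * j + b" by (simp add: j_def b_def)
    have kj: "k \<le> 3 * j + 2" "3 * j \<le> k" by (simp_all add: j_def)
    then have "real b = real k - 2 * real j" by (simp add: b_def of_nat_diff)
    then have j: "n / 3 \<le> real (2 * j) + 1" and b: "n / 3 \<le> real b + 1"
      using kj unfolding n_def by (simp_all add: field_simps)
    have pw: "(n / 3) powr (- D / \<beta>) = 3 powr (D / \<beta>) * n powr (- D / \<beta>)"
      using n by (simp add: powr_divide powr_minus field_simps)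
    have hkj: "hk (2 * j) x x \<le> C * 3 powr (D / \<beta>) * n powr (- D / \<beta>)" for x
    proof -
      have "hk (2 * j) x x \<le> C * (real (2 * j) + 1) powr (- D / \<beta>)" by (rule C)
      also have "\<dots> \<le> C * (n / 3) powr (- D / \<beta>)"
        using C(1) D n j by (intro mult_left_mono powr_mono2') auto
      finally show ?thesis by (simp only: pw mult.assoc)
    qed
    have "hkd k z w \<le> (1 + 1 / eps) / (real b + 1) * sqrt (hk (2 * j) z z) * sqrt (hk (2 * j) w w)"
      unfolding hkd_def k by (rule hk_diff_le)
    also have "\<dots> \<le> (1 + 1 / eps) / (n / 3) * sqrt (C * 3 powr (D / \<beta>) * n powr (- D / \<beta>)) * sqrt (C * 3 powr (D / \<beta>) * n powr (- D / \<beta>))"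
      using eps n b hk_nonneg C(1) by (intro mult_mono divide_left_mono real_sqrt_le_mono hkj) auto
    also have "\<dots> = (1 + 1 / eps) / (n / 3) * (C * 3 powr (D / \<beta>) * n powr (- D / \<beta>))"
      using C(1) by (simp add: mult.assoc)
    also have "\<dots> = C' * n powr (- 1 - D / \<beta>)"
      using n by (simp add: C'_def powr_diff powr_minus field_simps)
    finally show ?thesis by (simp add: n_def)
  qed
  moreover have "C' > 0" using C(1) eps by (simp add: C'_def add_pos_pos)
  ultimately show ?thesis using that by blast
qed

lemma hkd_moment:
  fixes s :: nat
  assumes \<epsilon>: "\<epsilon> > 0"
  obtains C where "C > 0"
    "\<And>k w F. finite F \<Longrightarrow> (\<Sum>z\<in>F. hkd k z w * real (gd w z) ^ s * m z) \<le> C * (real k + 1) powr (real s / \<beta> - 1 + \<epsilon>)"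
proof -
  \<comment> \<open>With this \<open>e\<close> the volume \<open>r powr D\<close> and the moment
    \<open>r ^ s\<close> of the near part together lose exactly
    \<open>n powr \<epsilon>\<close>.\<close>
  define e where "e = \<epsilon> / (D + real s)"
  define a where "a = 1 / \<beta> + e"
  have e: "e > 0" "e * (D + real s) = \<epsilon>" using \<epsilon> D by (auto simp: e_def)
  have a: "a > 0" using e D by (simp add: a_def add_pos_pos)
  obtain C5 where C5: "C5 > 0" "\<And>k z w. hkd k z w \<le> C5 * (real k + 1) powr (- 1 - D / \<beta>)" using hkd_le by blast
  obtain C2 where C2: "C2 > 0" "\<And>A x r. finite A \<Longrightarrow> (\<And>y. y \<in> A \<Longrightarrow> real (gd x y) \<le> r) \<Longrightarrow> r \<ge> 1 \<Longrightarrow> sum m A \<le> C2 * r powr D"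
    using ball_mass_le by blast
  define M where "M = D + real s + 1"
  obtain C4 where C4: "C4 > 0" "\<And>k x y. real (gd x y) \<ge> (real k + 1) powr a \<Longrightarrow> hk k x y \<le> C4 * (real k + 1) powr (- M)"
    using hk_tail[OF e(1), of M] unfolding a_def by blast
  define K1 where "K1 = C5 * C2 * 2 powr (a * (D + real s))"
  define K2 where "K2 = 2 * C4 * C2"
  have K: "K1 > 0" "K2 > 0" using C5 C2 C4 by (auto simp: K1_def K2_def)
  have "(\<Sum>z\<in>F. hkd k z w * real (gd w z) ^ s * m z) \<le> (K1 + K2) * (real k + 1) powr (real s / \<beta> - 1 + \<epsilon>)"
    if F: "finite F" for k w F
  proof -
    define n where "n = real k + 1"
    \<comment> \<open>The base is \<open>n + 1\<close>, not \<open>n\<close>, because the difference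
      also contains \<open>hk (Suc k)\<close>, whose tail bound starts at that radius.\<close>
    define r where "r = (n + 1) powr a"
    have n: "n \<ge> 1" by (simp add: n_def)
    have r: "r \<ge> 1" using n a by (simp add: r_def ge_one_powr_ge_zero)
    let ?t = "\<lambda>z. hkd k z w * real (gd w z) ^ s * m z"
    define A where "A = {z \<in> F. real (gd w z) \<le> r}"
    \<comment> \<open>Nothing lies beyond distance \<open>Suc k = n\<close>. On the far part the
      tail exponent \<open>M\<close> exceeds the volume and moment exponents by one, leaving
      \<open>n powr (- 1)\<close>.\<close>
    define B where "B = {z \<in> F. r < real (gd w z) \<and> gd w z \<le> Suc k}"
    have fin: "finite A" "finite B" using F by (auto simp: A_def B_def)
    have "sum ?t F = sum ?t (A \<union> B)"
    proof (rule sum.mono_neutral_right)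
      show "\<forall>z\<in>F - (A \<union> B). ?t z = 0"
      proof
        fix z assume "z \<in> F - (A \<union> B)"
        then have "Suc k < gd w z" by (auto simp: A_def B_def)
        then show "?t z = 0" by (simp add: hkd_eq_0 hkd_sym[of k z w])
      qed
    qed (use F in \<open>auto simp: A_def B_def\<close>)
    also have "\<dots> = sum ?t A + sum ?t B"
      by (rule sum.union_disjoint) (use fin in \<open>auto simp: A_def B_def\<close>)
    also have "sum ?t A \<le> K1 * n powr (real s / \<beta> - 1 + \<epsilon>)"
    proof -
      have "sum ?t A \<le> (\<Sum>z\<in>A. C5 * n powr (- 1 - D / \<beta>) * r ^ s * m z)"
        by (intro sum_mono mult_mono power_mono)
           (use C5(2) C5(1) r in \<open>auto simp: n_def A_def hkd_nonneg m_nonneg intro!: mult_nonneg_nonneg\<close>)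
      also have "\<dots> = C5 * n powr (- 1 - D / \<beta>) * r ^ s * sum m A"
        by (simp add: sum_distrib_left)
      also have "\<dots> \<le> C5 * n powr (- 1 - D / \<beta>) * r ^ s * (C2 * r powr D)"
        using C5 r fin by (intro mult_left_mono C2(2)[of _ w]) (auto simp: A_def)
      also have "\<dots> = C5 * C2 * n powr (- 1 - D / \<beta>) * r powr (D + real s)"
        using r by (simp add: powr_add powr_realpow)
      also have "\<dots> \<le> C5 * C2 * n powr (- 1 - D / \<beta>) * (2 powr (a * (D + real s)) * n powr (a * (D + real s)))"
      proof (rule mult_left_mono)
        have "r powr (D + real s) = (n + 1) powr (a * (D + real s))" by (simp add: r_def powr_powr)
        also have "\<dots> \<le> (2 * n) powr (a * (D + real s))"
          using n a D by (intro powr_mono2) auto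
        finally show "r powr (D + real s) \<le> 2 powr (a * (D + real s)) * n powr (a * (D + real s))"
          using n by (simp add: powr_mult)
      qed (use C5 C2 in auto)
      also have "\<dots> = K1 * (n powr (- 1 - D / \<beta>) * n powr (a * (D + real s)))"
        by (simp add: K1_def mult_ac)
      also have "n powr (- 1 - D / \<beta>) * n powr (a * (D + real s)) = n powr (real s / \<beta> - 1 + \<epsilon>)"
      proof -
        have "a * (D + real s) = (D + real s) / \<beta> + \<epsilon>" using e by (simp add: a_def distrib_right)
        then have "- 1 - D / \<beta> + a * (D + real s) = real s / \<beta> - 1 + \<epsilon>" by (simp add: add_divide_distrib)
        then show ?thesis by (simp only: powr_add[symmetric])
      qed
      finally show ?thesis .
    qed
    also have "sum ?t B \<le> K2 * n powr (real s / \<beta> - 1 + \<epsilon>)"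
    proof -
      have far: "hkd k z w \<le> 2 * C4 * n powr (- M)" if "z \<in> B" for z
      proof -
        have "n powr a \<le> r" using n a by (auto simp: r_def intro!: powr_mono2)
        then have 1: "hk k z w \<le> C4 * n powr (- M)"
          using that C4(2)[of k z w] by (simp add: B_def n_def gd_sym)
        have "hk (Suc k) z w \<le> C4 * (n + 1) powr (- M)"
          using that C4(2)[of "Suc k" z w] by (simp add: B_def n_def gd_sym r_def add_ac)
        also have "\<dots> \<le> C4 * n powr (- M)"
          using C4 n D by (intro mult_left_mono powr_mono2') (auto simp: M_def)
        finally show ?thesis using 1 hk_nonneg[of k z w] hk_nonneg[of "Suc k" z w] by (simp add: hkd_def)
      qed
      have gdn: "real (gd w z) \<le> n" if "z \<in> B" for z using that by (simp add: B_def n_def)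
      have "sum ?t B \<le> (\<Sum>z\<in>B. 2 * C4 * n powr (- M) * n ^ s * m z)"
        by (intro sum_mono mult_mono power_mono far gdn)
           (use C4 n in \<open>auto simp: m_nonneg intro!: mult_nonneg_nonneg\<close>)
      also have "\<dots> = 2 * C4 * n powr (- M) * n ^ s * sum m B" by (simp add: sum_distrib_left)
      also have "\<dots> \<le> 2 * C4 * n powr (- M) * n ^ s * (C2 * n powr D)"
        using C4 n fin gdn by (intro mult_left_mono C2(2)[of _ w]) auto
      also have "\<dots> = K2 * (n powr (- M) * (n powr real s * n powr D))"
        using n by (simp add: K2_def powr_realpow)
      also have "n powr (- M) * (n powr real s * n powr D) = n powr (- 1)"
        unfolding powr_add[symmetric] by (rule arg_cong[where f = "(powr) n"]) (simp add: M_def)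
      also have "K2 * n powr (- 1) \<le> K2 * n powr (real s / \<beta> - 1 + \<epsilon>)"
        using K n \<epsilon> D by (intro mult_left_mono powr_mono) auto
      finally show ?thesis .
    qed
    finally show ?thesis by (simp add: n_def distrib_right)
  qed
  then show ?thesis using that[of "K1 + K2"] K by simp
qed

section \<open>Spatial differences of the heat kernel: column and row sums\<close>

definition gk :: "nat \<Rightarrow> 'a \<Rightarrow> 'a \<Rightarrow> real" where
  "gk k x w = (\<Sum>y\<in>nbh x. \<bar>hk k x w - hk k y w\<bar>)"

lemma gk_nonneg: "gk k x w \<ge> 0" by (simp add: gk_def sum_nonneg)

lemma gk_col:
  assumes \<epsilon>: "\<epsilon> > 0"
  obtains C where "C > 0"
    "\<And>k w F. finite F \<Longrightarrow> (\<Sum>x\<in>F. gk k x w * m x) \<le> C * (real k + 1) powr (1 / \<beta> - 1 + \<epsilon>)"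
proof -
  obtain C where C: "C > 0"
    "\<And>k w F. finite F \<Longrightarrow> (\<Sum>z\<in>F. hkd k z w * real (gd w z) ^ 1 * m z) \<le> C * (real k + 1) powr (real 1 / \<beta> - 1 + \<epsilon>)"
    using hkd_moment[OF \<epsilon>, of 1] by blast
  have "(\<Sum>x\<in>F. gk k x w * m x) \<le> 2 / eps * C * (real k + 1) powr (1 / \<beta> - 1 + \<epsilon>)" if F: "finite F" for k w F
  proof -
    obtain S where S: "finite S" "(\<Sum>x\<in>F. gk k x w * m x) \<le> 2 / eps * (\<Sum>z\<in>S. hkd k z w * real (gd w z) * m z)"
      using total_diff_le[OF finite_support_hk F, of k w w] unfolding gk_def hkd_def hk_Suc by blast
    have "2 / eps * (\<Sum>z\<in>S. hkd k z w * real (gd w z) * m z) \<le> 2 / eps * (C * (real k + 1) powr (1 / \<beta> - 1 + \<epsilon>))"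
      using C(2)[OF S(1), of k w] eps by (intro mult_left_mono) auto
    with S show ?thesis by (simp add: mult.assoc)
  qed
  then show ?thesis using that[of "2 / eps * C"] C eps by simp
qed

lemma gk_row:
  assumes \<epsilon>: "\<epsilon> > 0"
  obtains C where "C > 0"
    "\<And>k x S. finite S \<Longrightarrow> (\<Sum>w\<in>S. gk k x w * m w) \<le> C * (real k + 1) powr (- 1 / \<beta> + \<epsilon>)"
proof -
  define e where "e = \<epsilon> / (D + 1)"
  define a where "a = 1 / \<beta> + e"
  have e: "e > 0" "e * (D + 1) = \<epsilon>" using \<epsilon> D by (auto simp: e_def)
  have a: "a > 0" using e D by (simp add: a_def add_pos_pos)
  obtain C6 where C6: "C6 > 0"
    "\<And>k w F. finite F \<Longrightarrow> (\<Sum>z\<in>F. hkd k z w * real (gd w z) ^ 0 * m z) \<le> C6 * (real k + 1) powr (real 0 / \<beta> - 1 + e)"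
    using hkd_moment[OF e(1), of 0] by blast
  obtain C2 where C2: "C2 > 0" "\<And>A x r. finite A \<Longrightarrow> (\<And>y. y \<in> A \<Longrightarrow> real (gd x y) \<le> r) \<Longrightarrow> r \<ge> 1 \<Longrightarrow> sum m A \<le> C2 * r powr D"
    using ball_mass_le by blast
  define M where "M = D + 1"
  obtain C4 where C4: "C4 > 0" "\<And>k x y. real (gd x y) \<ge> (real k + 1) powr a \<Longrightarrow> hk k x y \<le> C4 * (real k + 1) powr (- M)"
    using hk_tail[OF e(1), of M] unfolding a_def by blast
  obtain c0 where c0: "c0 > 0" "\<And>x. c0 \<le> m x" using m_lower_bound by blast
  have card: "real (card (nbh x)) \<le> 1 / eps" for x by (rule card_nbh_le[OF finite_nbh subset_refl])
  define K0 where "K0 = C6 / (eps * c0)"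
  define K1 where "K1 = 1 / eps * K0 * C2 * 2 powr D"
  define K2 where "K2 = 1 / eps * (2 * C4) * C2"
  have K: "K0 > 0" "K1 > 0" "K2 > 0" using C6 C2 C4 c0 eps by (auto simp: K0_def K1_def K2_def)
  \<comment> \<open>The zeroth moment bounds the flux through the edge uniformly in
    \<open>w\<close>; dividing by the edge weight uses the lower bound of \<open>m\<close>.\<close>
  have edge: "\<bar>hk k x w - hk k y w\<bar> \<le> K0 * (real k + 1) powr (- 1 + e)" if y: "y \<in> nbh x" for k x y w
  proof -
    obtain S where S: "finite S" "\<mu> x y * \<bar>hk k x w - hk k y w\<bar> \<le> (\<Sum>z\<in>S. hkd k z w * m z)"
      using edge_diff_le[OF finite_support_hk y, of k w] unfolding hkd_def hk_Suc by blast
    have "eps * c0 * \<bar>hk k x w - hk k y w\<bar> \<le> \<mu> x y * \<bar>hk k x w - hk k y w\<bar>"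
    proof (rule mult_right_mono)
      have "eps * c0 \<le> eps * m x" using eps c0 by (intro mult_left_mono) auto
      then show "eps * c0 \<le> \<mu> x y" using eps(3)[OF y] by simp
    qed simp
    also have "\<dots> \<le> C6 * (real k + 1) powr (- 1 + e)"
      using S(2) C6(2)[OF S(1), of k w] by simp
    finally show ?thesis using eps c0 by (simp add: K0_def field_simps)
  qed
  have "(\<Sum>w\<in>S. gk k x w * m w) \<le> (K1 + K2) * (real k + 1) powr (- 1 / \<beta> + \<epsilon>)"
    if S: "finite S" for k x S
  proof -
    define n where "n = real k + 1"
    \<comment> \<open>The additional 1 puts the neighbours of \<open>x\<close> into the tail region
      as well.\<close>
    define r where "r = n powr a + 1"
    have n: "n \<ge> 1" by (simp add: n_def)
    have na: "n powr a \<ge> 1" using n a by (simp add: ge_one_powr_ge_zero)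
    have r: "r \<ge> 1" using na by (simp add: r_def)
    let ?t = "\<lambda>w. gk k x w * m w"
    define A where "A = {w \<in> S. real (gd x w) \<le> r}"
    define B where "B = {w \<in> S. r < real (gd x w) \<and> gd x w \<le> Suc k}"
    have fin: "finite A" "finite B" using S by (auto simp: A_def B_def)
    have "sum ?t S = sum ?t (A \<union> B)"
    proof (rule sum.mono_neutral_right)
      show "\<forall>w\<in>S - (A \<union> B). ?t w = 0"
      proof
        fix w assume "w \<in> S - (A \<union> B)"
        then have far: "Suc k < gd x w" by (auto simp: A_def B_def)
        have "hk k y w = 0" if "y \<in> nbh x" for y
          using far gd_triangle[of x w y] gd_nbh_le[OF that] by (intro hk_eq_0) simp
        moreover have "hk k x w = 0" using far by (intro hk_eq_0) simp
        ultimately have "gk k x w = 0" unfolding gk_def by (intro sum.neutral ballI) simp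
        then show "?t w = 0" by simp
      qed
    qed (use S in \<open>auto simp: A_def B_def\<close>)
    also have "\<dots> = sum ?t A + sum ?t B"
      by (rule sum.union_disjoint) (use fin in \<open>auto simp: A_def B_def\<close>)
    also have "sum ?t A \<le> K1 * n powr (- 1 / \<beta> + \<epsilon>)"
    proof -
      have gkle: "gk k x w \<le> 1 / eps * (K0 * n powr (- 1 + e))" for w
      proof -
        have "gk k x w \<le> real (card (nbh x)) * (K0 * n powr (- 1 + e))"
          unfolding gk_def using edge by (intro sum_bounded_above) (auto simp: n_def)
        also have "\<dots> \<le> 1 / eps * (K0 * n powr (- 1 + e))"
          using card K by (intro mult_right_mono) auto
        finally show ?thesis .
      qed
      have "sum ?t A \<le> (\<Sum>w\<in>A. 1 / eps * (K0 * n powr (- 1 + e)) * m w)"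
        by (intro sum_mono mult_right_mono gkle m_nonneg)
      also have "\<dots> = 1 / eps * (K0 * n powr (- 1 + e)) * sum m A"
        by (simp only: sum_distrib_left)
      also have "\<dots> \<le> 1 / eps * (K0 * n powr (- 1 + e)) * (C2 * r powr D)"
        using K eps r fin by (intro mult_left_mono C2(2)[of _ x]) (auto simp: A_def)
      also have "\<dots> \<le> 1 / eps * (K0 * n powr (- 1 + e)) * (C2 * (2 powr D * n powr (a * D)))"
      proof (intro mult_left_mono)
        have "r powr D \<le> (2 * n powr a) powr D" using na D r by (intro powr_mono2) (auto simp: r_def)
        then show "r powr D \<le> 2 powr D * n powr (a * D)" by (simp add: powr_mult powr_powr)
      qed (use K eps C2 in auto)
      also have "\<dots> = K1 * (n powr (- 1 + e) * n powr (a * D))" by (simp add: K1_def mult_ac)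
      also have "n powr (- 1 + e) * n powr (a * D) = n powr (- 1 / \<beta> + \<epsilon>)"
      proof -
        have "e * D + e = \<epsilon>" using e(2) by (simp add: distrib_left)
        moreover have "a * D = D / \<beta> + e * D" by (simp add: a_def distrib_right)
        \<comment> \<open>Here \<open>\<beta> = D + 1\<close> enters: the edge bound
          \<open>1 / n\<close> times the volume \<open>n powr (D / \<beta>)\<close> of the heat
          ball.\<close>
        moreover have "D / \<beta> - 1 = - 1 / \<beta>" using D by (simp add: field_simps)
        ultimately have "- 1 + e + a * D = - 1 / \<beta> + \<epsilon>" by linarith
        then show ?thesis by (simp only: powr_add[symmetric])
      qed
      finally show ?thesis .
    qed
    also have "sum ?t B \<le> K2 * n powr (- 1 / \<beta> + \<epsilon>)"
    proof -
      have far: "gk k x w \<le> 1 / eps * (2 * C4 * n powr (- M))" if w: "w \<in> B" for w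
      proof -
        have 1: "hk k x w \<le> C4 * n powr (- M)"
          using w C4(2)[of k x w] by (simp add: B_def n_def r_def)
        have 2: "hk k y w \<le> C4 * n powr (- M)" if "y \<in> nbh x" for y
          using w C4(2)[of k y w] gd_triangle[of x w y] gd_nbh_le[OF that] by (simp add: B_def n_def r_def)
        have "gk k x w \<le> real (card (nbh x)) * (2 * C4 * n powr (- M))"
          unfolding gk_def
        proof (rule sum_bounded_above)
          fix y assume "y \<in> nbh x"
          then show "\<bar>hk k x w - hk k y w\<bar> \<le> 2 * C4 * n powr (- M)"
            using 1 2[of y] hk_nonneg[of k x w] hk_nonneg[of k y w] by simp
        qed
        also have "\<dots> \<le> 1 / eps * (2 * C4 * n powr (- M))"
          using card C4 by (intro mult_right_mono) auto
        finally show ?thesis .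
      qed
      have "sum ?t B \<le> (\<Sum>w\<in>B. 1 / eps * (2 * C4 * n powr (- M)) * m w)"
        by (intro sum_mono mult_right_mono far m_nonneg)
      also have "\<dots> = 1 / eps * (2 * C4 * n powr (- M)) * sum m B" by (simp only: sum_distrib_left)
      also have "\<dots> \<le> 1 / eps * (2 * C4 * n powr (- M)) * (C2 * n powr D)"
        using C4 n fin eps by (intro mult_left_mono C2(2)[of _ x]) (auto simp: B_def n_def)
      also have "\<dots> = K2 * (n powr (- M) * n powr D)" by (simp add: K2_def)
      also have "n powr (- M) * n powr D = n powr (- 1)"
        unfolding powr_add[symmetric] by (rule arg_cong[where f = "(powr) n"]) (simp add: M_def)
      also have "K2 * n powr (- 1) \<le> K2 * n powr (- 1 / \<beta> + \<epsilon>)"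
      proof -
        have "1 / \<beta> \<le> 1" using D by simp
        then have "- 1 \<le> - 1 / \<beta> + \<epsilon>" using \<epsilon> by simp
        then show ?thesis using K n by (intro mult_left_mono powr_mono) auto
      qed
      finally show ?thesis .
    qed
    finally show ?thesis by (simp add: n_def distrib_right)
  qed
  then show ?thesis using that[of "K1 + K2"] K by simp
qed

lemma Lp_weight_1: "p > 1 \<Longrightarrow> Lp_weight m p" by (rule Lp_weight_m) simp

lemma schur_powr:
  assumes p: "p > 1" and A: "A > 0" and B: "B > 0"
    and K: "\<And>x w. K x w \<ge> 0"
    and row: "\<And>x S. finite S \<Longrightarrow> (\<Sum>w\<in>S. K x w * m w) \<le> A * n powr a"
    and col: "\<And>w F. finite F \<Longrightarrow> (\<Sum>x\<in>F. K x w * m x) \<le> B * n powr b"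
    and g: "Lp_le m p g G" "G \<ge> 0"
    and h: "\<And>x. \<exists>S. finite S \<and> \<bar>h x\<bar> \<le> (\<Sum>w\<in>S. K x w * \<bar>g w\<bar> * m w)"
  shows "Lp_le m p h (A powr (1 - 1 / p) * B powr (1 / p) * n powr (a * (1 - 1 / p) + b * (1 / p)) * G)"
proof -
  interpret Lp_weight m p using p by (rule Lp_weight_1)
  have "Lp_le m p h ((A * n powr a) powr (1 - 1 / p) * (B * n powr b) powr (1 / p) * G)"
    by (rule schur_test[OF K row col g h])
  also have "(A * n powr a) powr (1 - 1 / p) * (B * n powr b) powr (1 / p) * G =
      A powr (1 - 1 / p) * B powr (1 / p) * n powr (a * (1 - 1 / p) + b * (1 / p)) * G"
    using A B by (simp add: powr_mult powr_powr powr_add)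
  finally show ?thesis .
qed

text \<open>A majorant of the gradient length without squares: sums of absolute differences fit the
  Schur test and pass to the limit termwise.\<close>

definition nb_diff :: "('a \<Rightarrow> real) \<Rightarrow> 'a \<Rightarrow> real" where
  "nb_diff f x = (\<Sum>y\<in>nbh x. \<bar>f x - f y\<bar>)"

lemma markov_power_nb_diff_lp:
  assumes p: "p > 1" and \<epsilon>: "\<epsilon> > 0"
  obtains C where "C > 0" "\<And>k g G. Lp_le m p g G \<Longrightarrow> G \<ge> 0 \<Longrightarrow>
     Lp_le m p (nb_diff ((markov \<mu> ^^ k) g)) (C * (real k + 1) powr (- gamma_star D p + \<epsilon>) * G)"
proof -
  obtain A where A: "A > 0" "\<And>k x S. finite S \<Longrightarrow> (\<Sum>w\<in>S. gk k x w * m w) \<le> A * (real k + 1) powr (- 1 / \<beta> + \<epsilon>)"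
    using gk_row[OF \<epsilon>] by blast
  obtain B where B: "B > 0" "\<And>k w F. finite F \<Longrightarrow> (\<Sum>x\<in>F. gk k x w * m x) \<le> B * (real k + 1) powr (1 / \<beta> - 1 + \<epsilon>)"
    using gk_col[OF \<epsilon>] by blast
  have ex: "(- 1 / \<beta> + \<epsilon>) * (1 - 1 / p) + (1 / \<beta> - 1 + \<epsilon>) * (1 / p) = - gamma_star D p + \<epsilon>"
    using p D by (simp add: gamma_star_def divide_simps) (simp add: algebra_simps)
  have "Lp_le m p (nb_diff ((markov \<mu> ^^ k) g))
      (A powr (1 - 1 / p) * B powr (1 / p) * (real k + 1) powr (- gamma_star D p + \<epsilon>) * G)"
    if g: "Lp_le m p g G" "G \<ge> 0" for k g G
    unfolding ex[symmetric]
  proof (rule schur_powr[OF p A(1) B(1) gk_nonneg A(2) B(2) g])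
    fix x
    \<comment> \<open>Radius \<open>Suc k\<close> covers the balls of radius \<open>k\<close> around
      all neighbours of \<open>x\<close>.\<close>
    define S where "S = cb x (Suc k)"
    have S: "finite S" by (simp add: S_def finite_cb)
    have eq: "(markov \<mu> ^^ k) g y = (\<Sum>w\<in>S. hk k y w * g w * m w)" if y: "y \<in> nbh x" for y
    proof (rule markov_power_eq[OF S])
      fix w assume "w \<notin> S" "gd y w \<le> k"
      then show "g w = 0" using gd_triangle[of x w y] gd_nbh_le[OF y] by (simp add: S_def cb_def)
    qed
    have "\<bar>nb_diff ((markov \<mu> ^^ k) g) x\<bar> = (\<Sum>y\<in>nbh x. \<bar>\<Sum>w\<in>S. (hk k x w - hk k y w) * g w * m w\<bar>)"
      by (simp add: nb_diff_def eq nbh_refl sum_subtractf[symmetric] left_diff_distrib sum_nonneg)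
    also have "\<dots> \<le> (\<Sum>y\<in>nbh x. \<Sum>w\<in>S. \<bar>hk k x w - hk k y w\<bar> * \<bar>g w\<bar> * m w)"
      by (intro sum_mono order_trans[OF sum_abs]) (simp add: abs_mult m_nonneg)
    also have "\<dots> = (\<Sum>w\<in>S. gk k x w * \<bar>g w\<bar> * m w)"
      by (subst sum.swap) (simp add: gk_def sum_distrib_right)
    finally show "\<exists>S. finite S \<and> \<bar>nb_diff ((markov \<mu> ^^ k) g) x\<bar> \<le> (\<Sum>w\<in>S. gk k x w * \<bar>g w\<bar> * m w)"
      using S by blast
  qed
  then show ?thesis using that[of "A powr (1 - 1 / p) * B powr (1 / p)"] A B by simp
qed

lemma grad_length_eq: "grad_length \<mu> f x = sqrt (\<Sum>y\<in>nbh x. \<mu> x y / (2 * m x) * (f x - f y)\<^sup>2)"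
  unfolding grad_length_def nbh_def[symmetric]
  by (simp add: infsum_finite[OF finite_nbh] sum_distrib_left)

lemma grad_length_le: "\<bar>grad_length \<mu> f x\<bar> \<le> \<bar>nb_diff f x\<bar>"
proof -
  have "(\<Sum>y\<in>nbh x. \<mu> x y / (2 * m x) * (f x - f y)\<^sup>2) \<le> (\<Sum>y\<in>nbh x. \<bar>f x - f y\<bar>\<^sup>2)"
  proof (rule sum_mono)
    fix y
    have "\<mu> x y / (2 * m x) \<le> 1" using mu_le_m[of x y] m_pos[of x] by (simp add: field_simps)
    then show "\<mu> x y / (2 * m x) * (f x - f y)\<^sup>2 \<le> \<bar>f x - f y\<bar>\<^sup>2"
      using mult_right_mono[of "\<mu> x y / (2 * m x)" 1 "(f x - f y)\<^sup>2"] by simp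
  qed
  then have "grad_length \<mu> f x \<le> L2_set (\<lambda>y. \<bar>f x - f y\<bar>) (nbh x)"
    unfolding grad_length_eq L2_set_def by (rule real_sqrt_le_mono)
  also have "\<dots> \<le> nb_diff f x" unfolding nb_diff_def by (rule L2_set_le_sum) auto
  finally have "grad_length \<mu> f x \<le> nb_diff f x" .
  moreover have "0 \<le> grad_length \<mu> f x"
    unfolding grad_length_eq using mu_nonneg m_nonneg by (auto intro!: real_sqrt_ge_zero sum_nonneg)
  ultimately show ?thesis by simp
qed

lemma diff_le_grad_length:
  assumes y: "y \<in> nbh x"
  shows "\<bar>f x - f y\<bar> \<le> sqrt (2 / eps) * grad_length \<mu> f x"
proof -
  have "(f x - f y)\<^sup>2 * (eps / 2) \<le> \<mu> x y / (2 * m x) * (f x - f y)\<^sup>2"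
    using eps(3)[OF y] m_pos[of x] mult_right_mono[of "eps / 2" "\<mu> x y / (2 * m x)" "(f x - f y)\<^sup>2"]
    by (simp add: field_simps)
  also have "\<dots> \<le> (\<Sum>y\<in>nbh x. \<mu> x y / (2 * m x) * (f x - f y)\<^sup>2)"
    by (rule member_le_sum) (use y finite_nbh mu_nonneg m_nonneg in auto)
  finally have "(f x - f y)\<^sup>2 \<le> 2 / eps * (\<Sum>y\<in>nbh x. \<mu> x y / (2 * m x) * (f x - f y)\<^sup>2)"
    using eps by (simp add: field_simps)
  then have "sqrt ((f x - f y)\<^sup>2) \<le> sqrt (2 / eps * (\<Sum>y\<in>nbh x. \<mu> x y / (2 * m x) * (f x - f y)\<^sup>2))"
    by (rule real_sqrt_le_mono)
  then show ?thesis by (simp only: grad_length_eq real_sqrt_mult real_sqrt_abs)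
qed

text \<open>Green's formula moves one difference from \<open>f\<close> onto \<open>hk k w\<close>,
  so \<open>P^k \<Delta> f\<close> is controlled by the gradient of \<open>f\<close> under the
  transpose of \<open>gk\<close>.\<close>

lemma markov_power_laplacian_le:
  "\<exists>S. finite S \<and> \<bar>(markov \<mu> ^^ k) (\<lambda>x. f x - markov \<mu> f x) w\<bar> \<le>
     (\<Sum>x\<in>S. gk k x w * \<bar>sqrt (2 / eps) / 2 * grad_length \<mu> f x\<bar> * m x)"
proof -
  define S where "S = cb w (Suc k)"
  define \<phi> where "\<phi> x = hk k w x" for x
  have S: "finite S" by (simp add: S_def finite_cb)
  have g0: "0 \<le> grad_length \<mu> f x" for x
    unfolding grad_length_eq using mu_nonneg m_nonneg by (auto intro!: real_sqrt_ge_zero sum_nonneg)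
  have "(markov \<mu> ^^ k) (\<lambda>x. f x - markov \<mu> f x) w = (\<Sum>x\<in>S. \<phi> x * (f x - markov \<mu> f x) * m x)"
    unfolding \<phi>_def by (rule markov_power_eq[OF S]) (auto simp: S_def cb_def)
  also have "\<dots> = (\<Sum>x\<in>S. \<Sum>y\<in>S. \<mu> x y * \<phi> x * (f x - f y))"
  proof (rule sum.cong)
    fix x
    show "\<phi> x * (f x - markov \<mu> f x) * m x = (\<Sum>y\<in>S. \<mu> x y * \<phi> x * (f x - f y))"
    proof (cases "gd w x \<le> k")
      case True
      have sub: "nbh x \<subseteq> S" using True gd_nbh[of _ x w] by (force simp: S_def cb_def)
      have "(f x - markov \<mu> f x) * m x = f x * m x - (\<Sum>y\<in>nbh x. \<mu> x y * f y)"
        using m_pos[of x] by (simp add: markov_eq left_diff_distrib)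
      also have "\<dots> = (\<Sum>y\<in>nbh x. \<mu> x y * (f x - f y))"
        by (simp add: m_eq_sum sum_distrib_left right_diff_distrib sum_subtractf mult.commute)
      also have "\<dots> = (\<Sum>y\<in>S. \<mu> x y * (f x - f y))"
        by (rule sum.mono_neutral_left) (use S sub mu_eq_0 in auto)
      finally show ?thesis by (simp add: sum_distrib_left mult_ac)
    next
      case False
      then show ?thesis by (simp add: \<phi>_def hk_eq_0)
    qed
  qed simp
  also have "\<dots> = (\<Sum>x\<in>S. \<Sum>y\<in>S. \<mu> x y * (\<phi> x - \<phi> y) * (f x - f y)) / 2"
  proof -
    have "(\<Sum>x\<in>S. \<Sum>y\<in>S. \<mu> x y * \<phi> y * (f x - f y)) = (\<Sum>x\<in>S. \<Sum>y\<in>S. \<mu> y x * \<phi> x * (f y - f x))"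
      by (rule sum.swap)
    also have "\<dots> = - (\<Sum>x\<in>S. \<Sum>y\<in>S. \<mu> x y * \<phi> x * (f x - f y))"
      unfolding sum_negf[symmetric] by (intro sum.cong) (auto simp: mu_sym algebra_simps)
    finally have swap: "(\<Sum>x\<in>S. \<Sum>y\<in>S. \<mu> x y * \<phi> y * (f x - f y)) = - (\<Sum>x\<in>S. \<Sum>y\<in>S. \<mu> x y * \<phi> x * (f x - f y))" .
    have "(\<Sum>x\<in>S. \<Sum>y\<in>S. \<mu> x y * (\<phi> x - \<phi> y) * (f x - f y)) =
        (\<Sum>x\<in>S. \<Sum>y\<in>S. \<mu> x y * \<phi> x * (f x - f y)) - (\<Sum>x\<in>S. \<Sum>y\<in>S. \<mu> x y * \<phi> y * (f x - f y))"
      unfolding sum_subtractf[symmetric] by (intro sum.cong refl) (simp only: left_diff_distrib right_diff_distrib)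
    then show ?thesis unfolding swap by simp
  qed
  also have "\<bar>\<dots>\<bar> \<le> (\<Sum>x\<in>S. \<bar>\<Sum>y\<in>S. \<mu> x y * (\<phi> x - \<phi> y) * (f x - f y)\<bar>) / 2"
    by simp
  also have "\<dots> \<le> (\<Sum>x\<in>S. gk k x w * (sqrt (2 / eps) * grad_length \<mu> f x) * m x) / 2"
  proof (intro divide_right_mono sum_mono)
    fix x
    have "\<bar>\<Sum>y\<in>S. \<mu> x y * (\<phi> x - \<phi> y) * (f x - f y)\<bar> = \<bar>\<Sum>y\<in>S \<inter> nbh x. \<mu> x y * (\<phi> x - \<phi> y) * (f x - f y)\<bar>"
      by (rule arg_cong[where f = abs], rule sum.mono_neutral_right) (use S mu_eq_0 in auto)
    also have "\<dots> \<le> (\<Sum>y\<in>S \<inter> nbh x. \<bar>\<mu> x y * (\<phi> x - \<phi> y) * (f x - f y)\<bar>)" by (rule sum_abs)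
    also have "\<dots> \<le> (\<Sum>y\<in>nbh x. \<bar>\<mu> x y * (\<phi> x - \<phi> y) * (f x - f y)\<bar>)"
      by (rule sum_mono2) (use finite_nbh in auto)
    also have "\<dots> \<le> (\<Sum>y\<in>nbh x. m x * \<bar>\<phi> x - \<phi> y\<bar> * (sqrt (2 / eps) * grad_length \<mu> f x))"
      unfolding abs_mult
      by (intro sum_mono mult_mono diff_le_grad_length)
         (auto simp: mu_nonneg mu_le_m m_nonneg intro!: mult_nonneg_nonneg)
    also have "\<dots> = gk k x w * (sqrt (2 / eps) * grad_length \<mu> f x) * m x"
      by (simp add: gk_def \<phi>_def hk_sym[of k w] sum_distrib_left sum_distrib_right mult_ac)
    finally show "\<bar>\<Sum>y\<in>S. \<mu> x y * (\<phi> x - \<phi> y) * (f x - f y)\<bar> \<le> gk k x w * (sqrt (2 / eps) * grad_length \<mu> f x) * m x" .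
  qed simp
  also have "\<dots> = (\<Sum>x\<in>S. gk k x w * \<bar>sqrt (2 / eps) / 2 * grad_length \<mu> f x\<bar> * m x)"
  proof -
    have "\<bar>sqrt (2 / eps) / 2 * grad_length \<mu> f x\<bar> = sqrt (2 / eps) * grad_length \<mu> f x / 2" for x
      using g0[of x] eps by (simp add: abs_mult)
    then show ?thesis by (simp only: sum_divide_distrib times_divide_eq_right times_divide_eq_left)
  qed
  finally show ?thesis using S by blast
qed

text \<open>For the transposed kernel the row and column bounds change roles, so the exponent is
  minus \<open>gamma_star\<close> at the conjugate exponent of \<open>p\<close>, which equals
  \<open>gamma_star D p - 1\<close>.\<close>

lemma markov_power_laplacian_grad_lp:
  assumes p: "p > 1" and \<epsilon>: "\<epsilon> > 0"
  obtains C where "C > 0" "\<And>k f G. Lp_le m p (grad_length \<mu> f) G \<Longrightarrow> G \<ge> 0 \<Longrightarrow>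
     Lp_le m p ((markov \<mu> ^^ k) (\<lambda>x. f x - markov \<mu> f x)) (C * (real k + 1) powr (gamma_star D p - 1 + \<epsilon>) * G)"
proof -
  interpret Lp_weight m p using p by (rule Lp_weight_1)
  obtain A where A: "A > 0" "\<And>k x S. finite S \<Longrightarrow> (\<Sum>w\<in>S. gk k x w * m w) \<le> A * (real k + 1) powr (- 1 / \<beta> + \<epsilon>)"
    using gk_row[OF \<epsilon>] by blast
  obtain B where B: "B > 0" "\<And>k w F. finite F \<Longrightarrow> (\<Sum>x\<in>F. gk k x w * m x) \<le> B * (real k + 1) powr (1 / \<beta> - 1 + \<epsilon>)"
    using gk_col[OF \<epsilon>] by blast
  have ex: "(1 / \<beta> - 1 + \<epsilon>) * (1 - 1 / p) + (- 1 / \<beta> + \<epsilon>) * (1 / p) = gamma_star D p - 1 + \<epsilon>"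
    using p D by (simp add: gamma_star_def divide_simps) (simp add: algebra_simps)
  define s where "s = sqrt (2 / eps) / 2"
  have s: "s > 0" using eps by (simp add: s_def)
  have "Lp_le m p ((markov \<mu> ^^ k) (\<lambda>x. f x - markov \<mu> f x))
      (B powr (1 - 1 / p) * A powr (1 / p) * (real k + 1) powr (gamma_star D p - 1 + \<epsilon>) * (s * G))"
    if g: "Lp_le m p (grad_length \<mu> f) G" "G \<ge> 0" for k f G
    unfolding ex[symmetric]
  proof (rule schur_powr[OF p B(1) A(1), where K = "\<lambda>x w. gk k w x" and g = "\<lambda>x. s * grad_length \<mu> f x"])
    show "Lp_le m p (\<lambda>x. s * grad_length \<mu> f x) (s * G)" using lp_le_cmult[OF g, of s] s by simp
    show "\<exists>S. finite S \<and> \<bar>(markov \<mu> ^^ k) (\<lambda>x. f x - markov \<mu> f x) x\<bar> \<le> (\<Sum>w\<in>S. gk k w x * \<bar>s * grad_length \<mu> f w\<bar> * m w)" for x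
      unfolding s_def by (rule markov_power_laplacian_le)
  qed (use A(2) B(2) s g in \<open>auto simp: gk_nonneg\<close>)
  then show ?thesis using that[of "B powr (1 - 1 / p) * A powr (1 / p) * s"] A B s by (simp add: mult_ac)
qed

end

section \<open>The inequalities below and above the critical exponent\<close>

context vicsek
begin

text \<open>Only \<open>B > 0\<close> is asked for in \<open>le\<close>, so the norm is approached
  from above by \<open>B + e\<close>; this includes the case of norm 0.\<close>

lemma norm_ineqI:
  assumes p: "p > 1" and K: "K > 0"
    and le: "\<And>B. B > 0 \<Longrightarrow> Lp_le m p g B \<Longrightarrow> Lp_le m p f (K * B)"
  shows "Lp_norm \<mu> p f \<le> ennreal K * Lp_norm \<mu> p g"
proof (cases "Lp_norm \<mu> p g")
  case (real B)
  have "Lp_norm \<mu> p f \<le> ennreal (K * (B + e))" if e: "e > 0" for e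
  proof -
    have "Lp_norm \<mu> p g \<le> ennreal (B + e)" using real e by (simp add: ennreal_leI)
    then have "Lp_le m p g (B + e)" using Lp_norm_le_iff[OF m_pos, of p "B + e" g] p real e by simp
    then have "Lp_le m p f (K * (B + e))" using le[of "B + e"] real e by simp
    then show ?thesis using Lp_norm_le_iff[OF m_pos, of p "K * (B + e)" f] p K real e by simp
  qed
  note bound = this
  then have fin: "Lp_norm \<mu> p f < \<infinity>" using le_less_trans[OF bound[of 1] ennreal_less_top] by simp
  define r where "r = enn2real (Lp_norm \<mu> p f)"
  have r: "Lp_norm \<mu> p f = ennreal r" "r \<ge> 0" using fin by (auto simp: r_def)
  have "r \<le> K * B"
  proof (rule field_le_epsilon)
    fix e :: real assume "e > 0"
    then have "ennreal r \<le> ennreal (K * (B + e / K))" using bound[of "e / K"] K r by simp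
    moreover have "K * (B + e / K) = K * B + e" using K by (simp add: distrib_left)
    ultimately have "ennreal r \<le> ennreal (K * B + e)" by (simp only:)
    then show "r \<le> K * B + e" by (subst (asm) ennreal_le_iff) (use K real \<open>e > 0\<close> in auto)
  qed
  then show ?thesis using r real K by (simp add: ennreal_leI flip: ennreal_mult)
next
  case top
  then show ?thesis using K by (simp add: ennreal_mult_top)
qed

lemma norm_ineqD:
  assumes p: "p > 1" and K: "K > 0" and le: "Lp_norm \<mu> p f \<le> ennreal K * Lp_norm \<mu> p g"
    and g: "Lp_le m p g B" "B \<ge> 0"
  shows "Lp_le m p f (K * B)"
proof -
  have "Lp_norm \<mu> p g \<le> ennreal B" using Lp_norm_le_iff[OF m_pos, of p B g] p g by simp
  then have "Lp_norm \<mu> p f \<le> ennreal K * ennreal B" using le by (meson mult_left_mono order_trans zero_le)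
  then have "Lp_norm \<mu> p f \<le> ennreal (K * B)" using K g by (simp add: ennreal_mult)
  then show ?thesis using Lp_norm_le_iff[OF m_pos, of p "K * B" f] p K g by simp
qed

lemma gamma_star_bounds: "p > 1 \<Longrightarrow> 0 < gamma_star D p \<and> gamma_star D p < 1"
proof -
  assume p: "p > 1"
  have q: "0 \<le> 1 - 2 / \<beta>" "0 < 1 / \<beta>" using D by auto
  have range: "0 < v + u \<and> v + u < 1" if "0 \<le> u" "u \<le> 1 - 2 * v" "0 < v" for u v :: real
    using that by auto
  have "1 / p * (1 - 2 / \<beta>) \<le> 1 * (1 - 2 / \<beta>)" using p q by (intro mult_right_mono) auto
  moreover have "0 \<le> 1 / p * (1 - 2 / \<beta>)" using p q by (intro mult_nonneg_nonneg) auto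
  ultimately show ?thesis unfolding gamma_star_def using q by (intro range) auto
qed

lemma summable_powr: "e > 0 \<Longrightarrow> summable (\<lambda>k. (real k + 1) powr (- 1 - e))"
  using summable_Suc_iff[of "\<lambda>k. real k powr (- 1 - e)"] summable_real_powr_iff[of "- 1 - e"]
  by (simp add: add.commute)

section \<open>Inverting the fractional power along the semigroup\<close>

lemma markov_power_decay:
  assumes fin: "finite {x. f x \<noteq> 0}"
  obtains C where "C > 0" "\<And>j x. \<bar>(markov \<mu> ^^ j) f x\<bar> \<le> C * (real j + 1) powr (- D / \<beta>)"
proof -
  obtain C3 where C3: "C3 > 0" "\<And>k x y. hk k x y \<le> C3 * (real k + 1) powr (- D / \<beta>)" using hk_le by blast
  let ?X = "{x. f x \<noteq> 0}"
  define s where "s = (\<Sum>y\<in>?X. \<bar>f y\<bar> * m y)"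
  have s: "s \<ge> 0" by (simp add: s_def sum_nonneg m_nonneg)
  have "\<bar>(markov \<mu> ^^ j) f x\<bar> \<le> C3 * (s + 1) * (real j + 1) powr (- D / \<beta>)" for j x
  proof -
    have "(markov \<mu> ^^ j) f x = (\<Sum>y\<in>?X. hk j x y * f y * m y)"
      by (rule markov_power_eq[OF fin]) simp
    also have "\<bar>\<dots>\<bar> \<le> (\<Sum>y\<in>?X. \<bar>hk j x y * f y * m y\<bar>)" by (rule sum_abs)
    also have "\<dots> = (\<Sum>y\<in>?X. hk j x y * (\<bar>f y\<bar> * m y))" by (simp add: abs_mult hk_nonneg m_nonneg mult.assoc)
    also have "\<dots> \<le> (\<Sum>y\<in>?X. C3 * (real j + 1) powr (- D / \<beta>) * (\<bar>f y\<bar> * m y))"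
      by (intro sum_mono mult_right_mono C3) (simp add: m_nonneg)
    also have "\<dots> = C3 * (real j + 1) powr (- D / \<beta>) * s" by (simp only: s_def sum_distrib_left)
    also have "\<dots> \<le> C3 * (real j + 1) powr (- D / \<beta>) * (s + 1)" using C3 by (intro mult_left_mono) auto
    finally show ?thesis by (simp only: mult_ac)
  qed
  then show ?thesis using that[of "C3 * (s + 1)"] C3 s by simp
qed

lemma markov_power_bounded:
  assumes fin: "finite {x. f x \<noteq> 0}"
  obtains C where "\<And>j x. \<bar>(markov \<mu> ^^ j) f x\<bar> \<le> C"
proof -
  obtain C where C: "C > 0" "\<And>j x. \<bar>(markov \<mu> ^^ j) f x\<bar> \<le> C * (real j + 1) powr (- D / \<beta>)"
    using markov_power_decay[OF fin] by blast
  have "\<bar>(markov \<mu> ^^ j) f x\<bar> \<le> C" for j x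
  proof (rule order_trans[OF C(2)])
    have "(real j + 1) powr (- D / \<beta>) \<le> (real j + 1) powr 0" using D by (intro powr_mono) auto
    then show "C * (real j + 1) powr (- D / \<beta>) \<le> C" using C(1) by (simp add: mult_left_le)
  qed
  then show ?thesis using that by blast
qed

text \<open>By finite propagation \<open>P^k\<close> at a vertex is a finite sum and may be
  exchanged with the series.\<close>

lemma markov_power_laplacian_power:
  assumes g: "0 < \<gamma>" "\<gamma> < 1" and fin: "finite {x. f x \<noteq> 0}"
  shows "(markov \<mu> ^^ k) (laplacian_power \<mu> \<gamma> f) x = (\<Sum>i. neg_binom (- \<gamma>) i * (markov \<mu> ^^ (k + i)) f x)"
proof -
  obtain C where C: "\<And>j x. \<bar>(markov \<mu> ^^ j) f x\<bar> \<le> C" using markov_power_bounded[OF fin] by blast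
  have lp: "(\<lambda>i. neg_binom (- \<gamma>) i * (markov \<mu> ^^ i) f y) sums laplacian_power \<mu> \<gamma> f y" for y
    unfolding laplacian_power_eq[OF g fin]
    by (rule summable_sums[OF neg_binom_summable_mult[OF g, of "\<lambda>i. (markov \<mu> ^^ i) f y" C]]) (rule C)
  have eq: "(markov \<mu> ^^ k) h x = (\<Sum>y\<in>cb x k. hk k x y * m y * h y)" for h
    using markov_power_eq[of "cb x k" x k h] finite_cb by (simp add: cb_def mult_ac)
  have "(\<lambda>i. \<Sum>y\<in>cb x k. hk k x y * m y * (neg_binom (- \<gamma>) i * (markov \<mu> ^^ i) f y)) sums
      (\<Sum>y\<in>cb x k. hk k x y * m y * laplacian_power \<mu> \<gamma> f y)"
    by (intro sums_sum sums_mult lp)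
  moreover have "(\<Sum>y\<in>cb x k. hk k x y * m y * (neg_binom (- \<gamma>) i * (markov \<mu> ^^ i) f y)) =
      neg_binom (- \<gamma>) i * (markov \<mu> ^^ (k + i)) f x" for i
    unfolding funpow_add comp_def eq[of "(markov \<mu> ^^ i) f"] sum_distrib_left
    by (rule sum.cong) (simp_all add: mult_ac)
  ultimately show ?thesis unfolding eq[of "laplacian_power \<mu> \<gamma> f"] by (simp add: sums_iff)
qed

text \<open>The explicit error at finite \<open>N\<close> matters on its own: it compares a heat
  kernel with finitely many terms when powers of the Laplacian are separated.\<close>

lemma laplacian_power_inversion_le:
  assumes g: "0 < \<gamma>" "\<gamma> < 1" and fin: "finite {x. f x \<noteq> 0}" and N: "N > 0"
    and B: "\<And>j. j \<ge> N \<Longrightarrow> \<bar>(markov \<mu> ^^ j) f x\<bar> \<le> B"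
  shows "\<bar>(\<Sum>k<N. neg_binom \<gamma> k * (markov \<mu> ^^ k) (laplacian_power \<mu> \<gamma> f) x) - f x\<bar> \<le> B"
proof -
  obtain C where C: "\<And>j x. \<bar>(markov \<mu> ^^ j) f x\<bar> \<le> C" using markov_power_bounded[OF fin] by blast
  show ?thesis
    using neg_binom_inversion[OF g, of "\<lambda>k. (markov \<mu> ^^ k) f x" C N B] C B N
    by (simp add: markov_power_laplacian_power[OF g fin])
qed

lemma laplacian_power_inversion:
  assumes g: "0 < \<gamma>" "\<gamma> < 1" and fin: "finite {x. f x \<noteq> 0}"
  shows "(\<lambda>N. \<Sum>k<N. neg_binom \<gamma> k * (markov \<mu> ^^ k) (laplacian_power \<mu> \<gamma> f) x) \<longlonglongrightarrow> f x"
proof -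
  obtain C where C: "C > 0" "\<And>j x. \<bar>(markov \<mu> ^^ j) f x\<bar> \<le> C * (real j + 1) powr (- D / \<beta>)"
    using markov_power_decay[OF fin] by blast
  have "(\<lambda>N. (\<Sum>k<N. neg_binom \<gamma> k * (markov \<mu> ^^ k) (laplacian_power \<mu> \<gamma> f) x) - f x) \<longlonglongrightarrow> 0"
  proof (rule Lim_null_comparison)
    show "\<forall>\<^sub>F N in sequentially. norm ((\<Sum>k<N. neg_binom \<gamma> k * (markov \<mu> ^^ k) (laplacian_power \<mu> \<gamma> f) x) - f x)
        \<le> C * (real N + 1) powr (- D / \<beta>)"
      using eventually_gt_at_top[of 0]
    proof eventually_elim
      case (elim N)
      have "\<bar>(markov \<mu> ^^ j) f x\<bar> \<le> C * (real N + 1) powr (- D / \<beta>)" if "j \<ge> N" for j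
      proof (rule order_trans[OF C(2)])
        show "C * (real j + 1) powr (- D / \<beta>) \<le> C * (real N + 1) powr (- D / \<beta>)"
          using that C D by (intro mult_left_mono powr_mono2') auto
      qed
      then show ?case using laplacian_power_inversion_le[OF g fin elim] by simp
    qed
    have "filterlim (\<lambda>N. real N + 1) at_top sequentially"
      using filterlim_compose[OF filterlim_real_sequentially filterlim_Suc] by (simp add: add.commute)
    then have "(\<lambda>N. (real N + 1) powr (- D / \<beta>)) \<longlonglongrightarrow> 0"
      using D by (intro tendsto_neg_powr) auto
    then show "(\<lambda>N. C * (real N + 1) powr (- D / \<beta>)) \<longlonglongrightarrow> 0"
      by (rule tendsto_mult_right_zero)
  qed
  then show ?thesis by (simp add: LIM_zero_iff)
qed

lemma R_ineq_below:
  assumes p: "p > 1" and g: "0 < \<gamma>" "\<gamma> < gamma_star D p"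
  shows "R_ineq \<mu> p \<gamma>"
proof -
  interpret Lp_weight m p using p by (rule Lp_weight_1)
  have g1: "\<gamma> < 1" using g gamma_star_bounds[OF p] by simp
  \<comment> \<open>Half of the gap, so that the exponents \<open>\<gamma> - 1\<close> of the
    coefficients and \<open>- gamma_star D p + \<epsilon>\<close> of the operators add up to
    \<open>- 1 - \<epsilon>\<close>.\<close>
  define \<epsilon> where "\<epsilon> = (gamma_star D p - \<gamma>) / 2"
  have \<epsilon>: "\<epsilon> > 0" using g by (simp add: \<epsilon>_def)
  obtain C where C: "C > 0" "\<And>k g G. Lp_le m p g G \<Longrightarrow> G \<ge> 0 \<Longrightarrow>
     Lp_le m p (nb_diff ((markov \<mu> ^^ k) g)) (C * (real k + 1) powr (- gamma_star D p + \<epsilon>) * G)"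
    using markov_power_nb_diff_lp[OF p \<epsilon>] by blast
  define z where "z k = (real k + 1) powr (- 1 - \<epsilon>)" for k :: nat
  have "summable (\<lambda>k. z k)" unfolding z_def by (rule summable_powr[OF \<epsilon>])
  moreover have "z k > 0" for k by (simp add: z_def)
  ultimately have z: "summable z" "\<And>k. z k > 0" .
  have Z: "suminf z > 0" using z suminf_pos by blast
  show ?thesis
    unfolding R_ineq_def
  proof (intro exI[of _ "C * suminf z"] conjI allI impI)
    show "C * suminf z > 0" using C Z by simp
    fix f :: "'a \<Rightarrow> real" assume fin: "finite {x. f x \<noteq> 0}"
    define G where "G = laplacian_power \<mu> \<gamma> f"
    show "Lp_norm \<mu> p (grad_length \<mu> f) \<le> ennreal (C * suminf z) * Lp_norm \<mu> p (laplacian_power \<mu> \<gamma> f)"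
      unfolding G_def[symmetric]
    proof (rule norm_ineqI[OF p])
      show "C * suminf z > 0" using C Z by simp
      fix B :: real assume B: "B > 0" and GB: "lp_le G B"
      \<comment> \<open>Partial sums of the series for \<open>\<Delta>^(-\<gamma>) G\<close>. Their
        differences are bounded uniformly in \<open>N\<close>, and only then does \<open>N\<close>
        tend to infinity.\<close>
      define T where "T N x = (\<Sum>k<N. neg_binom \<gamma> k * (markov \<mu> ^^ k) G x)" for N x
      define h where "h k x = neg_binom \<gamma> k * nb_diff ((markov \<mu> ^^ k) G) x" for k x
      have h: "lp_le (h k) (C * B * z k)" for k
      proof -
        have nn: "0 \<le> C * (real k + 1) powr (- gamma_star D p + \<epsilon>) * B" using C B by simp
        have "lp_le (h k) (\<bar>neg_binom \<gamma> k\<bar> * (C * (real k + 1) powr (- gamma_star D p + \<epsilon>) * B))"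
          unfolding h_def using GB B by (intro lp_le_cmult C(2) nn) auto
        moreover have "\<bar>neg_binom \<gamma> k\<bar> * (C * (real k + 1) powr (- gamma_star D p + \<epsilon>) * B) \<le> C * B * z k"
        proof -
          have "\<bar>neg_binom \<gamma> k\<bar> * (C * (real k + 1) powr (- gamma_star D p + \<epsilon>) * B)
            \<le> (real k + 1) powr (\<gamma> - 1) * (C * (real k + 1) powr (- gamma_star D p + \<epsilon>) * B)"
            using neg_binom_le[OF g(1) g1, of k] neg_binom_pos[OF g(1), of k] by (intro mult_right_mono nn) auto
          also have "\<dots> = C * B * ((real k + 1) powr (\<gamma> - 1) * (real k + 1) powr (- gamma_star D p + \<epsilon>))"
            by (simp only: mult_ac)
          also have "(real k + 1) powr (\<gamma> - 1) * (real k + 1) powr (- gamma_star D p + \<epsilon>) = z k"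
            unfolding powr_add[symmetric] z_def by (rule arg_cong[where f = "(powr) (real k + 1)"]) (simp add: \<epsilon>_def field_simps)
          finally show ?thesis .
        qed
        ultimately show ?thesis
          by (rule lp_le_mono[OF _ order_refl]) (use nn in simp)
      qed
      have TN: "lp_le (nb_diff (T N)) (C * suminf z * B)" for N
      proof (rule lp_le_mono)
        show "lp_le (\<lambda>x. \<Sum>k<N. h k x) (\<Sum>k<N. C * B * z k)"
          by (rule lp_le_sum) (use h C B z in auto)
        show "\<bar>nb_diff (T N) x\<bar> \<le> \<bar>\<Sum>k<N. h k x\<bar>" for x
        proof -
          have "nb_diff (T N) x = (\<Sum>y\<in>nbh x. \<bar>\<Sum>k<N. neg_binom \<gamma> k * ((markov \<mu> ^^ k) G x - (markov \<mu> ^^ k) G y)\<bar>)"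
            unfolding nb_diff_def T_def by (simp add: right_diff_distrib sum_subtractf)
          also have "\<dots> \<le> (\<Sum>y\<in>nbh x. \<Sum>k<N. neg_binom \<gamma> k * \<bar>(markov \<mu> ^^ k) G x - (markov \<mu> ^^ k) G y\<bar>)"
            using neg_binom_pos[OF g(1)]
            by (intro sum_mono order_trans[OF sum_abs]) (simp add: abs_mult less_imp_le)
          also have "\<dots> = (\<Sum>k<N. h k x)"
            by (subst sum.swap) (simp add: h_def nb_diff_def sum_distrib_left)
          finally have "nb_diff (T N) x \<le> (\<Sum>k<N. h k x)" .
          moreover have "0 \<le> nb_diff (T N) x" by (simp add: nb_diff_def sum_nonneg)
          ultimately show ?thesis by simp
        qed
        show "(\<Sum>k<N. C * B * z k) \<le> C * suminf z * B"
        proof -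
          have "(\<Sum>k<N. z k) \<le> suminf z" using z by (intro sum_le_suminf) (auto intro: less_imp_le)
          then have "C * B * (\<Sum>k<N. z k) \<le> C * B * suminf z" using C B by (intro mult_left_mono) auto
          then show ?thesis by (simp add: sum_distrib_left mult_ac)
        qed
        show "0 \<le> (\<Sum>k<N. C * B * z k)" using C B z by (intro sum_nonneg) (auto intro!: mult_nonneg_nonneg intro: less_imp_le)
      qed
      have "lp_le (nb_diff f) (C * suminf z * B)"
      proof (rule lp_le_limit[OF TN])
        fix x
        show "(\<lambda>N. nb_diff (T N) x) \<longlonglongrightarrow> nb_diff f x"
          unfolding nb_diff_def T_def G_def
          by (intro tendsto_sum tendsto_rabs tendsto_diff laplacian_power_inversion[OF g(1) g1 fin])
      qed
      then show "lp_le (grad_length \<mu> f) (C * suminf z * B)"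
        by (rule lp_le_mono[OF _ grad_length_le order_refl]) (use C Z B in simp)
    qed
  qed
qed

lemma laplacian_power_sums:
  assumes g: "0 < \<gamma>" "\<gamma> < 1" and fin: "finite {x. f x \<noteq> 0}"
  shows "(\<lambda>k. neg_binom (1 - \<gamma>) k * (markov \<mu> ^^ k) (\<lambda>x. f x - markov \<mu> f x) x) sums laplacian_power \<mu> \<gamma> f x"
proof -
  obtain C where C: "\<And>j x. \<bar>(markov \<mu> ^^ j) f x\<bar> \<le> C" using markov_power_bounded[OF fin] by blast
  have "(\<lambda>k. neg_binom (1 - \<gamma>) k * ((markov \<mu> ^^ k) f x - (markov \<mu> ^^ Suc k) f x)) sums
      (\<Sum>k. neg_binom (- \<gamma>) k * (markov \<mu> ^^ k) f x)"
    by (rule neg_binom_telescope[OF g, of "\<lambda>k. (markov \<mu> ^^ k) f x" C]) (rule C)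
  moreover have "(markov \<mu> ^^ k) (\<lambda>x. f x - markov \<mu> f x) x = (markov \<mu> ^^ k) f x - (markov \<mu> ^^ Suc k) f x" for k
    by (simp add: markov_power_diff funpow_swap1)
  ultimately show ?thesis by (simp only: laplacian_power_eq[OF g fin])
qed

text \<open>Common summation step for two sources of the bounds \<open>b k\<close>: the gradient of
  \<open>f\<close>, and the time derivative of a heat kernel.\<close>

lemma laplacian_power_lp_le:
  assumes p: "p > 1" and g: "0 < \<gamma>" "\<gamma> < 1" and fin: "finite {x. f x \<noteq> 0}"
    and h: "\<And>k. Lp_le m p ((markov \<mu> ^^ k) (\<lambda>x. f x - markov \<mu> f x)) (b k)" "\<And>k. b k \<ge> 0"
    and bz: "\<And>k. (real k + 1) powr (- \<gamma>) * b k \<le> c * z k" "\<And>k. z k > 0" "summable z" "c > 0"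
  shows "Lp_le m p (laplacian_power \<mu> \<gamma> f) (c * suminf z)"
proof -
  interpret Lp_weight m p using p by (rule Lp_weight_1)
  have "lp_le (laplacian_power \<mu> \<gamma> f) (\<Sum>k. c * z k)"
  proof (rule lp_le_suminf)
    fix k
    have "lp_le (\<lambda>x. neg_binom (1 - \<gamma>) k * (markov \<mu> ^^ k) (\<lambda>x. f x - markov \<mu> f x) x) (\<bar>neg_binom (1 - \<gamma>) k\<bar> * b k)"
      by (rule lp_le_cmult[OF h])
    then show "lp_le (\<lambda>x. neg_binom (1 - \<gamma>) k * (markov \<mu> ^^ k) (\<lambda>x. f x - markov \<mu> f x) x) (c * z k)"
    proof (rule lp_le_mono[OF _ order_refl])
      have "\<bar>neg_binom (1 - \<gamma>) k\<bar> * b k \<le> (real k + 1) powr (- \<gamma>) * b k"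
        using neg_binom_le[of "1 - \<gamma>" k] neg_binom_pos[of "1 - \<gamma>" k] g by (intro mult_right_mono h) auto
      then show "\<bar>neg_binom (1 - \<gamma>) k\<bar> * b k \<le> c * z k" using bz(1)[of k] by linarith
    qed (use h in simp)
  qed (use bz laplacian_power_sums[OF g fin] in \<open>auto intro: summable_mult\<close>)
  then show ?thesis using suminf_mult[OF bz(3), of c] by simp
qed

lemma RR_ineq_above:
  assumes p: "p > 1" and g: "gamma_star D p < \<gamma>" "\<gamma> < 1"
  shows "RR_ineq \<mu> p \<gamma>"
proof -
  have g0: "0 < \<gamma>" using g gamma_star_bounds[OF p] by simp
  define \<epsilon> where "\<epsilon> = (\<gamma> - gamma_star D p) / 2"
  have \<epsilon>: "\<epsilon> > 0" using g by (simp add: \<epsilon>_def)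
  obtain C where C: "C > 0" "\<And>k f G. Lp_le m p (grad_length \<mu> f) G \<Longrightarrow> G \<ge> 0 \<Longrightarrow>
     Lp_le m p ((markov \<mu> ^^ k) (\<lambda>x. f x - markov \<mu> f x)) (C * (real k + 1) powr (gamma_star D p - 1 + \<epsilon>) * G)"
    using markov_power_laplacian_grad_lp[OF p \<epsilon>] by blast
  define z where "z k = (real k + 1) powr (- 1 - \<epsilon>)" for k :: nat
  have "summable (\<lambda>k. z k)" unfolding z_def by (rule summable_powr[OF \<epsilon>])
  moreover have "z k > 0" for k by (simp add: z_def)
  ultimately have z: "summable z" "\<And>k. z k > 0" .
  have Z: "suminf z > 0" using z suminf_pos by blast
  show ?thesis
    unfolding RR_ineq_def
  proof (intro exI[of _ "C * suminf z"] conjI allI impI)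
    show CZ: "C * suminf z > 0" using C Z by simp
    fix f :: "'a \<Rightarrow> real" assume fin: "finite {x. f x \<noteq> 0}"
    show "Lp_norm \<mu> p (laplacian_power \<mu> \<gamma> f) \<le> ennreal (C * suminf z) * Lp_norm \<mu> p (grad_length \<mu> f)"
    proof (rule norm_ineqI[OF p CZ])
      fix B :: real assume B: "B > 0" and fB: "Lp_le m p (grad_length \<mu> f) B"
      have "Lp_le m p (laplacian_power \<mu> \<gamma> f) ((C * B) * suminf z)"
      proof (rule laplacian_power_lp_le[OF p g0 g(2) fin C(2)[OF fB]])
        fix k
        have "(real k + 1) powr (- \<gamma>) * (C * (real k + 1) powr (gamma_star D p - 1 + \<epsilon>) * B)
          = C * B * ((real k + 1) powr (- \<gamma>) * (real k + 1) powr (gamma_star D p - 1 + \<epsilon>))"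
          by (simp only: mult_ac)
        also have "(real k + 1) powr (- \<gamma>) * (real k + 1) powr (gamma_star D p - 1 + \<epsilon>) = z k"
          unfolding powr_add[symmetric] z_def by (rule arg_cong[where f = "(powr) (real k + 1)"]) (simp add: \<epsilon>_def field_simps)
        finally show "(real k + 1) powr (- \<gamma>) * (C * (real k + 1) powr (gamma_star D p - 1 + \<epsilon>) * B) \<le> C * B * z k"
          by (rule eq_refl)
      qed (use B C z in auto)
      then show "Lp_le m p (laplacian_power \<mu> \<gamma> f) (C * suminf z * B)" by (simp only: mult_ac)
    qed
  qed
qed

end

section \<open>Powers of the Laplacian are not comparable\<close>

context vicsek
begin

lemma markov_power_hk: "(markov \<mu> ^^ j) (\<lambda>x. hk k x w) = (\<lambda>x. hk (j + k) x w)"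
proof (induction j)
  case (Suc j)
  then show ?case by (simp add: hk_Suc[abs_def])
qed simp

text \<open>Analyticity of the semigroup on \<open>L^p\<close> up to \<open>\<epsilon>\<close>. The
  kernel \<open>hkd\<close> is symmetric, so its zeroth moment bounds both Schur sums.\<close>

lemma markov_power_laplacian_lp:
  assumes p: "p > 1" and \<epsilon>: "\<epsilon> > 0"
  obtains C where "C > 0" "\<And>k g G. Lp_le m p g G \<Longrightarrow> G \<ge> 0 \<Longrightarrow>
     Lp_le m p ((markov \<mu> ^^ k) (\<lambda>x. g x - markov \<mu> g x)) (C * (real k + 1) powr (- 1 + \<epsilon>) * G)"
proof -
  obtain C0 where C0: "C0 > 0"
    "\<And>k w F. finite F \<Longrightarrow> (\<Sum>z\<in>F. hkd k z w * real (gd w z) ^ 0 * m z) \<le> C0 * (real k + 1) powr (real 0 / \<beta> - 1 + \<epsilon>)"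
    using hkd_moment[OF \<epsilon>, of 0] by blast
  then have C: "\<And>k w F. finite F \<Longrightarrow> (\<Sum>z\<in>F. hkd k z w * m z) \<le> C0 * (real k + 1) powr (- 1 + \<epsilon>)"
    by simp
  have "Lp_le m p ((markov \<mu> ^^ k) (\<lambda>x. g x - markov \<mu> g x))
      (C0 powr (1 - 1 / p) * C0 powr (1 / p) * (real k + 1) powr ((- 1 + \<epsilon>) * (1 - 1 / p) + (- 1 + \<epsilon>) * (1 / p)) * G)"
    if g: "Lp_le m p g G" "G \<ge> 0" for k g G
  proof (rule schur_powr[OF p C0(1) C0(1) hkd_nonneg _ C g])
    show "(\<Sum>w\<in>S. hkd k x w * m w) \<le> C0 * (real k + 1) powr (- 1 + \<epsilon>)" if "finite S" for x S
      using C[OF that, of k x] by (simp only: hkd_sym[of k x])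
    fix x
    define S where "S = cb x (Suc k)"
    have S: "finite S" by (simp add: S_def finite_cb)
    have "(markov \<mu> ^^ k) (\<lambda>x. g x - markov \<mu> g x) x = (markov \<mu> ^^ k) g x - (markov \<mu> ^^ Suc k) g x"
      by (simp add: markov_power_diff funpow_swap1)
    also have "\<dots> = (\<Sum>w\<in>S. hk k x w * g w * m w) - (\<Sum>w\<in>S. hk (Suc k) x w * g w * m w)"
      using markov_power_eq[OF S, of x k g] markov_power_eq[OF S, of x "Suc k" g] by (simp add: S_def cb_def)
    also have "\<dots> = (\<Sum>w\<in>S. (hk k x w - hk (Suc k) x w) * g w * m w)"
      by (simp add: left_diff_distrib sum_subtractf)
    also have "\<bar>\<dots>\<bar> \<le> (\<Sum>w\<in>S. hkd k x w * \<bar>g w\<bar> * m w)"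
      by (rule order_trans[OF sum_abs]) (simp add: abs_mult m_nonneg hkd_def)
    finally show "\<exists>S. finite S \<and> \<bar>(markov \<mu> ^^ k) (\<lambda>x. g x - markov \<mu> g x) x\<bar> \<le> (\<Sum>w\<in>S. hkd k x w * \<bar>g w\<bar> * m w)"
      using S by blast
  qed
  moreover have "(- 1 + \<epsilon>) * (1 - 1 / p) + (- 1 + \<epsilon>) * (1 / p) = - 1 + \<epsilon>"
    by (simp only: distrib_left[symmetric]) simp
  moreover have "C0 powr (1 - 1 / p) * C0 powr (1 / p) = C0" using C0 by (simp flip: powr_add)
  ultimately show ?thesis using that[of C0] C0(1) by simp
qed

text \<open>Interpolation between the supremum bound and total mass at most 1.\<close>

lemma hk_lp_le:
  assumes p: "p > 1"
  obtains C where "C > 0" "\<And>k w. Lp_le m p (\<lambda>x. hk k x w) (C * (real k + 1) powr (- D / \<beta> * (1 - 1 / p)))"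
proof -
  obtain C3 where C3: "C3 > 0" "\<And>k x y. hk k x y \<le> C3 * (real k + 1) powr (- D / \<beta>)" using hk_le by blast
  have "Lp_le m p (\<lambda>x. hk k x w) (C3 powr (1 - 1 / p) * (real k + 1) powr (- D / \<beta> * (1 - 1 / p)))" for k w
    unfolding Lp_le_def
  proof (intro allI impI)
    fix F :: "'a set" assume F: "finite F"
    define s where "s = C3 * (real k + 1) powr (- D / \<beta>)"
    have s: "s > 0" using C3 by (simp add: s_def)
    have "(\<Sum>x\<in>F. \<bar>hk k x w\<bar> powr p * m x) \<le> (\<Sum>x\<in>F. s powr (p - 1) * (hk k w x * m x))"
    proof (rule sum_mono)
      fix x
      have "hk k x w powr p = hk k x w powr (p - 1) * hk k x w"
        using hk_nonneg[of k x w] by (cases "hk k x w = 0") (auto simp: powr_diff)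
      also have "\<dots> \<le> s powr (p - 1) * hk k x w"
        using C3(2) p hk_nonneg by (intro mult_right_mono powr_mono2) (auto simp: s_def)
      finally have "hk k x w powr p * m x \<le> s powr (p - 1) * hk k x w * m x"
        by (rule mult_right_mono[OF _ m_nonneg])
      then show "\<bar>hk k x w\<bar> powr p * m x \<le> s powr (p - 1) * (hk k w x * m x)"
        by (simp add: hk_nonneg hk_sym[of k w] mult.assoc)
    qed
    also have "\<dots> = s powr (p - 1) * (\<Sum>x\<in>F. hk k w x * m x)" by (simp only: sum_distrib_left)
    also have "\<dots> \<le> s powr (p - 1) * 1" by (intro mult_left_mono sum_hk_le F) auto
    also have "\<dots> = (s powr (1 - 1 / p)) powr p"
    proof -
      have "(1 - 1 / p) * p = p - 1" using p by (simp add: field_simps)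
      then show ?thesis by (simp only: powr_powr mult_1_right)
    qed
    also have "s powr (1 - 1 / p) = C3 powr (1 - 1 / p) * (real k + 1) powr (- D / \<beta> * (1 - 1 / p))"
      using C3 by (simp only: s_def powr_mult powr_powr)
    finally show "(\<Sum>x\<in>F. \<bar>hk k x w\<bar> powr p * m x) \<le> (C3 powr (1 - 1 / p) * (real k + 1) powr (- D / \<beta> * (1 - 1 / p))) powr p" .
  qed
  then show ?thesis using that[of "C3 powr (1 - 1 / p)"] C3 by simp
qed

text \<open>Half of the time \<open>2 * N\<close> is kept for the \<open>L^p\<close> norm of
  \<open>hk N\<close>; the other half joins the \<open>k\<close> steps of the series. The operator
  decay at \<open>k + N\<close> is then shared between a gain of almost
  \<open>N powr (- \<gamma>)\<close> and what makes the series converge.\<close>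

lemma laplacian_power_hk_lp_le:
  assumes p: "p > 1" and g: "0 < \<gamma>" "\<gamma> < 1" and e: "e > 0" "2 * e \<le> \<gamma>"
  obtains C where "C > 0" "\<And>N w. Lp_le m p (laplacian_power \<mu> \<gamma> (\<lambda>x. hk (2 * N) x w))
     (C * (real N + 1) powr (- (\<gamma> - 2 * e + D / \<beta> * (1 - 1 / p))))"
proof -
  obtain C1 where C1: "C1 > 0" "\<And>k g G. Lp_le m p g G \<Longrightarrow> G \<ge> 0 \<Longrightarrow>
     Lp_le m p ((markov \<mu> ^^ k) (\<lambda>x. g x - markov \<mu> g x)) (C1 * (real k + 1) powr (- 1 + e) * G)"
    using markov_power_laplacian_lp[OF p e(1)] by blast
  obtain C2 where C2: "C2 > 0" "\<And>k w. Lp_le m p (\<lambda>x. hk k x w) (C2 * (real k + 1) powr (- D / \<beta> * (1 - 1 / p)))"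
    using hk_lp_le[OF p] by blast
  define z where "z k = (real k + 1) powr (- 1 - e)" for k :: nat
  have "summable (\<lambda>k. z k)" unfolding z_def by (rule summable_powr[OF e(1)])
  moreover have "z k > 0" for k by (simp add: z_def)
  ultimately have z: "summable z" "\<And>k. z k > 0" .
  have Z: "suminf z > 0" using z suminf_pos by blast
  have "Lp_le m p (laplacian_power \<mu> \<gamma> (\<lambda>x. hk (2 * N) x w))
     (C1 * C2 * suminf z * (real N + 1) powr (- (\<gamma> - 2 * e + D / \<beta> * (1 - 1 / p))))" for N w
  proof -
    define n where "n = real N + 1"
    have n: "n \<ge> 1" by (simp add: n_def)
    define G where "G = C2 * n powr (- D / \<beta> * (1 - 1 / p))"
    have G: "G > 0" using C2 by (simp add: G_def n_def)
    have "Lp_le m p (laplacian_power \<mu> \<gamma> (\<lambda>x. hk (2 * N) x w)) ((C1 * G * n powr (- (\<gamma> - 2 * e))) * suminf z)"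
    proof (rule laplacian_power_lp_le[OF p g finite_support_hk])
      fix k
      have eq: "(markov \<mu> ^^ k) (\<lambda>x. hk (2 * N) x w - markov \<mu> (\<lambda>x. hk (2 * N) x w) x) =
          (markov \<mu> ^^ (k + N)) (\<lambda>x. hk N x w - markov \<mu> (\<lambda>x. hk N x w) x)"
        unfolding hk_Suc by (simp add: markov_power_diff markov_power_hk mult_2 add_ac)
      show "Lp_le m p ((markov \<mu> ^^ k) (\<lambda>x. hk (2 * N) x w - markov \<mu> (\<lambda>x. hk (2 * N) x w) x))
          (C1 * (real (k + N) + 1) powr (- 1 + e) * G)"
        unfolding eq by (rule C1(2)) (use C2(2)[of N w] G in \<open>auto simp: G_def n_def\<close>)
      show "0 \<le> C1 * (real (k + N) + 1) powr (- 1 + e) * G" using C1 G by simp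
      have "(real (k + N) + 1) powr (- 1 + e) = (real (k + N) + 1) powr (- (\<gamma> - 2 * e)) * (real (k + N) + 1) powr (- (1 - \<gamma> + e))"
        unfolding powr_add[symmetric] by (rule arg_cong[where f = "(powr) (real (k + N) + 1)"]) simp
      also have "\<dots> \<le> n powr (- (\<gamma> - 2 * e)) * (real k + 1) powr (- (1 - \<gamma> + e))"
        using e g by (intro mult_mono powr_mono2') (auto simp: n_def)
      finally have le: "(real (k + N) + 1) powr (- 1 + e) \<le> n powr (- (\<gamma> - 2 * e)) * (real k + 1) powr (- (1 - \<gamma> + e))" .
      have "(real k + 1) powr (- \<gamma>) * (C1 * (real (k + N) + 1) powr (- 1 + e) * G) \<le>
          (real k + 1) powr (- \<gamma>) * (C1 * (n powr (- (\<gamma> - 2 * e)) * (real k + 1) powr (- (1 - \<gamma> + e))) * G)"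
        using C1 G le by (intro mult_left_mono mult_right_mono) auto
      also have "\<dots> = C1 * G * n powr (- (\<gamma> - 2 * e)) * ((real k + 1) powr (- \<gamma>) * (real k + 1) powr (- (1 - \<gamma> + e)))"
        by (simp only: mult_ac)
      also have "(real k + 1) powr (- \<gamma>) * (real k + 1) powr (- (1 - \<gamma> + e)) = z k"
        unfolding powr_add[symmetric] z_def by (rule arg_cong[where f = "(powr) (real k + 1)"]) simp
      finally show "(real k + 1) powr (- \<gamma>) * (C1 * (real (k + N) + 1) powr (- 1 + e) * G) \<le> C1 * G * n powr (- (\<gamma> - 2 * e)) * z k" .
    qed (use z C1 G in \<open>auto simp: n_def\<close>)
    also have "(C1 * G * n powr (- (\<gamma> - 2 * e))) * suminf z =
        C1 * C2 * suminf z * (n powr (- (\<gamma> - 2 * e)) * n powr (- D / \<beta> * (1 - 1 / p)))"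
      unfolding G_def by (simp only: mult_ac)
    also have "n powr (- (\<gamma> - 2 * e)) * n powr (- D / \<beta> * (1 - 1 / p)) = n powr (- (\<gamma> - 2 * e + D / \<beta> * (1 - 1 / p)))"
      unfolding powr_add[symmetric] by (rule arg_cong[where f = "(powr) n"]) simp
    finally show ?thesis by (simp only: n_def)
  qed
  then show ?thesis using that[of "C1 * C2 * suminf z"] C1 C2 Z by simp
qed

text \<open>Within the \<open>k\<close> steps of the walk the volume is at most of order
  \<open>n powr D\<close>, so a tail of exponent \<open>D + 1\<close> carries mass of order
  \<open>1 / n\<close>.\<close>

lemma hk_mass_ball:
  assumes e: "e > 0"
  obtains C where "C > 0"
    "\<And>k w r A. r = (real k + 1) powr (1 / \<beta> + e) \<Longrightarrow> A = {z. real (gd w z) \<le> r} \<Longrightarrow>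
       1 - C / (real k + 1) \<le> (\<Sum>z\<in>A. hk k z w * m z)"
proof -
  define a where "a = 1 / \<beta> + e"
  have a: "a > 0" using e D by (simp add: a_def add_pos_pos)
  obtain C2 where C2: "C2 > 0" "\<And>A x r. finite A \<Longrightarrow> (\<And>y. y \<in> A \<Longrightarrow> real (gd x y) \<le> r) \<Longrightarrow> r \<ge> 1 \<Longrightarrow> sum m A \<le> C2 * r powr D"
    using ball_mass_le by blast
  obtain C4 where C4: "C4 > 0" "\<And>k x y. real (gd x y) \<ge> (real k + 1) powr a \<Longrightarrow> hk k x y \<le> C4 * (real k + 1) powr (- (D + 1))"
    using hk_tail[OF e, of "D + 1"] unfolding a_def by blast
  have "1 - C4 * C2 / (real k + 1) \<le> (\<Sum>z\<in>A. hk k z w * m z)"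
    if r: "r = (real k + 1) powr a" and A: "A = {z. real (gd w z) \<le> r}" for k w r A
  proof -
    define n where "n = real k + 1"
    have n: "n \<ge> 1" by (simp add: n_def)
    define B where "B = cb w k - A"
    have finA: "finite A"
      by (rule finite_subset[OF _ finite_cb[of w "nat \<lceil>r\<rceil>"]]) (auto simp: A cb_def, linarith)
    have finB: "finite B" by (simp add: B_def finite_cb)
    have "1 = (\<Sum>z\<in>A \<union> B. hk k w z * m z)"
      by (rule sum_hk[symmetric]) (use finA finB in \<open>auto simp: B_def\<close>)
    also have "\<dots> = (\<Sum>z\<in>A. hk k w z * m z) + (\<Sum>z\<in>B. hk k w z * m z)"
      by (rule sum.union_disjoint) (use finA finB in \<open>auto simp: B_def\<close>)
    also have "(\<Sum>z\<in>B. hk k w z * m z) \<le> C4 * C2 / n"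
    proof -
      have "(\<Sum>z\<in>B. hk k w z * m z) \<le> (\<Sum>z\<in>B. C4 * n powr (- (D + 1)) * m z)"
        using C4(2) by (intro sum_mono mult_right_mono m_nonneg) (auto simp: B_def A r n_def)
      also have "\<dots> = C4 * n powr (- (D + 1)) * sum m B" by (simp only: sum_distrib_left)
      also have "\<dots> \<le> C4 * n powr (- (D + 1)) * (C2 * n powr D)"
        using C4 finB n by (intro mult_left_mono C2(2)[of _ w]) (auto simp: B_def cb_def n_def)
      also have "\<dots> = C4 * C2 * (n powr (- (D + 1)) * n powr D)" by (simp only: mult_ac)
      also have "n powr (- (D + 1)) * n powr D = n powr (- 1)"
        unfolding powr_add[symmetric] by (rule arg_cong[where f = "(powr) n"]) simp
      finally show ?thesis using n by (simp add: powr_minus divide_inverse)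
    qed
    finally show ?thesis by (simp add: hk_sym[of k w] n_def)
  qed
  then show ?thesis using that[of "C4 * C2"] C2 C4 unfolding a_def by simp
qed

text \<open>The test functions are \<open>hk (2 N)\<close>. On a ball of radius slightly above \<open>N powr (1 / \<beta>)\<close>,
  which carries most of its mass, such a function is up to a small error the sum of the first
  \<open>M\<close> terms of the series for \<open>\<Delta>\<^sup>-\<^sup>\<gamma> (\<Delta>\<^sup>\<gamma> hk)\<close>, where \<open>M\<close> is slightly larger than \<open>N\<close>.\<close>

lemma laplacian_powers_not_comparable:
  assumes p: "p > 1" and g: "0 < \<gamma>" "\<gamma> < \<gamma>'" "\<gamma>' < 1" and K: "K > 0"
  shows "\<not> (\<forall>f. finite {x. f x \<noteq> 0} \<longrightarrow>
    Lp_norm \<mu> p (laplacian_power \<mu> \<gamma> f) \<le> ennreal K * Lp_norm \<mu> p (laplacian_power \<mu> \<gamma>' f))"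
proof
  assume comp: "\<forall>f. finite {x. f x \<noteq> 0} \<longrightarrow>
    Lp_norm \<mu> p (laplacian_power \<mu> \<gamma> f) \<le> ennreal K * Lp_norm \<mu> p (laplacian_power \<mu> \<gamma>' f)"
  interpret Lp_weight m p using p by (rule Lp_weight_1)
  have g1: "\<gamma> < 1" using g by simp
  \<comment> \<open>Small enough that all losses in the final exponent, at most
    \<open>e * (3 + 2 * \<beta> + D)\<close>, use up only half of the gap between
    \<open>\<gamma>\<close> and \<open>\<gamma>'\<close>.\<close>
  define e where "e = (\<gamma>' - \<gamma>) / (2 * (3 + 2 * \<beta> + D))"
  define q where "q = 1 - 1 / p"
  define \<delta> where "\<delta> = D / \<beta> * q"
  define a where "a = 1 / \<beta> + e"
  define \<theta> where "\<theta> = (\<gamma>' - \<gamma>) / 2"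
  have e: "e > 0" using g D by (auto simp: e_def intro!: divide_pos_pos)
  have eD: "e * (3 + 2 * \<beta> + D) = \<theta>" using D by (simp add: e_def \<theta>_def field_simps)
  have \<theta>: "\<theta> > 0" using g by (simp add: \<theta>_def)
  have e\<theta>: "8 * e \<le> \<theta>" unfolding eD[symmetric] using e D by (simp add: mult.commute)
  have e1: "e \<le> 1" "2 * e \<le> \<gamma>'" using e\<theta> g by (auto simp: \<theta>_def field_simps)
  have q: "0 < q" "q \<le> 1" using p by (auto simp: q_def)
  have aD: "a * D = D / \<beta> + D * e" by (simp add: a_def distrib_right)
  have a: "a > 0" using e D by (simp add: a_def add_pos_pos)
  obtain C1 where C1: "C1 > 0" "\<And>N w. lp_le (laplacian_power \<mu> \<gamma>' (\<lambda>x. hk (2 * N) x w))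
     (C1 * (real N + 1) powr (- (\<gamma>' - 2 * e + D / \<beta> * (1 - 1 / p))))"
    using laplacian_power_hk_lp_le[OF p _ g(3) e e1(2)] g by auto
  obtain C2 where C2: "C2 > 0" "\<And>A x r. finite A \<Longrightarrow> (\<And>y. y \<in> A \<Longrightarrow> real (gd x y) \<le> r) \<Longrightarrow> r \<ge> 1 \<Longrightarrow> sum m A \<le> C2 * r powr D"
    using ball_mass_le by blast
  obtain C3 where C3: "C3 > 0" "\<And>k x y. hk k x y \<le> C3 * (real k + 1) powr (- D / \<beta>)" using hk_le by blast
  obtain C4 where C4: "C4 > 0" "\<And>k w r A. r = (real k + 1) powr (1 / \<beta> + e) \<Longrightarrow> A = {z. real (gd w z) \<le> r} \<Longrightarrow>
       1 - C4 / (real k + 1) \<le> (\<Sum>z\<in>A. hk k z w * m z)"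
    using hk_mass_ball[OF e] by blast
  define z where "z k = (real k + 1) powr (- 1 - e)" for k :: nat
  have "summable (\<lambda>k. z k)" unfolding z_def by (rule summable_powr[OF e(1)])
  moreover have "z k > 0" for k by (simp add: z_def)
  ultimately have z: "summable z" "\<And>k. z k > 0" .
  define Z where "Z = suminf z"
  have Z: "Z > 0" unfolding Z_def using z suminf_pos by blast
  \<comment> \<open>\<open>H\<close> makes the constant in the decay of \<open>P^j h\<close> for
    \<open>j \<ge> M\<close> at most \<open>1 / (4 * C2)\<close>, with \<open>C2\<close> the volume
    constant.\<close>
  define H where "H = max 1 ((4 * C3 * C2) powr (\<beta> / D))"
  have H: "H \<ge> 1" "4 * C3 * C2 \<le> H powr (D / \<beta>)"
  proof -
    show "H \<ge> 1" by (simp add: H_def)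
    have "4 * C3 * C2 = ((4 * C3 * C2) powr (\<beta> / D)) powr (D / \<beta>)"
      using C3 C2 D by (simp add: powr_powr)
    also have "\<dots> \<le> H powr (D / \<beta>)" using D by (intro powr_mono2) (auto simp: H_def)
    finally show "4 * C3 * C2 \<le> H powr (D / \<beta>)" .
  qed
  define Q where "Q = Z * (2 * H) powr (\<gamma> + e) * (K * (C1 * 2 powr (\<gamma>' - 2 * e + \<delta>))) * C2 powr q"
  have main: "1 / 4 \<le> Q * (2 * real N + 1) powr (- \<theta>)" if N: "2 * real N + 1 \<ge> 2 * C4" for N
  proof -
    define w :: 'a where "w = undefined"
    define x where "x = 2 * real N + 1"
    have x: "x \<ge> 1" by (simp add: x_def)
    define h where "h = (\<lambda>y. hk (2 * N) y w)"
    have fin: "finite {y. h y \<noteq> 0}" unfolding h_def by (rule finite_support_hk)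
    define L where "L = K * (C1 * (real N + 1) powr (- (\<gamma>' - 2 * e + \<delta>)))"
    have L: "L > 0" using K C1 by (simp add: L_def)
    define G where "G = laplacian_power \<mu> \<gamma> h"
    have GL: "lp_le G L"
      unfolding G_def L_def
    proof (rule norm_ineqD[OF p K])
      show "Lp_norm \<mu> p (laplacian_power \<mu> \<gamma> h) \<le> ennreal K * Lp_norm \<mu> p (laplacian_power \<mu> \<gamma>' h)"
        using comp fin by blast
      show "lp_le (laplacian_power \<mu> \<gamma>' h) (C1 * (real N + 1) powr (- (\<gamma>' - 2 * e + \<delta>)))"
        using C1(2)[of N w] by (simp only: h_def \<delta>_def q_def)
    qed (use C1 in simp)
    define r where "r = x powr a"
    have r: "r \<ge> 1" using x a by (simp add: r_def ge_one_powr_ge_zero)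
    define A where "A = {y. real (gd w y) \<le> r}"
    have finA: "finite A"
      by (rule finite_subset[OF _ finite_cb[of w "nat \<lceil>r\<rceil>"]]) (auto simp: A_def cb_def, linarith)
    have mA: "sum m A \<le> C2 * x powr (a * D)"
      using C2(2)[OF finA, of w r] r by (simp add: A_def r_def powr_powr)
    have mass: "1 / 2 \<le> (\<Sum>y\<in>A. h y * m y)"
    proof -
      have "C4 / x \<le> 1 / 2" using N x by (simp add: x_def field_simps)
      moreover have "1 - C4 / x \<le> (\<Sum>y\<in>A. h y * m y)"
        using C4(2)[of r "2 * N" A w] by (simp add: h_def x_def r_def A_def a_def)
      ultimately show ?thesis by simp
    qed
    \<comment> \<open>The exponent matches time and ball:
      \<open>(x powr (1 + \<beta> * e)) powr (- D / \<beta>)\<close> is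
      \<open>x powr (- (a * D))\<close>, the reciprocal of the volume scale of
      \<open>A\<close>.\<close>
    define M where "M = nat \<lceil>H * x powr (1 + \<beta> * e)\<rceil>"
    have xe: "x powr (1 + \<beta> * e) \<ge> 1" using x e D by (intro ge_one_powr_ge_zero) auto
    have Hx: "H * x powr (1 + \<beta> * e) \<ge> 1" using mult_mono[OF H(1) xe] H(1) by simp
    then have M: "H * x powr (1 + \<beta> * e) \<le> real M" "real M \<le> 2 * H * x powr (1 + \<beta> * e)"
      unfolding M_def by linarith+
    have M0: "M > 0" using M Hx by (cases M) auto
    \<comment> \<open>A pointwise error of this size integrates to at most \<open>1 / 4\<close> over
      \<open>A\<close>, half of the mass that \<open>h\<close> has there.\<close>
    define \<tau> where "\<tau> = 1 / (4 * C2) * x powr (- (a * D))"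
    have small: "\<bar>(markov \<mu> ^^ j) h y\<bar> \<le> \<tau>" if j: "j \<ge> M" for j y
    proof -
      have "(markov \<mu> ^^ j) h y = hk (j + 2 * N) y w" unfolding h_def markov_power_hk ..
      also have "\<dots> \<le> C3 * (real (j + 2 * N) + 1) powr (- D / \<beta>)" by (rule C3)
      also have "\<dots> \<le> C3 * (H * x powr (1 + \<beta> * e)) powr (- D / \<beta>)"
        using C3 D H x M(1) j Hx by (intro mult_left_mono powr_mono2') auto
      also have "\<dots> = C3 / H powr (D / \<beta>) * x powr (- (a * D))"
      proof -
        have "(1 + \<beta> * e) * (- D / \<beta>) = - (a * D)" using D unfolding aD by (simp add: field_simps)
        then have "(x powr (1 + \<beta> * e)) powr (- D / \<beta>) = x powr (- (a * D))" by (simp only: powr_powr)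
        then show ?thesis using H x by (simp add: powr_mult powr_minus divide_inverse)
      qed
      also have "\<dots> \<le> C3 / (4 * C3 * C2) * x powr (- (a * D))"
        using H C3(1) C2(1) by (intro mult_right_mono divide_left_mono[OF H(2)] mult_pos_pos) auto
      also have "\<dots> = \<tau>" using C3 by (simp add: \<tau>_def)
      finally have "(markov \<mu> ^^ j) h y \<le> \<tau>" .
      moreover have "(markov \<mu> ^^ j) h y \<ge> 0" unfolding h_def markov_power_hk by (rule hk_nonneg)
      ultimately show ?thesis by simp
    qed
    define T where "T y = (\<Sum>k<M. neg_binom \<gamma> k * (markov \<mu> ^^ k) G y)" for y
    have Th: "\<bar>T y - h y\<bar> \<le> \<tau>" for y
      unfolding T_def G_def by (rule laplacian_power_inversion_le[OF g(1) g1 fin M0]) (rule small)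
    have "1 / 4 \<le> (\<Sum>y\<in>A. \<bar>T y\<bar> * m y)"
    proof -
      have "(\<Sum>y\<in>A. h y * m y) \<le> (\<Sum>y\<in>A. \<bar>T y\<bar> * m y + \<tau> * m y)"
        unfolding distrib_right[symmetric]
      proof (intro sum_mono mult_right_mono m_nonneg)
        show "h y \<le> \<bar>T y\<bar> + \<tau>" for y using Th[of y] by linarith
      qed
      also have "\<dots> = (\<Sum>y\<in>A. \<bar>T y\<bar> * m y) + \<tau> * sum m A" by (simp add: sum.distrib sum_distrib_left)
      also have "\<tau> * sum m A \<le> \<tau> * (C2 * x powr (a * D))"
        using mA C2 by (intro mult_left_mono) (auto simp: \<tau>_def)
      also have "\<dots> = 1 / 4" using C2 x by (simp add: \<tau>_def powr_minus)
      finally show ?thesis using mass by simp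
    qed
    \<comment> \<open>Hoelder's inequality on \<open>A\<close>. Since \<open>P\<close> contracts the
      norm, \<open>T\<close> costs only the sum of its coefficients.\<close>
    also have "\<dots> \<le> (Z * real M powr (\<gamma> + e) * L) * sum m A powr q"
      unfolding q_def
    proof (rule sum_le_lp[OF _ _ finA])
      have "lp_le T (\<Sum>k<M. neg_binom \<gamma> k * L)"
        unfolding T_def
      proof (rule lp_le_sum)
        fix k
        have "lp_le ((markov \<mu> ^^ k) G) L"
          using GL L p by (induction k) (auto intro: markov_lp_le)
        from lp_le_cmult[OF this, of "neg_binom \<gamma> k"]
        show "lp_le (\<lambda>y. neg_binom \<gamma> k * (markov \<mu> ^^ k) G y) (neg_binom \<gamma> k * L)"
          using L neg_binom_pos[OF g(1), of k] by simp
      qed (use L neg_binom_pos[OF g(1)] in auto)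
      then show "lp_le T (Z * real M powr (\<gamma> + e) * L)"
      proof (rule lp_le_mono[OF _ order_refl])
        \<comment> \<open>The sum has order \<open>M powr \<gamma>\<close>; spending
          \<open>e\<close> reduces it to the summable \<open>z\<close>.\<close>
        have "(\<Sum>k<M. neg_binom \<gamma> k) \<le> (\<Sum>k<M. real M powr (\<gamma> + e) * z k)"
        proof (rule sum_mono)
          fix k assume k: "k \<in> {..<M}"
          have "neg_binom \<gamma> k \<le> (real k + 1) powr (\<gamma> - 1)" by (rule neg_binom_le[OF g(1) g1])
          also have "\<dots> = (real k + 1) powr (\<gamma> + e) * z k"
            unfolding z_def powr_add[symmetric] by (rule arg_cong[where f = "(powr) (real k + 1)"]) simp
          also have "\<dots> \<le> real M powr (\<gamma> + e) * z k"
            using k g(1) e z(2)[of k] by (intro mult_right_mono powr_mono2) (auto intro: less_imp_le)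
          finally show "neg_binom \<gamma> k \<le> real M powr (\<gamma> + e) * z k" .
        qed
        also have "\<dots> = real M powr (\<gamma> + e) * (\<Sum>k<M. z k)" by (simp only: sum_distrib_left)
        also have "\<dots> \<le> real M powr (\<gamma> + e) * Z"
          unfolding Z_def using z by (intro mult_left_mono sum_le_suminf) (auto intro: less_imp_le)
        finally have "(\<Sum>k<M. neg_binom \<gamma> k) * L \<le> real M powr (\<gamma> + e) * Z * L"
          using L by (intro mult_right_mono) auto
        then show "(\<Sum>k<M. neg_binom \<gamma> k * L) \<le> Z * real M powr (\<gamma> + e) * L"
          unfolding sum_distrib_right[symmetric] by (simp only: mult_ac)
        show "0 \<le> (\<Sum>k<M. neg_binom \<gamma> k * L)"
          using L neg_binom_pos[OF g(1)] by (intro sum_nonneg mult_nonneg_nonneg) (auto intro: less_imp_le)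
      qed
    qed (use Z L in simp)
    also have "\<dots> \<le> (Z * ((2 * H) powr (\<gamma> + e) * x powr ((1 + \<beta> * e) * (\<gamma> + e))) *
        (K * (C1 * (2 powr (\<gamma>' - 2 * e + \<delta>) * x powr (- (\<gamma>' - 2 * e + \<delta>)))))) * (C2 powr q * x powr (a * D * q))"
    proof (intro mult_mono)
      have "real M powr (\<gamma> + e) \<le> (2 * H * x powr (1 + \<beta> * e)) powr (\<gamma> + e)"
        using M g(1) e by (intro powr_mono2) auto
      then show "real M powr (\<gamma> + e) \<le> (2 * H) powr (\<gamma> + e) * x powr ((1 + \<beta> * e) * (\<gamma> + e))"
        using H by (simp add: powr_mult powr_powr)
      show "L \<le> K * (C1 * (2 powr (\<gamma>' - 2 * e + \<delta>) * x powr (- (\<gamma>' - 2 * e + \<delta>))))"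
        unfolding L_def
      proof (intro mult_left_mono)
        have s: "0 \<le> \<gamma>' - 2 * e + \<delta>" using e1 q D by (simp add: \<delta>_def)
        have "(real N + 1) powr (- (\<gamma>' - 2 * e + \<delta>)) \<le> (x / 2) powr (- (\<gamma>' - 2 * e + \<delta>))"
          using s x by (intro powr_mono2') (auto simp: x_def)
        also have "\<dots> = 2 powr (\<gamma>' - 2 * e + \<delta>) * x powr (- (\<gamma>' - 2 * e + \<delta>))"
        proof -
          have "(x / 2) powr (- s) = 2 powr s * x powr (- s)" for s :: real
            using x by (simp add: powr_divide powr_minus field_simps)
          then show ?thesis .
        qed
        finally show "(real N + 1) powr (- (\<gamma>' - 2 * e + \<delta>)) \<le> 2 powr (\<gamma>' - 2 * e + \<delta>) * x powr (- (\<gamma>' - 2 * e + \<delta>))" .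
      qed (use K C1 in auto)
      have "sum m A powr q \<le> (C2 * x powr (a * D)) powr q"
        using mA q by (intro powr_mono2 sum_nonneg m_nonneg) auto
      then show "sum m A powr q \<le> C2 powr q * x powr (a * D * q)" using C2 by (simp add: powr_mult powr_powr)
    qed (use Z L H K C1 in auto)
    also have "\<dots> = Q * (x powr ((1 + \<beta> * e) * (\<gamma> + e)) * x powr (- (\<gamma>' - 2 * e + \<delta>)) * x powr (a * D * q))"
      unfolding Q_def by (simp only: mult_ac)
    also have "x powr ((1 + \<beta> * e) * (\<gamma> + e)) * x powr (- (\<gamma>' - 2 * e + \<delta>)) * x powr (a * D * q) \<le> x powr (- \<theta>)"
    proof -
      \<comment> \<open>The norm decay of the heat kernel and the volume factor both contain
        \<open>\<delta>\<close> and cancel; what remains is \<open>\<gamma> - \<gamma>'\<close> plus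
        multiples of \<open>e\<close>.\<close>
      have "(1 + \<beta> * e) * (\<gamma> + e) + - (\<gamma>' - 2 * e + \<delta>) + a * D * q \<le> - \<theta>"
      proof -
        have 1: "a * D * q = \<delta> + e * (D * q)" unfolding aD \<delta>_def by (simp add: algebra_simps)
        have "D * q \<le> D" using q D by (simp add: mult_left_le)
        then have 2: "e * (D * q) \<le> e * D" by (rule mult_left_mono) (use e in simp)
        have "\<beta> * (\<gamma> + e) \<le> \<beta> * 2" using e1 g1 D by (intro mult_left_mono) auto
        then have 3: "e * (\<beta> * (\<gamma> + e)) \<le> e * (\<beta> * 2)" by (rule mult_left_mono) (use e in simp)
        have 4: "(1 + \<beta> * e) * (\<gamma> + e) = \<gamma> + e + e * (\<beta> * (\<gamma> + e))" by (simp add: algebra_simps)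
        have 5: "\<theta> = 3 * e + e * (\<beta> * 2) + e * D" unfolding eD[symmetric] by (simp add: algebra_simps)
        have 6: "\<gamma>' - \<gamma> = 2 * \<theta>" by (simp add: \<theta>_def)
        have "A + - (\<gamma>' - 2 * e + \<delta>) + B \<le> - \<theta>"
          if "B = \<delta> + b1" "b1 \<le> b2" "c1 \<le> c2" "A = \<gamma> + e + c1" "\<theta> = 3 * e + c2 + b2" "\<gamma>' - \<gamma> = 2 * \<theta>"
          for A B b1 b2 c1 c2 :: real
          using that by linarith
        from this[OF 1 2 3 4 5 6] show ?thesis .
      qed
      then show ?thesis unfolding powr_add[symmetric] using x by (intro powr_mono) auto
    qed
    finally show ?thesis
      using K C1 Z H C2 by (simp add: x_def Q_def)
  qed
  have "filterlim (\<lambda>N. 2 * real N + 1) at_top sequentially"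
    by (rule filterlim_at_top_mono[OF filterlim_real_sequentially]) (simp add: always_eventually)
  then have lim: "(\<lambda>N. Q * (2 * real N + 1) powr (- \<theta>)) \<longlonglongrightarrow> Q * 0"
    using \<theta> by (intro tendsto_mult tendsto_const tendsto_neg_powr) auto
  have "1 / 4 \<le> Q * 0"
  proof (rule LIMSEQ_le_const[OF lim])
    obtain N0 :: nat where "2 * C4 \<le> real N0" using real_arch_simple by blast
    then show "\<exists>N. \<forall>n\<ge>N. 1 / 4 \<le> Q * (2 * real n + 1) powr (- \<theta>)"
      by (intro exI[of _ N0] allI impI main) linarith
  qed
  then show False by simp
qed

end

theorem theorem1p3:
  fixes \<mu> :: "'a \<Rightarrow> 'a \<Rightarrow> real" and D :: real
  assumes "D \<ge> 1" and "vicsek_graph D \<mu>"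
  shows "(\<forall>p \<gamma>. 1 < p \<and> 0 < \<gamma> \<and> \<gamma> < gamma_star D p \<longrightarrow> R_ineq \<mu> p \<gamma> \<and> \<not> RR_ineq \<mu> p \<gamma>) \<and>
         (\<forall>p \<gamma>. 1 < p \<and> gamma_star D p < \<gamma> \<and> \<gamma> < 1 \<longrightarrow> \<not> R_ineq \<mu> p \<gamma> \<and> RR_ineq \<mu> p \<gamma>)"
proof -
  interpret vicsek \<mu> D using assms by unfold_locales
  have no: False if p: "1 < p" and g: "0 < \<gamma>" "\<gamma> < \<gamma>'" "\<gamma>' < 1" and RR: "RR_ineq \<mu> p \<gamma>" and R: "R_ineq \<mu> p \<gamma>'" for p \<gamma> \<gamma>'
  proof -
    obtain C where C: "C > 0" "\<And>f. finite {x. f x \<noteq> 0} \<Longrightarrow>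
        Lp_norm \<mu> p (laplacian_power \<mu> \<gamma> f) \<le> ennreal C * Lp_norm \<mu> p (grad_length \<mu> f)"
      using RR by (auto simp: RR_ineq_def)
    obtain C' where C': "C' > 0" "\<And>f. finite {x. f x \<noteq> 0} \<Longrightarrow>
        Lp_norm \<mu> p (grad_length \<mu> f) \<le> ennreal C' * Lp_norm \<mu> p (laplacian_power \<mu> \<gamma>' f)"
      using R by (auto simp: R_ineq_def)
    have "Lp_norm \<mu> p (laplacian_power \<mu> \<gamma> f) \<le> ennreal (C * C') * Lp_norm \<mu> p (laplacian_power \<mu> \<gamma>' f)"
      if "finite {x. f x \<noteq> 0}" for f
    proof -
      have "Lp_norm \<mu> p (laplacian_power \<mu> \<gamma> f) \<le> ennreal C * (ennreal C' * Lp_norm \<mu> p (laplacian_power \<mu> \<gamma>' f))"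
        by (rule order_trans[OF C(2)[OF that] mult_left_mono[OF C'(2)[OF that]]]) simp
      then show ?thesis using C C' by (simp add: ennreal_mult mult.assoc)
    qed
    then show False using laplacian_powers_not_comparable[OF p g, of "C * C'"] C C' by simp
  qed
  have "\<not> RR_ineq \<mu> p \<gamma>" if p: "1 < p" and g: "0 < \<gamma>" "\<gamma> < gamma_star D p" for p \<gamma>
  proof
    assume RR: "RR_ineq \<mu> p \<gamma>"
    \<comment> \<open>A strictly intermediate exponent is needed, because the positive result does
      not reach the critical one.\<close>
    obtain \<gamma>' where g': "\<gamma> < \<gamma>'" "\<gamma>' < gamma_star D p" using dense[OF g(2)] by blast
    then have "R_ineq \<mu> p \<gamma>'" using g by (intro R_ineq_below[OF p]) auto
    then show False using no[OF p g(1) g'(1) _ RR] g' gamma_star_bounds[OF p] by simp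
  qed
  moreover have "\<not> R_ineq \<mu> p \<gamma>" if p: "1 < p" and g: "gamma_star D p < \<gamma>" "\<gamma> < 1" for p \<gamma>
  proof
    assume R: "R_ineq \<mu> p \<gamma>"
    obtain \<gamma>' where g': "gamma_star D p < \<gamma>'" "\<gamma>' < \<gamma>" using dense[OF g(1)] by blast
    then have "RR_ineq \<mu> p \<gamma>'" using g by (intro RR_ineq_above[OF p]) auto
    then show False using no[OF p _ g'(2) g(2) _ R] g' gamma_star_bounds[OF p] by simp
  qed
  ultimately show ?thesis using R_ineq_below RR_ineq_above by blast
qed

end
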